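(* Let $R$ be a discrete valuation ring with fraction field $F$ of characteristic zero, finite residue field, and uniformizer $\pi$. Let $G$ be a finite group, $H$ a subgroup, and $M$ an $R[H]$-lattice such that $FM$ is free of rank $1$ over $F[H]$. Suppose there exist a positive integer $n$ and a subgroup $P$ of $H$ with $\mathfrak{A}(F[H],M)=R[H]+\pi^{-n}R[H]\mathrm{Tr}_P$. Then: (i) $\mathrm{Ind}_H^G\mathfrak{A}(F[H],M)=R[G]+\pi^{-n}R[G]\mathrm{Tr}_P$; (ii) $\mathfrak{A}(F[G],\mathrm{Ind}_H^GM)=R[G]+\pi^{-n}R[G]\mathrm{Tr}_{\mathrm{ncl}_G(P)}$; (iii) $\mathrm{Ind}_H^G\mathfrak{A}(F[H],M)$ is a ring if and only if $P$ is normal in $G$; (iv) if $P$ is normal in $G$ and $M$ is free over $\mathfrak{A}(F[H],M)$, then $\mathrm{Ind}_H^G\mathfrak{A}(F[H],M)$ is free over $\mathfrak{A}(F[G],\mathrm{Ind}_H^GM)$; (v) if $H$ is abelian and normal in $G$ and $\mathrm{Ind}_H^GM$ is projective over $\mathfrak{A}(F[G],\mathrm{Ind}_H^GM)$, then $P$ is normal in $G$.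
   Context: An $R[H]$-lattice is an $R[H]$-module that is finitely generated and torsion-free over $R$. For an $F$-algebra $A$ and lattice $L$ in an $A$-module, $\mathfrak{A}(A,L)=\{\lambda\in A:\lambda L\subseteq L\}$. $\mathrm{Ind}_H^GX=R[G]\otimes_{R[H]}X$; $\mathrm{Ind}_H^GM$ is a lattice in the free rank-one $F[G]$-module $F[G]\otimes_{F[H]}FM$, and $\mathrm{Ind}_H^G\mathfrak{A}(F[H],M)$ is regarded as a subset of $F[G]=F[G]\otimes_{F[H]}F[H]$. For a subgroup $P$, $\mathrm{Tr}_P=\sum_{k\in P}k$ and $\mathrm{ncl}_G(P)$ is the normal closure of $P$ in $G$ (smallest normal subgroup containing $P$). *)

theory Defs
  imports "HOL-Algebra.Ring_Divisibility" "HOL-Algebra.Subrings" "HOL-Algebra.Module" "HOL-Algebra.Free_Abelian_Groups"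
begin

section \<open>Discrete valuation rings\<close>

definition discrete_valuation_ring :: "('a, 'b) ring_scheme \<Rightarrow> bool" where
  "discrete_valuation_ring K \<longleftrightarrow>
     principal_domain K \<and> (\<exists>!I. primeideal I K \<and> I \<noteq> {\<zero>\<^bsub>K\<^esub>})"

definition uniformizer :: "('a, 'b) ring_scheme \<Rightarrow> 'a \<Rightarrow> bool" where
  "uniformizer K p \<longleftrightarrow> p \<in> carrier K \<and> maximalideal (PIdl\<^bsub>K\<^esub> p) K"

definition fraction_field_of :: "('a, 'b) ring_scheme \<Rightarrow> 'a set \<Rightarrow> bool" where
  "fraction_field_of F R \<longleftrightarrow> field F \<and> subring R F \<and>
     (\<forall>x\<in>carrier F. \<exists>a\<in>R. \<exists>b\<in>R - {\<zero>\<^bsub>F\<^esub>}. x = a \<otimes>\<^bsub>F\<^esub> inv\<^bsub>F\<^esub> b)"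

definition char_zero :: "('a, 'b) ring_scheme \<Rightarrow> bool" where
  "char_zero F \<longleftrightarrow> (\<forall>k::nat. 0 < k \<longrightarrow> [k] \<cdot>\<^bsub>F\<^esub> \<one>\<^bsub>F\<^esub> \<noteq> \<zero>\<^bsub>F\<^esub>)"


section \<open>Left modules over arbitrary rings\<close>

text \<open>The library locale \<^locale>\<open>module\<close> is restricted to commutative rings of scalars.  As there, the
  fields \<open>mult\<close> and \<open>one\<close> of the record are irrelevant.\<close>

locale left_module = A?: ring A + M?: abelian_group M
  for A :: "('a, 'e) ring_scheme" (structure) and M :: "('a, 'm, 'r) module_scheme" (structure) +
  assumes smult_closed:
      "\<lbrakk>a \<in> carrier A; x \<in> carrier M\<rbrakk> \<Longrightarrow> a \<odot>\<^bsub>M\<^esub> x \<in> carrier M"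
    and smult_l_distr:
      "\<lbrakk>a \<in> carrier A; b \<in> carrier A; x \<in> carrier M\<rbrakk> \<Longrightarrow>
       (a \<oplus>\<^bsub>A\<^esub> b) \<odot>\<^bsub>M\<^esub> x = a \<odot>\<^bsub>M\<^esub> x \<oplus>\<^bsub>M\<^esub> b \<odot>\<^bsub>M\<^esub> x"
    and smult_r_distr:
      "\<lbrakk>a \<in> carrier A; x \<in> carrier M; y \<in> carrier M\<rbrakk> \<Longrightarrow>
       a \<odot>\<^bsub>M\<^esub> (x \<oplus>\<^bsub>M\<^esub> y) = a \<odot>\<^bsub>M\<^esub> x \<oplus>\<^bsub>M\<^esub> a \<odot>\<^bsub>M\<^esub> y"
    and smult_assoc:
      "\<lbrakk>a \<in> carrier A; b \<in> carrier A; x \<in> carrier M\<rbrakk> \<Longrightarrow>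
       (a \<otimes>\<^bsub>A\<^esub> b) \<odot>\<^bsub>M\<^esub> x = a \<odot>\<^bsub>M\<^esub> (b \<odot>\<^bsub>M\<^esub> x)"
    and smult_one: "x \<in> carrier M \<Longrightarrow> \<one>\<^bsub>A\<^esub> \<odot>\<^bsub>M\<^esub> x = x"

definition left_module_hom ::
    "('a, 'e) ring_scheme \<Rightarrow> ('a, 'm, 'r) module_scheme \<Rightarrow> ('a, 'n, 's) module_scheme \<Rightarrow> ('m \<Rightarrow> 'n) set"
  where
  "left_module_hom A M N = {f \<in> carrier M \<rightarrow> carrier N.
     (\<forall>x\<in>carrier M. \<forall>y\<in>carrier M. f (x \<oplus>\<^bsub>M\<^esub> y) = f x \<oplus>\<^bsub>N\<^esub> f y) \<and>
     (\<forall>a\<in>carrier A. \<forall>x\<in>carrier M. f (a \<odot>\<^bsub>M\<^esub> x) = a \<odot>\<^bsub>N\<^esub> f x)}"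

definition regular_module :: "('a, 'e) ring_scheme \<Rightarrow> ('a, 'a) module" where
  "regular_module A = \<lparr>carrier = carrier A, monoid.mult = monoid.mult A, one = \<one>\<^bsub>A\<^esub>,
     ring.zero = \<zero>\<^bsub>A\<^esub>, add = add A, smult = monoid.mult A\<rparr>"

text \<open>The direct sum of copies of \<open>A\<close> indexed by \<open>I\<close>: finitely supported families.\<close>

definition coproduct_module :: "('a, 'e) ring_scheme \<Rightarrow> 'i set \<Rightarrow> ('a, 'i \<Rightarrow> 'a) module" where
  "coproduct_module A I =
     \<lparr>carrier = {c. (\<forall>i\<in>I. c i \<in> carrier A) \<and> (\<forall>i. i \<notin> I \<longrightarrow> c i = \<zero>\<^bsub>A\<^esub>) \<and> finite {i. c i \<noteq> \<zero>\<^bsub>A\<^esub>}},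
      monoid.mult = (\<lambda>c d i. c i \<otimes>\<^bsub>A\<^esub> d i), one = (\<lambda>i. if i \<in> I then \<one>\<^bsub>A\<^esub> else \<zero>\<^bsub>A\<^esub>),
      ring.zero = (\<lambda>i. \<zero>\<^bsub>A\<^esub>), add = (\<lambda>c d i. c i \<oplus>\<^bsub>A\<^esub> d i), smult = (\<lambda>a c i. a \<otimes>\<^bsub>A\<^esub> c i)\<rparr>"

definition free_on :: "('a, 'e) ring_scheme \<Rightarrow> ('a, 'm, 'r) module_scheme \<Rightarrow> 'i set \<Rightarrow> bool" where
  "free_on A M I \<longleftrightarrow> left_module A M \<and>
     (\<exists>f\<in>left_module_hom A (coproduct_module A I) M.
        bij_betw f (carrier (coproduct_module A I)) (carrier M))"

definition free_of_rank :: "('a, 'e) ring_scheme \<Rightarrow> ('a, 'm, 'r) module_scheme \<Rightarrow> nat \<Rightarrow> bool" where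
  "free_of_rank A M r \<longleftrightarrow> free_on A M {..<r}"

text \<open>Index sets inside the module's own type lose no generality: a basis can serve as the index
  set, and every projective module is a direct summand of the free module on its elements.\<close>

definition free_module :: "('a, 'e) ring_scheme \<Rightarrow> ('a, 'm, 'r) module_scheme \<Rightarrow> bool" where
  "free_module A M \<longleftrightarrow> (\<exists>I::'m set. free_on A M I)"

definition projective_module :: "('a, 'e) ring_scheme \<Rightarrow> ('a, 'm, 'r) module_scheme \<Rightarrow> bool" where
  "projective_module A M \<longleftrightarrow> left_module A M \<and>
     (\<exists>I::'m set. \<exists>s\<in>left_module_hom A M (coproduct_module A I).
        \<exists>p\<in>left_module_hom A (coproduct_module A I) M. \<forall>x\<in>carrier M. p (s x) = x)"

definition finitely_generated :: "('a, 'e) ring_scheme \<Rightarrow> ('a, 'm, 'r) module_scheme \<Rightarrow> bool" where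
  "finitely_generated A M \<longleftrightarrow> (\<exists>S. finite S \<and> S \<subseteq> carrier M \<and>
     (\<forall>x\<in>carrier M. \<exists>c\<in>S \<rightarrow> carrier A. x = (\<Oplus>\<^bsub>M\<^esub>s\<in>S. c s \<odot>\<^bsub>M\<^esub> s)))"

definition torsion_free :: "('a, 'e) ring_scheme \<Rightarrow> ('a, 'm, 'r) module_scheme \<Rightarrow> bool" where
  "torsion_free A M \<longleftrightarrow> (\<forall>a\<in>carrier A. \<forall>x\<in>carrier M.
     a \<odot>\<^bsub>M\<^esub> x = \<zero>\<^bsub>M\<^esub> \<longrightarrow> a = \<zero>\<^bsub>A\<^esub> \<or> x = \<zero>\<^bsub>M\<^esub>)"


section \<open>Group rings\<close>

text \<open>Elements are functions on the whole type vanishing outside the group.  Hence, for a subring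
  \<open>R\<close> of \<open>F\<close> and a subgroup \<open>H\<close> of \<open>G\<close>, the sets \<open>R[H]\<close>, \<open>F[H]\<close>, \<open>R[G]\<close> are literally subsets of
  \<open>F[G]\<close>.  Intended for finite \<open>G\<close>.\<close>

definition group_ring :: "('a, 'e) ring_scheme \<Rightarrow> ('g, 'r) monoid_scheme \<Rightarrow> ('a, 'g \<Rightarrow> 'a) module" where
  "group_ring K G =
     \<lparr>carrier = {a. (\<forall>g\<in>carrier G. a g \<in> carrier K) \<and> (\<forall>g. g \<notin> carrier G \<longrightarrow> a g = \<zero>\<^bsub>K\<^esub>)},
      monoid.mult = (\<lambda>a b g. if g \<in> carrier G
                then \<Oplus>\<^bsub>K\<^esub>h\<in>carrier G. a h \<otimes>\<^bsub>K\<^esub> b (inv\<^bsub>G\<^esub> h \<otimes>\<^bsub>G\<^esub> g) else \<zero>\<^bsub>K\<^esub>),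
      one = (\<lambda>g. if g = \<one>\<^bsub>G\<^esub> then \<one>\<^bsub>K\<^esub> else \<zero>\<^bsub>K\<^esub>),
      ring.zero = (\<lambda>g. \<zero>\<^bsub>K\<^esub>), add = (\<lambda>a b g. a g \<oplus>\<^bsub>K\<^esub> b g), smult = (\<lambda>c a g. c \<otimes>\<^bsub>K\<^esub> a g)\<rparr>"

definition group_elem :: "('a, 'e) ring_scheme \<Rightarrow> 'g \<Rightarrow> 'g \<Rightarrow> 'a" where
  "group_elem K g = (\<lambda>x. if x = g then \<one>\<^bsub>K\<^esub> else \<zero>\<^bsub>K\<^esub>)"

definition trace_elem :: "('a, 'e) ring_scheme \<Rightarrow> ('g, 'r) monoid_scheme \<Rightarrow> 'g set \<Rightarrow> 'g \<Rightarrow> 'a" where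
  "trace_elem K G P = (\<Oplus>\<^bsub>group_ring K G\<^esub>k\<in>P. group_elem K k)"

text \<open>\<open>R[G] + \<pi>\<^sup>-\<^sup>n R[G] Tr\<^sub>P\<close> inside \<open>F[G]\<close>\<close>

definition trace_set :: "'a ring \<Rightarrow> 'a set \<Rightarrow> 'a \<Rightarrow> nat \<Rightarrow> 'g monoid \<Rightarrow> 'g set \<Rightarrow> ('g \<Rightarrow> 'a) set" where
  "trace_set F R p n G P =
     {x \<oplus>\<^bsub>group_ring F G\<^esub>
        (inv\<^bsub>F\<^esub> (p [^]\<^bsub>F\<^esub> n)) \<odot>\<^bsub>group_ring F G\<^esub> (y \<otimes>\<^bsub>group_ring F G\<^esub> trace_elem F G P) | x y.
      x \<in> carrier (group_ring (F\<lparr>carrier := R\<rparr>) G) \<and> y \<in> carrier (group_ring (F\<lparr>carrier := R\<rparr>) G)}"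

definition normal_closure :: "('g, 'r) monoid_scheme \<Rightarrow> 'g set \<Rightarrow> 'g set" where
  "normal_closure G P = \<Inter>{N. N \<lhd> G \<and> P \<subseteq> N}"


section \<open>Tensor products\<close>

text \<open>For a subring \<open>B\<close> of \<open>A\<close> and a left \<open>B\<close>-module \<open>X\<close>, the abelian group \<open>A \<otimes>\<^sub>B X\<close> is the free
  abelian group on \<open>A \<times> X\<close> modulo the usual relations; its elements are cosets.\<close>

type_synonym ('a, 'x) tensor = "('a \<times> 'x \<Rightarrow>\<^sub>0 int) set"

definition tensor_relations ::
    "('a, 'e) ring_scheme \<Rightarrow> ('a, 'f) ring_scheme \<Rightarrow> ('a, 'x, 'r) module_scheme \<Rightarrow> ('a \<times> 'x \<Rightarrow>\<^sub>0 int) set"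
  where
  "tensor_relations A B X =
     {frag_of (a \<oplus>\<^bsub>A\<^esub> a', x) - frag_of (a, x) - frag_of (a', x) | a a' x.
        a \<in> carrier A \<and> a' \<in> carrier A \<and> x \<in> carrier X} \<union>
     {frag_of (a, x \<oplus>\<^bsub>X\<^esub> x') - frag_of (a, x) - frag_of (a, x') | a x x'.
        a \<in> carrier A \<and> x \<in> carrier X \<and> x' \<in> carrier X} \<union>
     {frag_of (a \<otimes>\<^bsub>A\<^esub> b, x) - frag_of (a, b \<odot>\<^bsub>X\<^esub> x) | a b x.
        a \<in> carrier A \<and> b \<in> carrier B \<and> x \<in> carrier X}"

definition tensor_kernel ::
    "('a, 'e) ring_scheme \<Rightarrow> ('a, 'f) ring_scheme \<Rightarrow> ('a, 'x, 'r) module_scheme \<Rightarrow> ('a, 'x) tensor"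
  where
  "tensor_kernel A B X =
     generate (free_Abelian_group (carrier A \<times> carrier X)) (tensor_relations A B X)"

definition tensor_group ::
    "('a, 'e) ring_scheme \<Rightarrow> ('a, 'f) ring_scheme \<Rightarrow> ('a, 'x, 'r) module_scheme \<Rightarrow> ('a, 'x) tensor monoid"
  where
  "tensor_group A B X = free_Abelian_group (carrier A \<times> carrier X) Mod tensor_kernel A B X"

definition pure_tensor ::
    "('a, 'e) ring_scheme \<Rightarrow> ('a, 'f) ring_scheme \<Rightarrow> ('a, 'x, 'r) module_scheme \<Rightarrow> 'a \<Rightarrow> 'x \<Rightarrow> ('a, 'x) tensor"
  where
  "pure_tensor A B X a x =
     tensor_kernel A B X #>\<^bsub>free_Abelian_group (carrier A \<times> carrier X)\<^esub> frag_of (a, x)"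

text \<open>The map into a quotient with kernel \<open>N\<close> that is induced by the values \<open>f\<close> on generators.  If
  \<open>f\<close> respects the relations, all representatives \<open>c\<close> of the coset \<open>C\<close> give the same coset.\<close>

definition tensor_map ::
    "('b, 'y) tensor \<Rightarrow> ('a \<times> 'x \<Rightarrow> ('b \<times> 'y \<Rightarrow>\<^sub>0 int)) \<Rightarrow> ('a, 'x) tensor \<Rightarrow> ('b, 'y) tensor" where
  "tensor_map N f C = (\<Union>c\<in>C. N #>\<^bsub>free_Abelian_group UNIV\<^esub> frag_extend f c)"

text \<open>\<open>A \<otimes>\<^sub>B X\<close> as a left \<open>A\<close>-module; \<open>Ind\<^sub>H\<^sup>G X\<close> is the case \<open>A = R[G]\<close>, \<open>B = R[H]\<close>.\<close>

definition induced_module ::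
    "('a, 'e) ring_scheme \<Rightarrow> ('a, 'f) ring_scheme \<Rightarrow> ('a, 'x, 'r) module_scheme \<Rightarrow> ('a, ('a, 'x) tensor) module"
  where
  "induced_module A B X =
     \<lparr>carrier = carrier (tensor_group A B X), monoid.mult = undefined, one = undefined,
      ring.zero = \<one>\<^bsub>tensor_group A B X\<^esub>, add = monoid.mult (tensor_group A B X),
      smult = (\<lambda>s. tensor_map (tensor_kernel A B X) (\<lambda>(a, x). frag_of (s \<otimes>\<^bsub>A\<^esub> a, x)))\<rparr>"


section \<open>Lattices over group rings\<close>

text \<open>The \<open>K\<close>-module underlying a \<open>K[H]\<close>-module\<close>

definition restrict_to_base ::
    "('a, 'e) ring_scheme \<Rightarrow> ('g, 's) monoid_scheme \<Rightarrow> ('g \<Rightarrow> 'a, 'm, 'r) module_scheme \<Rightarrow> ('a, 'm) module"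
  where
  "restrict_to_base K H M =
     \<lparr>carrier = carrier M, monoid.mult = monoid.mult M, one = \<one>\<^bsub>M\<^esub>, ring.zero = \<zero>\<^bsub>M\<^esub>, add = add M,
      smult = (\<lambda>r x. (r \<odot>\<^bsub>group_ring K H\<^esub> \<one>\<^bsub>group_ring K H\<^esub>) \<odot>\<^bsub>M\<^esub> x)\<rparr>"

definition group_lattice ::
    "('a, 'e) ring_scheme \<Rightarrow> ('g, 's) monoid_scheme \<Rightarrow> ('g \<Rightarrow> 'a, 'm, 'r) module_scheme \<Rightarrow> bool" where
  "group_lattice K H M \<longleftrightarrow> left_module (group_ring K H) M \<and>
     finitely_generated K (restrict_to_base K H M) \<and> torsion_free K (restrict_to_base K H M)"

text \<open>\<open>FM = F \<otimes>\<^sub>R M\<close>, with \<open>\<Sum>\<^sub>h s\<^sub>h h \<in> F[H]\<close> acting by \<open>c \<otimes> m \<mapsto> \<Sum>\<^sub>h (s\<^sub>h c) \<otimes> h m\<close>,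
  and the canonical map \<open>m \<mapsto> 1 \<otimes> m\<close> from \<open>M\<close> to \<open>FM\<close>.\<close>

definition scalar_ext ::
    "'a ring \<Rightarrow> 'a set \<Rightarrow> 'g monoid \<Rightarrow> ('g \<Rightarrow> 'a, 'm) module \<Rightarrow> ('g \<Rightarrow> 'a, ('a, 'm) tensor) module" where
  "scalar_ext F R H M =
     (let K = F\<lparr>carrier := R\<rparr>; X = restrict_to_base K H M in
      \<lparr>carrier = carrier (tensor_group F K X), monoid.mult = undefined, one = undefined,
       ring.zero = \<one>\<^bsub>tensor_group F K X\<^esub>, add = monoid.mult (tensor_group F K X),
       smult = (\<lambda>s. tensor_map (tensor_kernel F K X)
         (\<lambda>(c, m). \<Sum>h\<in>carrier H. frag_of (s h \<otimes>\<^bsub>F\<^esub> c, group_elem K h \<odot>\<^bsub>M\<^esub> m)))\<rparr>)"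

definition scalar_ext_emb ::
    "'a ring \<Rightarrow> 'a set \<Rightarrow> 'g monoid \<Rightarrow> ('g \<Rightarrow> 'a, 'm) module \<Rightarrow> 'm \<Rightarrow> ('a, 'm) tensor" where
  "scalar_ext_emb F R H M m =
     pure_tensor F (F\<lparr>carrier := R\<rparr>) (restrict_to_base (F\<lparr>carrier := R\<rparr>) H M) \<one>\<^bsub>F\<^esub> m"

text \<open>\<open>M\<close> as a subset of \<open>FM\<close>\<close>

definition lattice_in_ext ::
    "'a ring \<Rightarrow> 'a set \<Rightarrow> 'g monoid \<Rightarrow> ('g \<Rightarrow> 'a, 'm) module \<Rightarrow> ('a, 'm) tensor set" where
  "lattice_in_ext F R H M = scalar_ext_emb F R H M ` carrier M"

definition associated_order :: "('a, 'e) ring_scheme \<Rightarrow> ('a, 'v, 'r) module_scheme \<Rightarrow> 'v set \<Rightarrow> 'a set" where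
  "associated_order A V L = {a \<in> carrier A. \<forall>x\<in>L. a \<odot>\<^bsub>V\<^esub> x \<in> L}"

text \<open>For an \<open>F[H]\<close>-module \<open>V\<close> and an \<open>R[H]\<close>-linear map \<open>j\<close> from \<open>X\<close> to \<open>V\<close>: the image of
  \<open>Ind\<^sub>H\<^sup>G X = R[G] \<otimes>\<^bsub>R[H]\<^esub> X\<close> in \<open>F[G] \<otimes>\<^bsub>F[H]\<^esub> V\<close> under \<open>a \<otimes> x \<mapsto> a \<otimes> j x\<close>.\<close>

definition induced_image ::
    "'a ring \<Rightarrow> 'a set \<Rightarrow> 'g monoid \<Rightarrow> 'g set \<Rightarrow> ('g \<Rightarrow> 'a, 'x) module \<Rightarrow> ('x \<Rightarrow> 'v) \<Rightarrow>
     ('g \<Rightarrow> 'a, 'v) module \<Rightarrow> ('g \<Rightarrow> 'a, 'v) tensor set" where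
  "induced_image F R G H X j V =
     tensor_map (tensor_kernel (group_ring F G) (group_ring F (G\<lparr>carrier := H\<rparr>)) V)
        (\<lambda>(a, x). frag_of (a, j x)) `
     carrier (induced_module (group_ring (F\<lparr>carrier := R\<rparr>) G)
        (group_ring (F\<lparr>carrier := R\<rparr>) (G\<lparr>carrier := H\<rparr>)) X)"

definition induced_ambient ::
    "'a ring \<Rightarrow> 'a set \<Rightarrow> 'g monoid \<Rightarrow> 'g set \<Rightarrow> ('g \<Rightarrow> 'a, 'm) module \<Rightarrow>
     ('g \<Rightarrow> 'a, ('g \<Rightarrow> 'a, ('a, 'm) tensor) tensor) module" where
  "induced_ambient F R G H M =
     induced_module (group_ring F G) (group_ring F (G\<lparr>carrier := H\<rparr>))
       (scalar_ext F R (G\<lparr>carrier := H\<rparr>) M)"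

text \<open>\<open>Ind\<^sub>H\<^sup>G M\<close> as a subset of \<open>F[G] \<otimes>\<^bsub>F[H]\<^esub> FM\<close>\<close>

definition induced_lattice ::
    "'a ring \<Rightarrow> 'a set \<Rightarrow> 'g monoid \<Rightarrow> 'g set \<Rightarrow> ('g \<Rightarrow> 'a, 'm) module \<Rightarrow>
     ('g \<Rightarrow> 'a, ('a, 'm) tensor) tensor set" where
  "induced_lattice F R G H M =
     induced_image F R G H M (scalar_ext_emb F R (G\<lparr>carrier := H\<rparr>) M)
       (scalar_ext F R (G\<lparr>carrier := H\<rparr>) M)"

text \<open>\<open>Ind\<^sub>H\<^sup>G L\<close> for \<open>L \<subseteq> F[H]\<close>, as a subset of \<open>F[G]\<close>: the identification of \<open>F[G]\<close> with
  \<open>F[G] \<otimes>\<^bsub>F[H]\<^esub> F[H]\<close> sends \<open>x\<close> to \<open>x \<otimes> 1\<close>.\<close>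

definition induced_subset ::
    "'a ring \<Rightarrow> 'a set \<Rightarrow> 'g monoid \<Rightarrow> 'g set \<Rightarrow> ('g \<Rightarrow> 'a) set \<Rightarrow> ('g \<Rightarrow> 'a) set" where
  "induced_subset F R G H L =
     (let FH = group_ring F (G\<lparr>carrier := H\<rparr>) in
      {x \<in> carrier (group_ring F G).
         pure_tensor (group_ring F G) FH (regular_module FH) x \<one>\<^bsub>FH\<^esub>
           \<in> induced_image F R G H ((regular_module FH)\<lparr>carrier := L\<rparr>) (\<lambda>y. y) (regular_module FH)})"

text \<open>\<open>\<AA>(F[H], M)\<close>\<close>

definition lattice_order :: "'a ring \<Rightarrow> 'a set \<Rightarrow> 'g monoid \<Rightarrow> ('g \<Rightarrow> 'a, 'm) module \<Rightarrow> ('g \<Rightarrow> 'a) set" where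
  "lattice_order F R H M =
     associated_order (group_ring F H) (scalar_ext F R H M) (lattice_in_ext F R H M)"

text \<open>\<open>\<AA>(F[G], Ind\<^sub>H\<^sup>G M)\<close>\<close>

definition induced_lattice_order ::
    "'a ring \<Rightarrow> 'a set \<Rightarrow> 'g monoid \<Rightarrow> 'g set \<Rightarrow> ('g \<Rightarrow> 'a, 'm) module \<Rightarrow> ('g \<Rightarrow> 'a) set" where
  "induced_lattice_order F R G H M =
     associated_order (group_ring F G) (induced_ambient F R G H M) (induced_lattice F R G H M)"

end

theory Submission
  imports Defs
begin

text \<open>Put \<open>c = \<pi>\<^sup>n\<close>.  The set \<open>T\<^sub>P = R[G] + c\<^sup>-\<^sup>1R[G]Tr\<^sub>P\<close> consists of the elements of \<open>c\<^sup>-\<^sup>1R[G]\<close> whose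
  coefficients are, modulo \<open>R\<close>, constant on the left cosets of \<open>P\<close>.

  A basis vector of \<open>FM\<close> identifies \<open>M\<close> with a lattice \<open>L\<close> in \<open>F[H]\<close> and \<open>Ind M\<close> with \<open>R[G]L\<close>, the set of
  all elements of \<open>F[G]\<close> whose parts on the left cosets \<open>gH\<close> lie in \<open>gL\<close>.  Taking parts is right
  \<open>F[H]\<close>-linear, so \<open>a L \<subseteq> R[G]L\<close> holds iff \<open>a \<in> T\<^sub>P\<close>; hence \<open>a\<close> stabilises \<open>R[G]L\<close> iff \<open>a g \<in> T\<^sub>P\<close> for all
  \<open>g\<close>, that is, iff the coefficients of \<open>a\<close> are constant modulo \<open>R\<close> on the cosets of every conjugate of \<open>P\<close>,
  and so on those of the normal closure \<open>N\<close>.  If \<open>T\<^sub>P\<close> is a ring, then \<open>c\<^sup>-\<^sup>1Tr\<^sub>P g \<in> T\<^sub>P\<close> forces \<open>Pg = gP\<close>.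

  If \<open>R[G]L\<close> is projective over \<open>T\<^sub>N\<close>, a dual basis gives \<open>\<Sum>\<^sub>i c\<^sub>i e\<^sub>i = 1\<close> with \<open>e\<^sub>i \<in> R[G]L\<close> and
  \<open>L c\<^sub>i \<subseteq> T\<^sub>N\<close>.  For abelian \<open>H\<close> the \<open>H\<close>-part of this identity can be multiplied by any \<open>s\<close> stabilising \<open>L\<close>
  and \<open>s\<close> be moved to the \<open>e\<^sub>i\<close>; this gives \<open>s \<in> T\<^sub>N\<close>.  For \<open>s = c\<^sup>-\<^sup>1Tr\<^sub>P\<close> it follows that \<open>N = P\<close>.\<close>

section \<open>Group rings of finite groups\<close>

text \<open>Whatever recovers a subgroup from its order rests on the inverse of \<open>c\<close> not
  lying in R, which holds because \<open>n\<close> is positive and \<open>\<pi>\<close> is not a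
  unit: the jump of \<open>c\<^sup>-\<^sup>1Tr\<^sub>P\<close> between coefficients inside and
  outside P is then visible modulo R. The dual basis argument meets the obstacle that L need not
  contain 1. Clearing the denominator of the basis vector gives a nonzero r of R in L, and the
  identity is run for r: \<open>\<Sum>\<^sub>i b\<^sub>i e\<^sub>i = r\<close>, where
  \<open>b\<^sub>i\<close> is the value of the i-th functional at r and
  \<open>x b\<^sub>i = r \<phi>\<^sub>i(x)\<close> for x in L. So
  \<open>b\<^sub>i = r c\<^sub>i\<close>, and r is cancelled at the end. The H-part is used because
  on H the part map is linear over F[H] on both sides; normality of H enters through N \<subseteq>
  H, which makes membership in \<open>T\<^sub>N\<close> testable on parts. Tensor products are
  quotients of free abelian groups whose scalar actions are unions over representatives. They serve
  to produce coordinates: for a free generator e every tensor is a \<otimes> e for a unique a, and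
  the rest is computation in F[G].\<close>

lemma (in abelian_monoid) finsum_swap:
  assumes "finite A" "finite B" "\<And>i j. i \<in> A \<Longrightarrow> j \<in> B \<Longrightarrow> f i j \<in> carrier G"
  shows "(\<Oplus>i\<in>A. \<Oplus>j\<in>B. f i j) = (\<Oplus>j\<in>B. \<Oplus>i\<in>A. f i j)"
  using assms(1,3)
proof (induction A)
  case (insert a A)
  have "(\<Oplus>j\<in>B. \<Oplus>i\<in>insert a A. f i j) = (\<Oplus>j\<in>B. f a j \<oplus> (\<Oplus>i\<in>A. f i j))"
    using insert by (intro finsum_cong') (auto simp: Pi_def)
  also have "\<dots> = (\<Oplus>j\<in>B. f a j) \<oplus> (\<Oplus>j\<in>B. \<Oplus>i\<in>A. f i j)"
    using insert by (intro finsum_addf) auto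
  finally show ?case
    using insert by (auto simp: Pi_def)
qed simp

text \<open>The record update changes the carrier only, so both sides iterate the same addition; for
  infinite \<open>A\<close> both take the default value zero, which lies in \<open>S\<close>. This
  is why products formed in R[G] and in F[G] coincide.\<close>

lemma (in ring) finsum_subring:
  assumes "subring S R" "f \<in> A \<rightarrow> S"
  shows "finsum (R\<lparr>carrier := S\<rparr>) f A = finsum R f A" and "finsum R f A \<in> S"
proof -
  interpret S: ring "R\<lparr>carrier := S\<rparr>"
    using subring_is_ring[OF assms(1)] .
  have "finsum (R\<lparr>carrier := S\<rparr>) f A = finsum R f A \<and> finsum R f A \<in> S"
    using assms(2)
  proof (induction A rule: infinite_finite_induct)
    case (infinite A)
    then show ?case
      using subringE(2)[OF assms(1)] S.finsum_infinite[of A f] by simp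
  next
    case empty
    then show ?case
      using subringE(2)[OF assms(1)] S.finsum_empty[of f] by simp
  next
    case (insert x A)
    have "f \<in> A \<rightarrow> carrier R" "f x \<in> carrier R"
      using insert.prems subringE(1)[OF assms(1)] by auto
    moreover have "finsum (R\<lparr>carrier := S\<rparr>) f (insert x A) = f x \<oplus> finsum (R\<lparr>carrier := S\<rparr>) f A"
      using S.finsum_insert[OF insert.hyps, of f] insert.prems by simp
    ultimately show ?case
      using insert subringE(7)[OF assms(1)] by (simp add: Pi_iff)
  qed
  then show "finsum (R\<lparr>carrier := S\<rparr>) f A = finsum R f A" "finsum R f A \<in> S" by auto
qed

text \<open>With \<open>r\<close> equal to one this is an embedded group element, with
  \<open>g\<close> the identity an embedded scalar; products of both kinds then follow from the same
  two formulas.\<close>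

definition monomial :: "('a, 'e) ring_scheme \<Rightarrow> 'a \<Rightarrow> 'g \<Rightarrow> 'g \<Rightarrow> 'a" where
  "monomial K r g = (\<lambda>x. if x = g then r else \<zero>\<^bsub>K\<^esub>)"

lemma monomial_carrier_update [simp]: "monomial (K\<lparr>carrier := S\<rparr>) r g = monomial K r g"
  by (auto simp: monomial_def)

lemma group_elem_eq_monomial: "group_elem K g = monomial K \<one>\<^bsub>K\<^esub> g"
  by (simp add: group_elem_def monomial_def)

lemma group_ring_carrier_iff:
  "a \<in> carrier (group_ring K G) \<longleftrightarrow>
     (\<forall>g\<in>carrier G. a g \<in> carrier K) \<and> (\<forall>g. g \<notin> carrier G \<longrightarrow> a g = \<zero>\<^bsub>K\<^esub>)"
  by (simp add: group_ring_def)

lemma group_ring_add [simp]: "(a \<oplus>\<^bsub>group_ring K G\<^esub> b) = (\<lambda>g. a g \<oplus>\<^bsub>K\<^esub> b g)"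
  by (simp add: group_ring_def)

lemma group_ring_zero [simp]: "\<zero>\<^bsub>group_ring K G\<^esub> = (\<lambda>g. \<zero>\<^bsub>K\<^esub>)"
  by (simp add: group_ring_def)

lemma group_ring_one: "\<one>\<^bsub>group_ring K G\<^esub> = monomial K \<one>\<^bsub>K\<^esub> \<one>\<^bsub>G\<^esub>"
  by (simp add: group_ring_def monomial_def)

lemma group_ring_smult [simp]: "r \<odot>\<^bsub>group_ring K G\<^esub> a = (\<lambda>g. r \<otimes>\<^bsub>K\<^esub> a g)"
  by (simp add: group_ring_def)

lemma group_ring_mult:
  "(a \<otimes>\<^bsub>group_ring K G\<^esub> b) g =
     (if g \<in> carrier G then \<Oplus>\<^bsub>K\<^esub>h\<in>carrier G. a h \<otimes>\<^bsub>K\<^esub> b (inv\<^bsub>G\<^esub> h \<otimes>\<^bsub>G\<^esub> g) else \<zero>\<^bsub>K\<^esub>)"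
  by (simp add: group_ring_def)

locale finite_group_ring = K?: cring K + G?: group G
  for K :: "('a, 'e) ring_scheme" (structure) and G :: "('g, 'r) monoid_scheme" +
  assumes finite_group: "finite (carrier G)"
begin

abbreviation KG where "KG \<equiv> group_ring K G"

lemma coeff_closed: "a \<in> carrier KG \<Longrightarrow> a g \<in> carrier K"
  by (cases "g \<in> carrier G") (auto simp: group_ring_carrier_iff)

lemma coeff_outside: "a \<in> carrier KG \<Longrightarrow> g \<notin> carrier G \<Longrightarrow> a g = \<zero>"
  by (auto simp: group_ring_carrier_iff)

lemma group_ring_eqI:
  assumes "a \<in> carrier KG" "b \<in> carrier KG" "\<And>g. g \<in> carrier G \<Longrightarrow> a g = b g"
  shows "a = b"
  using assms by (intro ext) (metis coeff_outside)

lemma group_ring_mult_closed: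
  assumes "a \<in> carrier KG" "b \<in> carrier KG"
  shows "a \<otimes>\<^bsub>KG\<^esub> b \<in> carrier KG"
  using assms by (auto simp: group_ring_carrier_iff group_ring_mult intro!: K.finsum_closed)

lemma finsum_shift:
  assumes "k \<in> carrier G" "f \<in> carrier G \<rightarrow> carrier K"
  shows "(\<Oplus>h\<in>carrier G. f h) = (\<Oplus>h\<in>carrier G. f (k \<otimes>\<^bsub>G\<^esub> h))"
proof -
  have "(\<lambda>h. k \<otimes>\<^bsub>G\<^esub> h) ` carrier G = carrier G"
    using assms(1) by (simp add: G.surj_const_mult)
  moreover have "inj_on (\<lambda>h. k \<otimes>\<^bsub>G\<^esub> h) (carrier G)"
    using assms(1) by (simp add: G.inj_on_cmult)
  ultimately show ?thesis
    using K.finsum_reindex[of f "\<lambda>h. k \<otimes>\<^bsub>G\<^esub> h" "carrier G"] assms(2) by simp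
qed

lemma group_ring_mult_assoc:
  assumes a: "a \<in> carrier KG" and b: "b \<in> carrier KG" and c: "c \<in> carrier KG"
  shows "(a \<otimes>\<^bsub>KG\<^esub> b) \<otimes>\<^bsub>KG\<^esub> c = a \<otimes>\<^bsub>KG\<^esub> (b \<otimes>\<^bsub>KG\<^esub> c)"
proof (rule group_ring_eqI)
  fix g assume g: "g \<in> carrier G"
  note cl = coeff_closed[OF a] coeff_closed[OF b] coeff_closed[OF c]
  have "((a \<otimes>\<^bsub>KG\<^esub> b) \<otimes>\<^bsub>KG\<^esub> c) g =
      (\<Oplus>h\<in>carrier G. (\<Oplus>k\<in>carrier G. a k \<otimes> b (inv\<^bsub>G\<^esub> k \<otimes>\<^bsub>G\<^esub> h)) \<otimes> c (inv\<^bsub>G\<^esub> h \<otimes>\<^bsub>G\<^esub> g))"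
    using g cl by (auto simp: group_ring_mult intro!: K.finsum_cong' K.finsum_closed)
  also have "\<dots> = (\<Oplus>h\<in>carrier G. \<Oplus>k\<in>carrier G.
      a k \<otimes> b (inv\<^bsub>G\<^esub> k \<otimes>\<^bsub>G\<^esub> h) \<otimes> c (inv\<^bsub>G\<^esub> h \<otimes>\<^bsub>G\<^esub> g))"
    using cl finite_group by (intro K.finsum_cong' K.finsum_ldistr) (auto intro!: K.finsum_closed)
  also have "\<dots> = (\<Oplus>k\<in>carrier G. \<Oplus>h\<in>carrier G.
      a k \<otimes> b (inv\<^bsub>G\<^esub> k \<otimes>\<^bsub>G\<^esub> h) \<otimes> c (inv\<^bsub>G\<^esub> h \<otimes>\<^bsub>G\<^esub> g))"
    using cl finite_group by (intro K.finsum_swap) auto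
  also have "\<dots> = (\<Oplus>k\<in>carrier G. a k \<otimes> (b \<otimes>\<^bsub>KG\<^esub> c) (inv\<^bsub>G\<^esub> k \<otimes>\<^bsub>G\<^esub> g))"
  proof (intro K.finsum_cong')
    fix k assume k: "k \<in> carrier G"
    have "(\<Oplus>h\<in>carrier G. a k \<otimes> b (inv\<^bsub>G\<^esub> k \<otimes>\<^bsub>G\<^esub> h) \<otimes> c (inv\<^bsub>G\<^esub> h \<otimes>\<^bsub>G\<^esub> g))
      = (\<Oplus>h\<in>carrier G. a k \<otimes> (b (inv\<^bsub>G\<^esub> k \<otimes>\<^bsub>G\<^esub> h) \<otimes> c (inv\<^bsub>G\<^esub> h \<otimes>\<^bsub>G\<^esub> g)))"
      using cl by (intro K.finsum_cong') (auto simp: K.m_assoc)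
    also have "\<dots> = a k \<otimes> (\<Oplus>h\<in>carrier G. b (inv\<^bsub>G\<^esub> k \<otimes>\<^bsub>G\<^esub> h) \<otimes> c (inv\<^bsub>G\<^esub> h \<otimes>\<^bsub>G\<^esub> g))"
      using cl finite_group by (intro K.finsum_rdistr[symmetric]) auto
    \<comment> \<open>Substituting \<open>k h\<close> for \<open>h\<close> makes the inner sum a
      coefficient of \<open>b c\<close>.\<close>
    also have "(\<Oplus>h\<in>carrier G. b (inv\<^bsub>G\<^esub> k \<otimes>\<^bsub>G\<^esub> h) \<otimes> c (inv\<^bsub>G\<^esub> h \<otimes>\<^bsub>G\<^esub> g))
      = (\<Oplus>h\<in>carrier G. b (inv\<^bsub>G\<^esub> k \<otimes>\<^bsub>G\<^esub> (k \<otimes>\<^bsub>G\<^esub> h)) \<otimes> c (inv\<^bsub>G\<^esub> (k \<otimes>\<^bsub>G\<^esub> h) \<otimes>\<^bsub>G\<^esub> g))"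
      using k cl by (intro finsum_shift) auto
    also have "\<dots> = (b \<otimes>\<^bsub>KG\<^esub> c) (inv\<^bsub>G\<^esub> k \<otimes>\<^bsub>G\<^esub> g)"
      using k g cl
      by (auto simp: group_ring_mult G.m_assoc[symmetric] G.inv_mult_group intro!: K.finsum_cong')
    finally show "(\<Oplus>h\<in>carrier G. a k \<otimes> b (inv\<^bsub>G\<^esub> k \<otimes>\<^bsub>G\<^esub> h) \<otimes> c (inv\<^bsub>G\<^esub> h \<otimes>\<^bsub>G\<^esub> g))
      = a k \<otimes> (b \<otimes>\<^bsub>KG\<^esub> c) (inv\<^bsub>G\<^esub> k \<otimes>\<^bsub>G\<^esub> g)" .
  qed (use cl coeff_closed[OF group_ring_mult_closed[OF b c]] in auto)
  also have "\<dots> = (a \<otimes>\<^bsub>KG\<^esub> (b \<otimes>\<^bsub>KG\<^esub> c)) g"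
    using g by (simp add: group_ring_mult)
  finally show "((a \<otimes>\<^bsub>KG\<^esub> b) \<otimes>\<^bsub>KG\<^esub> c) g = (a \<otimes>\<^bsub>KG\<^esub> (b \<otimes>\<^bsub>KG\<^esub> c)) g" .
qed (use assms group_ring_mult_closed in auto)

lemma monomial_closed:
  "r \<in> carrier K \<Longrightarrow> g \<in> carrier G \<Longrightarrow> monomial K r g \<in> carrier KG"
  by (auto simp: group_ring_carrier_iff monomial_def)

lemma monomial_mult:
  assumes "r \<in> carrier K" "h \<in> carrier G" "a \<in> carrier KG"
  shows "monomial K r h \<otimes>\<^bsub>KG\<^esub> a =
    (\<lambda>x. if x \<in> carrier G then r \<otimes> a (inv\<^bsub>G\<^esub> h \<otimes>\<^bsub>G\<^esub> x) else \<zero>)"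
proof
  fix x
  show "(monomial K r h \<otimes>\<^bsub>KG\<^esub> a) x =
    (if x \<in> carrier G then r \<otimes> a (inv\<^bsub>G\<^esub> h \<otimes>\<^bsub>G\<^esub> x) else \<zero>)"
  proof (cases "x \<in> carrier G")
    case True
    have "(\<Oplus>k\<in>carrier G. monomial K r h k \<otimes> a (inv\<^bsub>G\<^esub> k \<otimes>\<^bsub>G\<^esub> x))
      = (\<Oplus>k\<in>carrier G. if h = k then r \<otimes> a (inv\<^bsub>G\<^esub> k \<otimes>\<^bsub>G\<^esub> x) else \<zero>)"
      using assms coeff_closed[OF assms(3)] by (intro K.finsum_cong') (auto simp: monomial_def)
    also have "\<dots> = r \<otimes> a (inv\<^bsub>G\<^esub> h \<otimes>\<^bsub>G\<^esub> x)"
      using assms coeff_closed[OF assms(3)] finite_group by (intro K.finsum_singleton) auto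
    finally show ?thesis
      using True by (simp add: group_ring_mult)
  qed (simp add: group_ring_mult)
qed

lemma mult_monomial:
  assumes "r \<in> carrier K" "h \<in> carrier G" "a \<in> carrier KG"
  shows "a \<otimes>\<^bsub>KG\<^esub> monomial K r h =
    (\<lambda>x. if x \<in> carrier G then a (x \<otimes>\<^bsub>G\<^esub> inv\<^bsub>G\<^esub> h) \<otimes> r else \<zero>)"
proof
  fix x
  show "(a \<otimes>\<^bsub>KG\<^esub> monomial K r h) x =
    (if x \<in> carrier G then a (x \<otimes>\<^bsub>G\<^esub> inv\<^bsub>G\<^esub> h) \<otimes> r else \<zero>)"
  proof (cases "x \<in> carrier G")
    case True
    have *: "inv\<^bsub>G\<^esub> k \<otimes>\<^bsub>G\<^esub> x = h \<longleftrightarrow> x \<otimes>\<^bsub>G\<^esub> inv\<^bsub>G\<^esub> h = k" if "k \<in> carrier G" for k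
      using True that assms(2)
      by (metis G.inv_closed G.inv_solve_left G.inv_solve_right G.m_closed)
    have "(\<Oplus>k\<in>carrier G. a k \<otimes> monomial K r h (inv\<^bsub>G\<^esub> k \<otimes>\<^bsub>G\<^esub> x))
      = (\<Oplus>k\<in>carrier G. if x \<otimes>\<^bsub>G\<^esub> inv\<^bsub>G\<^esub> h = k then a k \<otimes> r else \<zero>)"
      using assms coeff_closed[OF assms(3)] * by (intro K.finsum_cong') (auto simp: monomial_def)
    also have "\<dots> = a (x \<otimes>\<^bsub>G\<^esub> inv\<^bsub>G\<^esub> h) \<otimes> r"
      using assms True coeff_closed[OF assms(3)] finite_group by (intro K.finsum_singleton) auto
    finally show ?thesis
      using True by (simp add: group_ring_mult)
  qed (simp add: group_ring_mult)
qed

lemma group_ring_ring: "ring KG"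
proof (rule ringI)
  show "abelian_group KG"
  proof (rule abelian_groupI)
    fix x assume x: "x \<in> carrier KG"
    show "\<exists>y\<in>carrier KG. y \<oplus>\<^bsub>KG\<^esub> x = \<zero>\<^bsub>KG\<^esub>"
      using x coeff_closed[OF x]
      by (intro bexI[of _ "\<lambda>g. \<ominus> x g"]) (auto simp: group_ring_carrier_iff K.l_neg)
  qed (auto simp: group_ring_carrier_iff fun_eq_iff coeff_closed K.a_assoc intro: K.a_comm)
  show "monoid KG"
  proof (rule monoidI)
    fix x assume x: "x \<in> carrier KG"
    show "\<one>\<^bsub>KG\<^esub> \<otimes>\<^bsub>KG\<^esub> x = x" "x \<otimes>\<^bsub>KG\<^esub> \<one>\<^bsub>KG\<^esub> = x"
      using x coeff_closed[OF x]
      by (auto simp: group_ring_one monomial_mult mult_monomial coeff_outside)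
  qed (auto simp: group_ring_mult_closed group_ring_mult_assoc group_ring_one monomial_closed)
next
  fix x y z assume x: "x \<in> carrier KG" and y: "y \<in> carrier KG" and z: "z \<in> carrier KG"
  note cl = coeff_closed[OF x] coeff_closed[OF y] coeff_closed[OF z]
  have "(\<Oplus>h\<in>carrier G. (x h \<oplus> y h) \<otimes> z (inv\<^bsub>G\<^esub> h \<otimes>\<^bsub>G\<^esub> g)) =
      (\<Oplus>h\<in>carrier G. x h \<otimes> z (inv\<^bsub>G\<^esub> h \<otimes>\<^bsub>G\<^esub> g) \<oplus> y h \<otimes> z (inv\<^bsub>G\<^esub> h \<otimes>\<^bsub>G\<^esub> g))" for g
    using cl by (intro K.finsum_cong') (auto simp: K.l_distr)
  then show "(x \<oplus>\<^bsub>KG\<^esub> y) \<otimes>\<^bsub>KG\<^esub> z = x \<otimes>\<^bsub>KG\<^esub> z \<oplus>\<^bsub>KG\<^esub> y \<otimes>\<^bsub>KG\<^esub> z"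
    using cl by (auto simp: fun_eq_iff group_ring_mult Pi_def K.finsum_addf)
  have "(\<Oplus>h\<in>carrier G. z h \<otimes> (x (inv\<^bsub>G\<^esub> h \<otimes>\<^bsub>G\<^esub> g) \<oplus> y (inv\<^bsub>G\<^esub> h \<otimes>\<^bsub>G\<^esub> g))) =
      (\<Oplus>h\<in>carrier G. z h \<otimes> x (inv\<^bsub>G\<^esub> h \<otimes>\<^bsub>G\<^esub> g) \<oplus> z h \<otimes> y (inv\<^bsub>G\<^esub> h \<otimes>\<^bsub>G\<^esub> g))" for g
    using cl by (intro K.finsum_cong') (auto simp: K.r_distr)
  then show "z \<otimes>\<^bsub>KG\<^esub> (x \<oplus>\<^bsub>KG\<^esub> y) = z \<otimes>\<^bsub>KG\<^esub> x \<oplus>\<^bsub>KG\<^esub> z \<otimes>\<^bsub>KG\<^esub> y"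
    using cl by (auto simp: fun_eq_iff group_ring_mult Pi_def K.finsum_addf)
qed

end

sublocale finite_group_ring \<subseteq> KG: ring "group_ring K G"
  by (rule group_ring_ring)

context finite_group_ring
begin

lemma group_ring_finsum:
  assumes "finite I" "f \<in> I \<rightarrow> carrier KG"
  shows "(\<Oplus>\<^bsub>KG\<^esub>i\<in>I. f i) g = (\<Oplus>i\<in>I. f i g)"
  using assms
proof (induction I)
  case (insert i I)
  then have "(\<lambda>i. f i g) \<in> I \<rightarrow> carrier K" "f i g \<in> carrier K"
    by (auto simp: coeff_closed Pi_iff)
  with insert show ?case by (simp add: Pi_iff)
qed simp

lemma group_ring_a_inv: "a \<in> carrier KG \<Longrightarrow> \<ominus>\<^bsub>KG\<^esub> a = (\<lambda>g. \<ominus> a g)"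
  by (rule KG.minus_equality)
    (auto simp: group_ring_carrier_iff coeff_closed K.l_neg fun_eq_iff)

lemma group_ring_smult_closed:
  "r \<in> carrier K \<Longrightarrow> a \<in> carrier KG \<Longrightarrow> r \<odot>\<^bsub>KG\<^esub> a \<in> carrier KG"
  by (auto simp: group_ring_carrier_iff)

lemma group_ring_smult_eq_mult:
  "r \<in> carrier K \<Longrightarrow> a \<in> carrier KG \<Longrightarrow> r \<odot>\<^bsub>KG\<^esub> a = monomial K r \<one>\<^bsub>G\<^esub> \<otimes>\<^bsub>KG\<^esub> a"
  by (auto simp: monomial_mult coeff_closed coeff_outside)

lemma scalar_central:
  "r \<in> carrier K \<Longrightarrow> a \<in> carrier KG \<Longrightarrow>
    a \<otimes>\<^bsub>KG\<^esub> monomial K r \<one>\<^bsub>G\<^esub> = monomial K r \<one>\<^bsub>G\<^esub> \<otimes>\<^bsub>KG\<^esub> a"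
  by (auto simp: monomial_mult mult_monomial coeff_closed K.m_comm)

lemma smult_one_eq_monomial:
  "r \<in> carrier K \<Longrightarrow> r \<odot>\<^bsub>KG\<^esub> \<one>\<^bsub>KG\<^esub> = monomial K r \<one>\<^bsub>G\<^esub>"
  by (auto simp: group_ring_one monomial_def)

lemma monomial_mult_monomial:
  assumes "r \<in> carrier K" "s \<in> carrier K" "g \<in> carrier G" "h \<in> carrier G"
  shows "monomial K r g \<otimes>\<^bsub>KG\<^esub> monomial K s h = monomial K (r \<otimes> s) (g \<otimes>\<^bsub>G\<^esub> h)"
proof -
  have "inv\<^bsub>G\<^esub> g \<otimes>\<^bsub>G\<^esub> x = h \<longleftrightarrow> x = g \<otimes>\<^bsub>G\<^esub> h" if "x \<in> carrier G" for x
    using assms that by (metis G.inv_closed G.inv_inv G.inv_solve_left)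
  then show ?thesis
    using assms by (auto simp: monomial_mult monomial_closed) (auto simp: monomial_def fun_eq_iff)
qed

lemma sum_of_monomials:
  assumes "a \<in> carrier KG"
  shows "a = (\<Oplus>\<^bsub>KG\<^esub>h\<in>carrier G. monomial K (a h) h)"
proof (rule group_ring_eqI)
  have cl: "(\<lambda>h. monomial K (a h) h) \<in> carrier G \<rightarrow> carrier KG"
    using assms by (auto simp: monomial_closed coeff_closed)
  then show "(\<Oplus>\<^bsub>KG\<^esub>h\<in>carrier G. monomial K (a h) h) \<in> carrier KG"
    by simp
  fix g assume g: "g \<in> carrier G"
  have "(\<Oplus>\<^bsub>KG\<^esub>h\<in>carrier G. monomial K (a h) h) g = (\<Oplus>h\<in>carrier G. monomial K (a h) h g)"
    using cl finite_group by (rule group_ring_finsum[rotated])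
  also have "\<dots> = (\<Oplus>h\<in>carrier G. if g = h then a h else \<zero>)"
    using assms by (intro K.finsum_cong') (auto simp: monomial_def coeff_closed)
  also have "\<dots> = a g"
    using g finite_group assms by (intro K.finsum_singleton) (auto simp: coeff_closed)
  finally show "a g = (\<Oplus>\<^bsub>KG\<^esub>h\<in>carrier G. monomial K (a h) h) g" by simp
qed fact

text \<open>Every element is a finite sum of monomials, so additive statements need be checked for
  one monomial at a time. The rule serves commutativity of F[H] and linearity of the embedding of M
  into FM.\<close>

lemma group_ring_induct [consumes 1, case_names zero add]:
  assumes "a \<in> carrier KG" and "Q \<zero>\<^bsub>KG\<^esub>"
    and "\<And>r h b. \<lbrakk>r \<in> carrier K; h \<in> carrier G; b \<in> carrier KG; Q b\<rbrakk> \<Longrightarrow> Q (monomial K r h \<oplus>\<^bsub>KG\<^esub> b)"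
  shows "Q a"
proof -
  have "Q (\<Oplus>\<^bsub>KG\<^esub>h\<in>I. monomial K (a h) h)" if "finite I" "I \<subseteq> carrier G" for I
    using that
  proof (induction I)
    case (insert i I)
    moreover from insert have "(\<lambda>h. monomial K (a h) h) \<in> I \<rightarrow> carrier KG"
      using assms(1) by (auto simp: monomial_closed coeff_closed)
    moreover from insert have "monomial K (a i) i \<in> carrier KG"
      using assms(1) by (auto simp: monomial_closed coeff_closed)
    ultimately show ?case
      using assms(3)[of "a i" i "\<Oplus>\<^bsub>KG\<^esub>h\<in>I. monomial K (a h) h"] assms(1)
      by (simp add: coeff_closed del: group_ring_add)
  qed (use assms in simp)
  from this[of "carrier G"] show ?thesis
    using sum_of_monomials[OF assms(1)] finite_group by simp
qed

text \<open>Multiplying by the trace on the right sums coefficients over the left coset of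
  \<open>P\<close> through \<open>x\<close>. This is the source of the coset description of
  \<open>trace_set\<close>.\<close>

lemma
  assumes "P \<subseteq> carrier G"
  shows trace_elem_apply: "trace_elem K G P = (\<lambda>x. if x \<in> P then \<one> else \<zero>)"
    and trace_elem_closed: "trace_elem K G P \<in> carrier KG"
    and mult_trace_elem: "\<lbrakk>a \<in> carrier KG; x \<in> carrier G\<rbrakk> \<Longrightarrow>
      (a \<otimes>\<^bsub>KG\<^esub> trace_elem K G P) x = (\<Oplus>k\<in>P. a (x \<otimes>\<^bsub>G\<^esub> inv\<^bsub>G\<^esub> k))"
proof -
  have fin: "finite P"
    using assms finite_group finite_subset by blast
  have cl: "group_elem K \<in> P \<rightarrow> carrier KG"
    using assms by (auto simp: group_elem_eq_monomial monomial_closed)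
  then show "trace_elem K G P \<in> carrier KG"
    by (simp add: trace_elem_def)
  show "trace_elem K G P = (\<lambda>x. if x \<in> P then \<one> else \<zero>)"
  proof
    fix x
    have "trace_elem K G P x = (\<Oplus>k\<in>P. if x = k then \<one> else \<zero>)"
      unfolding trace_elem_def using fin cl by (simp add: group_ring_finsum group_elem_def)
    also have "\<dots> = (if x \<in> P then \<one> else \<zero>)"
    proof (cases "x \<in> P")
      case True
      then show ?thesis
        using K.finsum_singleton[OF True fin, of "\<lambda>_. \<one>"] by simp
    next
      case False
      then have "(\<Oplus>k\<in>P. if x = k then \<one> else \<zero>) = (\<Oplus>k\<in>P. \<zero>)"
        by (intro K.finsum_cong') auto
      with False show ?thesis by simp
    qed
    finally show "trace_elem K G P x = (if x \<in> P then \<one> else \<zero>)" .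
  qed
  assume a: "a \<in> carrier KG" and x: "x \<in> carrier G"
  have "a \<otimes>\<^bsub>KG\<^esub> trace_elem K G P = (\<Oplus>\<^bsub>KG\<^esub>k\<in>P. a \<otimes>\<^bsub>KG\<^esub> group_elem K k)"
    unfolding trace_elem_def using fin cl a by (intro KG.finsum_rdistr) auto
  then have "(a \<otimes>\<^bsub>KG\<^esub> trace_elem K G P) x = (\<Oplus>k\<in>P. (a \<otimes>\<^bsub>KG\<^esub> group_elem K k) x)"
    using fin cl a by (simp add: group_ring_finsum Pi_iff)
  also have "\<dots> = (\<Oplus>k\<in>P. a (x \<otimes>\<^bsub>G\<^esub> inv\<^bsub>G\<^esub> k))"
    using assms a x
    by (intro K.finsum_cong') (auto simp: group_elem_eq_monomial mult_monomial coeff_closed subset_iff)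
  finally show "(a \<otimes>\<^bsub>KG\<^esub> trace_elem K G P) x = (\<Oplus>k\<in>P. a (x \<otimes>\<^bsub>G\<^esub> inv\<^bsub>G\<^esub> k))" .
qed

end

section \<open>Tensor products\<close>

text \<open>Closure is what places the relations in the free abelian group, so one locale covers M,
  FM and the additive subgroups of F[H] stable under R[H]; module laws are brought in where an
  argument uses them.\<close>

locale tensor_data =
  fixes A :: "('a, 'e) ring_scheme" and B :: "('a, 'f) ring_scheme"
    and X :: "('a, 'x, 'r) module_scheme"
  assumes ring_add_closed: "\<lbrakk>a \<in> carrier A; a' \<in> carrier A\<rbrakk> \<Longrightarrow> a \<oplus>\<^bsub>A\<^esub> a' \<in> carrier A"
    and mod_add_closed: "\<lbrakk>x \<in> carrier X; x' \<in> carrier X\<rbrakk> \<Longrightarrow> x \<oplus>\<^bsub>X\<^esub> x' \<in> carrier X"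
    and ring_mult_closed: "\<lbrakk>a \<in> carrier A; b \<in> carrier B\<rbrakk> \<Longrightarrow> a \<otimes>\<^bsub>A\<^esub> b \<in> carrier A"
    and mod_smult_closed: "\<lbrakk>b \<in> carrier B; x \<in> carrier X\<rbrakk> \<Longrightarrow> b \<odot>\<^bsub>X\<^esub> x \<in> carrier X"
begin

abbreviation frags where "frags \<equiv> free_Abelian_group (carrier A \<times> carrier X)"
abbreviation ker where "ker \<equiv> tensor_kernel A B X"
abbreviation cls where "cls c \<equiv> ker #>\<^bsub>frags\<^esub> c"

lemma relations_subset: "tensor_relations A B X \<subseteq> carrier frags"
proof -
  have *: "u - v \<in> carrier frags" if "u \<in> carrier frags" "v \<in> carrier frags" for u v
    using that by (auto dest: subsetD[OF keys_diff])
  show ?thesis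
    unfolding tensor_relations_def
    by (auto simp del: carrier_free_Abelian_group_iff
        intro!: * ring_add_closed mod_add_closed ring_mult_closed mod_smult_closed)
qed

lemma kernel_subgroup: "subgroup ker frags"
  unfolding tensor_kernel_def by (rule group.generate_is_subgroup[OF group_free_Abelian_group relations_subset])

lemma kernel_carrier: "k \<in> ker \<Longrightarrow> k \<in> carrier frags"
  using subgroup.mem_carrier[OF kernel_subgroup] .

lemma kernel_zero: "0 \<in> ker"
  using subgroup.one_closed[OF kernel_subgroup] by simp

lemma kernel_add: "k \<in> ker \<Longrightarrow> l \<in> ker \<Longrightarrow> k + l \<in> ker"
  using subgroup.m_closed[OF kernel_subgroup] by simp

lemma kernel_uminus: "k \<in> ker \<Longrightarrow> - k \<in> ker"
  using subgroup.m_inv_closed[OF kernel_subgroup, of k] kernel_carrier[of k] by simp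

lemma kernel_diff: "k \<in> ker \<Longrightarrow> l \<in> ker \<Longrightarrow> k - l \<in> ker"
  using kernel_add[of k "- l"] kernel_uminus[of l] by simp

lemma kernel_sum: "(\<And>i. i \<in> I \<Longrightarrow> f i \<in> ker) \<Longrightarrow> sum f I \<in> ker"
  by (induction I rule: infinite_finite_induct) (auto simp: kernel_zero kernel_add)

lemma kernel_relation: "r \<in> tensor_relations A B X \<Longrightarrow> r \<in> ker"
  unfolding tensor_kernel_def by (rule generate.incl)

lemma kernel_add_left:
  "\<lbrakk>a \<in> carrier A; a' \<in> carrier A; x \<in> carrier X\<rbrakk> \<Longrightarrow>
    frag_of (a \<oplus>\<^bsub>A\<^esub> a', x) - frag_of (a, x) - frag_of (a', x) \<in> ker"
  by (rule kernel_relation) (auto simp: tensor_relations_def)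

lemma kernel_add_right:
  "\<lbrakk>a \<in> carrier A; x \<in> carrier X; x' \<in> carrier X\<rbrakk> \<Longrightarrow>
    frag_of (a, x \<oplus>\<^bsub>X\<^esub> x') - frag_of (a, x) - frag_of (a, x') \<in> ker"
  by (rule kernel_relation) (auto simp: tensor_relations_def)

lemma kernel_balance:
  "\<lbrakk>a \<in> carrier A; b \<in> carrier B; x \<in> carrier X\<rbrakk> \<Longrightarrow>
    frag_of (a \<otimes>\<^bsub>A\<^esub> b, x) - frag_of (a, b \<odot>\<^bsub>X\<^esub> x) \<in> ker"
  by (rule kernel_relation) (auto simp: tensor_relations_def)

lemma kernel_normal: "ker \<lhd> frags"
  using kernel_subgroup comm_group.normal_iff_subgroup[OF abelian_free_Abelian_group] by blast

text \<open>The operation of a free abelian group is addition of finitely supported functions,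
  whatever the set of generators. Hence the coset formed over \<open>UNIV\<close> in
  \<open>tensor_map\<close> is the same set as the one formed over the actual generators.\<close>

lemma cls_eq: "ker #>\<^bsub>free_Abelian_group S\<^esub> c = (\<lambda>k. k + c) ` ker"
  by (auto simp: r_coset_def)

lemma cls_eq_iff: "cls c = cls d \<longleftrightarrow> c - d \<in> ker"
proof
  assume "cls c = cls d"
  then have "0 + c \<in> (\<lambda>k. k + d) ` ker"
    using kernel_zero unfolding cls_eq by blast
  then show "c - d \<in> ker" by auto
next
  assume *: "c - d \<in> ker"
  have "k + c \<in> (\<lambda>k. k + d) ` ker" if "k \<in> ker" for k
    using kernel_add[OF that *] by (intro image_eqI[of _ _ "k + (c - d)"]) auto
  moreover have "k + d \<in> (\<lambda>k. k + c) ` ker" if "k \<in> ker" for k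
    using kernel_diff[OF that *] by (intro image_eqI[of _ _ "k - (c - d)"]) auto
  ultimately show "cls c = cls d"
    unfolding cls_eq by blast
qed

lemma tensor_carrier: "carrier (tensor_group A B X) = cls ` carrier frags"
  by (simp add: tensor_group_def carrier_FactGroup)

lemma tensor_mult: "cls c \<otimes>\<^bsub>tensor_group A B X\<^esub> cls d = cls (c + d)"
proof -
  have "(\<Union>h\<in>ker. \<Union>k\<in>ker. {h + c + (k + d)}) = (\<lambda>k. k + (c + d)) ` ker"
  proof (intro equalityI subsetI)
    fix z assume "z \<in> (\<lambda>k. k + (c + d)) ` ker"
    then obtain k where "k \<in> ker" "z = k + c + (0 + d)" by (auto simp: add.assoc)
    then show "z \<in> (\<Union>h\<in>ker. \<Union>k\<in>ker. {h + c + (k + d)})" using kernel_zero by blast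
  next
    fix z assume "z \<in> (\<Union>h\<in>ker. \<Union>k\<in>ker. {h + c + (k + d)})"
    then obtain h k where "h \<in> ker" "k \<in> ker" "z = (h + k) + (c + d)" by (auto simp: algebra_simps)
    then show "z \<in> (\<lambda>k. k + (c + d)) ` ker" using kernel_add by blast
  qed
  then show ?thesis
    by (simp add: tensor_group_def set_mult_def cls_eq)
qed

lemma tensor_one: "\<one>\<^bsub>tensor_group A B X\<^esub> = cls 0"
  by (simp add: tensor_group_def cls_eq)

lemma tensor_comm_group: "comm_group (tensor_group A B X)"
  unfolding tensor_group_def
  by (intro comm_group.abelian_FactGroup abelian_free_Abelian_group kernel_subgroup)

lemma pure_tensor_eq: "pure_tensor A B X a x = cls (frag_of (a, x))"
  by (simp add: pure_tensor_def)

lemma pure_tensor_closed: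
  "a \<in> carrier A \<Longrightarrow> x \<in> carrier X \<Longrightarrow> pure_tensor A B X a x \<in> carrier (tensor_group A B X)"
  by (simp add: pure_tensor_eq tensor_carrier)

lemma pure_tensor_add_right:
  "\<lbrakk>a \<in> carrier A; x \<in> carrier X; x' \<in> carrier X\<rbrakk> \<Longrightarrow>
    pure_tensor A B X a (x \<oplus>\<^bsub>X\<^esub> x') = pure_tensor A B X a x \<otimes>\<^bsub>tensor_group A B X\<^esub> pure_tensor A B X a x'"
  using kernel_add_right[of a x x'] by (simp add: pure_tensor_eq tensor_mult cls_eq_iff algebra_simps)

lemma pure_tensor_balance:
  "\<lbrakk>a \<in> carrier A; b \<in> carrier B; x \<in> carrier X\<rbrakk> \<Longrightarrow>
    pure_tensor A B X (a \<otimes>\<^bsub>A\<^esub> b) x = pure_tensor A B X a (b \<odot>\<^bsub>X\<^esub> x)"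
  using kernel_balance[of a b x] by (simp add: pure_tensor_eq cls_eq_iff)

lemma tensor_induct [consumes 1, case_names zero diff pure]:
  assumes "C \<in> carrier (tensor_group A B X)" and "Q (cls 0)"
    and "\<And>c d. \<lbrakk>c \<in> carrier frags; d \<in> carrier frags; Q (cls c); Q (cls d)\<rbrakk> \<Longrightarrow> Q (cls (c - d))"
    and "\<And>a x. \<lbrakk>a \<in> carrier A; x \<in> carrier X\<rbrakk> \<Longrightarrow> Q (cls (frag_of (a, x)))"
  shows "Q C"
proof -
  obtain c where c: "C = cls c" "Poly_Mapping.keys c \<subseteq> carrier A \<times> carrier X"
    using assms(1) by (auto simp: tensor_carrier)
  have "Q (cls c)"
    by (rule free_Abelian_group_induct[OF c(2), of "\<lambda>c. Q (cls c)"]) (use assms in auto)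
  with c show ?thesis by simp
qed

text \<open>Closure under subtraction covers the group operations: \<open>- k\<close> is
  \<open>0 - k\<close>, and a sum is a difference with a negative. Below, the rule shows that maps
  given on generators send relations to relations.\<close>

lemma tensor_kernel_induct:
  assumes "k \<in> ker" and "Q 0" and "\<And>k l. Q k \<Longrightarrow> Q l \<Longrightarrow> Q (k - l)"
    and "\<And>a a' x. \<lbrakk>a \<in> carrier A; a' \<in> carrier A; x \<in> carrier X\<rbrakk> \<Longrightarrow>
      Q (frag_of (a \<oplus>\<^bsub>A\<^esub> a', x) - frag_of (a, x) - frag_of (a', x))"
    and "\<And>a x x'. \<lbrakk>a \<in> carrier A; x \<in> carrier X; x' \<in> carrier X\<rbrakk> \<Longrightarrow>
      Q (frag_of (a, x \<oplus>\<^bsub>X\<^esub> x') - frag_of (a, x) - frag_of (a, x'))"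
    and "\<And>a b x. \<lbrakk>a \<in> carrier A; b \<in> carrier B; x \<in> carrier X\<rbrakk> \<Longrightarrow>
      Q (frag_of (a \<otimes>\<^bsub>A\<^esub> b, x) - frag_of (a, b \<odot>\<^bsub>X\<^esub> x))"
  shows "Q k"
proof -
  have neg: "Q (- k)" if "Q k" for k
    using assms(3)[OF assms(2) that] by simp
  have rel: "Q r" if "r \<in> tensor_relations A B X" for r
    using that assms(4-6) by (auto simp: tensor_relations_def)
  from assms(1) show ?thesis
    unfolding tensor_kernel_def
  proof (induction rule: generate.induct)
    case (inv h)
    then have "inv\<^bsub>frags\<^esub> h = - h"
      using relations_subset by auto
    with inv show ?case by (simp add: neg rel)
  next
    case (eng h1 h2)
    then show ?case using assms(3)[of h1 "- h2"] neg by simp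
  qed (use assms(2) rel in auto)
qed

text \<open>If \<open>f\<close> preserves the relations, changing the representative
  \<open>c\<close> by an element of the kernel does not change the resulting coset, so the union in
  \<open>tensor_map\<close> runs over equal sets; it is not empty because zero lies in the
  kernel.\<close>

lemma tensor_map_cls:
  assumes "tensor_data A' B' X'"
    and "\<And>k. k \<in> ker \<Longrightarrow> frag_extend f k \<in> tensor_kernel A' B' X'"
  shows "tensor_map (tensor_kernel A' B' X') f (cls c) =
    tensor_kernel A' B' X' #>\<^bsub>free_Abelian_group S\<^esub> frag_extend f c"
proof -
  interpret T: tensor_data A' B' X' by fact
  have "T.ker #>\<^bsub>free_Abelian_group UNIV\<^esub> frag_extend f (k + c) = T.cls (frag_extend f c)" if "k \<in> ker" for k
    using assms(2)[OF that] T.cls_eq_iff[of "frag_extend f (k + c)" "frag_extend f c"]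
    by (simp add: T.cls_eq frag_extend_add)
  then have "tensor_map T.ker f (cls c) = T.cls (frag_extend f c)"
    using kernel_zero by (auto simp: tensor_map_def cls_eq)
  then show ?thesis by (simp add: T.cls_eq)
qed

text \<open>The map \<open>\<beta>\<close> extends to the free abelian group. The extension kills
  the three kinds of relations because \<open>\<beta>\<close> is additive in each argument and
  balanced, hence it factors through the quotient.\<close>

lemma tensor_universal:
  assumes "abelian_group Z"
    and cl: "\<And>a x. \<lbrakk>a \<in> carrier A; x \<in> carrier X\<rbrakk> \<Longrightarrow> \<beta> a x \<in> carrier Z"
    and add_left: "\<And>a a' x. \<lbrakk>a \<in> carrier A; a' \<in> carrier A; x \<in> carrier X\<rbrakk> \<Longrightarrow>
      \<beta> (a \<oplus>\<^bsub>A\<^esub> a') x = \<beta> a x \<oplus>\<^bsub>Z\<^esub> \<beta> a' x"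
    and add_right: "\<And>a x x'. \<lbrakk>a \<in> carrier A; x \<in> carrier X; x' \<in> carrier X\<rbrakk> \<Longrightarrow>
      \<beta> a (x \<oplus>\<^bsub>X\<^esub> x') = \<beta> a x \<oplus>\<^bsub>Z\<^esub> \<beta> a x'"
    and balance: "\<And>a b x. \<lbrakk>a \<in> carrier A; b \<in> carrier B; x \<in> carrier X\<rbrakk> \<Longrightarrow>
      \<beta> (a \<otimes>\<^bsub>A\<^esub> b) x = \<beta> a (b \<odot>\<^bsub>X\<^esub> x)"
  obtains \<Phi> where "\<Phi> \<in> hom (tensor_group A B X) (add_monoid Z)"
    and "\<And>a x. \<lbrakk>a \<in> carrier A; x \<in> carrier X\<rbrakk> \<Longrightarrow> \<Phi> (pure_tensor A B X a x) = \<beta> a x"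
proof -
  interpret Z: abelian_group Z by fact
  have "case_prod \<beta> ` (carrier A \<times> carrier X) \<subseteq> carrier (add_monoid Z)"
    using cl by auto
  from comm_group.free_Abelian_group_universal[OF Z.a_comm_group this] obtain h
    where h: "h \<in> hom frags (add_monoid Z)"
      and hof: "\<And>u. u \<in> carrier A \<times> carrier X \<Longrightarrow> h (frag_of u) = case_prod \<beta> u"
    by blast
  interpret h: group_hom frags "add_monoid Z" h
    using h Z.a_group by (simp add: group_hom_def group_hom_axioms_def)
  have frag: "frag_of (a, x) \<in> carrier frags" if "a \<in> carrier A" "x \<in> carrier X" for a x
    using that by simp
  have diff: "u - v \<in> carrier frags" "h (u - v) = h u \<ominus>\<^bsub>Z\<^esub> h v" if "u \<in> carrier frags" "v \<in> carrier frags" for u v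
  proof -
    show "u - v \<in> carrier frags"
      using that by (auto dest: subsetD[OF keys_diff])
    have "h (u \<otimes>\<^bsub>frags\<^esub> inv\<^bsub>frags\<^esub> v) = h u \<oplus>\<^bsub>Z\<^esub> (inv\<^bsub>add_monoid Z\<^esub> h v)"
      using that h.hom_mult[of u "inv\<^bsub>frags\<^esub> v"] h.hom_inv[of v] h.G.inv_closed[of v] by simp
    then show "h (u - v) = h u \<ominus>\<^bsub>Z\<^esub> h v"
      using that by (simp add: a_minus_def a_inv_def)
  qed
  have cancel: "(u \<oplus>\<^bsub>Z\<^esub> v) \<ominus>\<^bsub>Z\<^esub> u \<ominus>\<^bsub>Z\<^esub> v = \<zero>\<^bsub>Z\<^esub>" if "u \<in> carrier Z" "v \<in> carrier Z" for u v
  proof -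
    have "(u \<oplus>\<^bsub>Z\<^esub> v) \<ominus>\<^bsub>Z\<^esub> u \<ominus>\<^bsub>Z\<^esub> v = (u \<oplus>\<^bsub>Z\<^esub> v) \<ominus>\<^bsub>Z\<^esub> (u \<oplus>\<^bsub>Z\<^esub> v)"
      using that by (simp add: a_minus_def Z.minus_add Z.a_assoc)
    then show ?thesis
      using that by (simp add: a_minus_def Z.r_neg)
  qed
  have ker0: "k \<in> carrier frags \<and> h k = \<zero>\<^bsub>Z\<^esub>" if "k \<in> ker" for k
    using that
  proof (rule tensor_kernel_induct)
    show "0 \<in> carrier frags \<and> h 0 = \<zero>\<^bsub>Z\<^esub>" using h.hom_one by simp
  next
    fix k l assume "k \<in> carrier frags \<and> h k = \<zero>\<^bsub>Z\<^esub>" "l \<in> carrier frags \<and> h l = \<zero>\<^bsub>Z\<^esub>"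
    then show "k - l \<in> carrier frags \<and> h (k - l) = \<zero>\<^bsub>Z\<^esub>"
      using diff[of k l] by (simp add: a_minus_def)
  next
    fix a a' x assume "a \<in> carrier A" "a' \<in> carrier A" "x \<in> carrier X"
    then show "frag_of (a \<oplus>\<^bsub>A\<^esub> a', x) - frag_of (a, x) - frag_of (a', x) \<in> carrier frags
        \<and> h (frag_of (a \<oplus>\<^bsub>A\<^esub> a', x) - frag_of (a, x) - frag_of (a', x)) = \<zero>\<^bsub>Z\<^esub>"
      using cancel cl
      by (simp add: diff frag ring_add_closed hof add_left del: carrier_free_Abelian_group_iff)
  next
    fix a x x' assume "a \<in> carrier A" "x \<in> carrier X" "x' \<in> carrier X"
    then show "frag_of (a, x \<oplus>\<^bsub>X\<^esub> x') - frag_of (a, x) - frag_of (a, x') \<in> carrier frags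
        \<and> h (frag_of (a, x \<oplus>\<^bsub>X\<^esub> x') - frag_of (a, x) - frag_of (a, x')) = \<zero>\<^bsub>Z\<^esub>"
      using cancel cl
      by (simp add: diff frag mod_add_closed hof add_right del: carrier_free_Abelian_group_iff)
  next
    fix a b x assume "a \<in> carrier A" "b \<in> carrier B" "x \<in> carrier X"
    then show "frag_of (a \<otimes>\<^bsub>A\<^esub> b, x) - frag_of (a, b \<odot>\<^bsub>X\<^esub> x) \<in> carrier frags
        \<and> h (frag_of (a \<otimes>\<^bsub>A\<^esub> b, x) - frag_of (a, b \<odot>\<^bsub>X\<^esub> x)) = \<zero>\<^bsub>Z\<^esub>"
      by (simp add: diff frag ring_mult_closed mod_smult_closed hof balance cl a_minus_def Z.r_neg
          del: carrier_free_Abelian_group_iff)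
  qed
  have eq: "h u = h v" if "u \<in> carrier frags" "v \<in> carrier frags" "cls u = cls v" for u v
  proof -
    have "h u \<ominus>\<^bsub>Z\<^esub> h v = \<zero>\<^bsub>Z\<^esub>"
      using that ker0[of "u - v"] by (simp add: cls_eq_iff diff del: carrier_free_Abelian_group_iff)
    then show ?thesis
      using that h.hom_closed[of u] h.hom_closed[of v] Z.minus_equality[of "h u" "\<ominus>\<^bsub>Z\<^esub> h v"]
      by (simp add: a_minus_def)
  qed
  from FactGroup_universal[OF h kernel_normal eq] obtain \<Phi>
    where "\<Phi> \<in> hom (tensor_group A B X) (add_monoid Z)" "\<And>c. c \<in> carrier frags \<Longrightarrow> \<Phi> (cls c) = h c"
    unfolding tensor_group_def by blast
  then show thesis
    using that[of \<Phi>] hof frag by (simp add: pure_tensor_eq)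
qed

end

lemma left_module_tensor_data:
  assumes "ring A" "carrier B \<subseteq> carrier A" "left_module B V"
  shows "tensor_data A B V"
proof -
  interpret A: ring A by fact
  interpret V: left_module B V by fact
  show ?thesis
    using assms(2) by unfold_locales (auto intro: V.smult_closed)
qed

text \<open>A basis vector of \<open>V\<close> over \<open>B\<close> is also one of \<open>A \<otimes>\<^sub>B V\<close> over \<open>A\<close>.\<close>

lemma induced_module_free_rank_one:
  fixes A :: "('a, 'e) ring_scheme" and B :: "('a, 'f) ring_scheme" and V :: "('a, 'v, 'r) module_scheme"
  assumes "ring A" "carrier B \<subseteq> carrier A" "left_module B V"
    and mult: "\<And>b c. \<lbrakk>b \<in> carrier B; c \<in> carrier B\<rbrakk> \<Longrightarrow> b \<otimes>\<^bsub>B\<^esub> c = b \<otimes>\<^bsub>A\<^esub> c"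
    and add: "\<And>b c. \<lbrakk>b \<in> carrier B; c \<in> carrier B\<rbrakk> \<Longrightarrow> b \<oplus>\<^bsub>B\<^esub> c = b \<oplus>\<^bsub>A\<^esub> c"
    and one: "\<one>\<^bsub>B\<^esub> = \<one>\<^bsub>A\<^esub>"
    and \<psi>: "\<psi> \<in> left_module_hom B V (regular_module B)" "bij_betw \<psi> (carrier V) (carrier B)"
  obtains \<Phi> where "bij_betw \<Phi> (carrier (induced_module A B V)) (carrier A)"
    and "\<And>x y. \<lbrakk>x \<in> carrier (induced_module A B V); y \<in> carrier (induced_module A B V)\<rbrakk> \<Longrightarrow>
      \<Phi> (x \<oplus>\<^bsub>induced_module A B V\<^esub> y) = \<Phi> x \<oplus>\<^bsub>A\<^esub> \<Phi> y"
    and "\<And>s x. \<lbrakk>s \<in> carrier A; x \<in> carrier (induced_module A B V)\<rbrakk> \<Longrightarrow>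
      s \<odot>\<^bsub>induced_module A B V\<^esub> x \<in> carrier (induced_module A B V) \<and>
      \<Phi> (s \<odot>\<^bsub>induced_module A B V\<^esub> x) = s \<otimes>\<^bsub>A\<^esub> \<Phi> x"
    and "\<And>a v. \<lbrakk>a \<in> carrier A; v \<in> carrier V\<rbrakk> \<Longrightarrow> \<Phi> (pure_tensor A B V a v) = a \<otimes>\<^bsub>A\<^esub> \<psi> v"
proof -
  interpret A: ring A by fact
  interpret V: left_module B V by fact
  interpret T: tensor_data A B V
    using assms(1-3) by (rule left_module_tensor_data)
  let ?T = "tensor_group A B V" and ?I = "induced_module A B V"
  have I: "carrier ?I = carrier ?T" "add ?I = monoid.mult ?T"
    by (simp_all add: induced_module_def)
  have \<psi>B: "\<psi> v \<in> carrier B" if "v \<in> carrier V" for v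
    using that \<psi>(2) by (auto simp: bij_betw_def)
  then have \<psi>A: "\<psi> v \<in> carrier A" if "v \<in> carrier V" for v
    using that assms(2) by blast
  have \<psi>add: "\<psi> (v \<oplus>\<^bsub>V\<^esub> w) = \<psi> v \<oplus>\<^bsub>A\<^esub> \<psi> w" if "v \<in> carrier V" "w \<in> carrier V" for v w
    using \<psi>(1) that \<psi>B by (simp add: left_module_hom_def regular_module_def add)
  have \<psi>smult: "\<psi> (b \<odot>\<^bsub>V\<^esub> v) = b \<otimes>\<^bsub>A\<^esub> \<psi> v" if "b \<in> carrier B" "v \<in> carrier V" for b v
    using \<psi>(1) that \<psi>B by (simp add: left_module_hom_def regular_module_def mult)
  \<comment> \<open>The values on pure tensors multiply \<open>a\<close> by the coordinate of
    \<open>v\<close>; they are balanced because \<open>\<psi>\<close> is linear over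
    \<open>B\<close>.\<close>
  obtain \<Phi> where \<Phi>: "\<Phi> \<in> hom ?T (add_monoid A)"
    and \<Phi>pure: "\<And>a v. \<lbrakk>a \<in> carrier A; v \<in> carrier V\<rbrakk> \<Longrightarrow> \<Phi> (pure_tensor A B V a v) = a \<otimes>\<^bsub>A\<^esub> \<psi> v"
  proof (rule T.tensor_universal[OF A.is_abelian_group, of "\<lambda>a v. a \<otimes>\<^bsub>A\<^esub> \<psi> v"])
    fix a b v assume "a \<in> carrier A" "b \<in> carrier B" "v \<in> carrier V"
    then show "a \<otimes>\<^bsub>A\<^esub> b \<otimes>\<^bsub>A\<^esub> \<psi> v = a \<otimes>\<^bsub>A\<^esub> \<psi> (b \<odot>\<^bsub>V\<^esub> v)"
      using assms(2) \<psi>A by (auto simp: \<psi>smult A.m_assoc subset_iff)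
  qed (auto simp: \<psi>A \<psi>add A.l_distr A.r_distr)
  have \<Phi>add: "\<Phi> (x \<otimes>\<^bsub>?T\<^esub> y) = \<Phi> x \<oplus>\<^bsub>A\<^esub> \<Phi> y" if "x \<in> carrier ?T" "y \<in> carrier ?T" for x y
    using \<Phi> that by (simp add: hom_def)
  have \<Phi>cl: "\<Phi> x \<in> carrier A" if "x \<in> carrier ?T" for x
    using \<Phi> that by (auto simp: hom_def)
  have cls_closed: "T.cls c \<in> carrier ?T" if "c \<in> carrier T.frags" for c
    using that by (auto simp: T.tensor_carrier)
  have diff: "u - v \<in> carrier T.frags" if "u \<in> carrier T.frags" "v \<in> carrier T.frags" for u v
    using that by (auto dest: subsetD[OF keys_diff])
  have \<Phi>diff: "\<Phi> (T.cls (c - d)) = \<Phi> (T.cls c) \<ominus>\<^bsub>A\<^esub> \<Phi> (T.cls d)"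
    if "c \<in> carrier T.frags" "d \<in> carrier T.frags" for c d
  proof -
    have "\<Phi> (T.cls (c - d)) \<oplus>\<^bsub>A\<^esub> \<Phi> (T.cls d) = \<Phi> (T.cls c)"
      using \<Phi>add[of "T.cls (c - d)" "T.cls d"] that
      by (simp add: cls_closed diff T.tensor_mult del: carrier_free_Abelian_group_iff)
    then show ?thesis
      using \<Phi>cl[OF cls_closed] that diff
      by (metis A.add.inv_solve_right A.minus_eq)
  qed
  obtain e where e: "e \<in> carrier V" "\<psi> e = \<one>\<^bsub>A\<^esub>"
    using \<psi>(2) V.A.one_closed one by (metis bij_betw_imp_surj_on imageE)
  \<comment> \<open>The coordinate of \<open>v\<close> moves across the tensor sign:
    \<open>v\<close> is \<open>\<psi> v\<close> times \<open>e\<close>, so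
    \<open>a \<otimes> v\<close> is \<open>(a \<psi> v) \<otimes> e\<close>. Hence
    \<open>a \<mapsto> a \<otimes> e\<close> inverts \<open>\<Phi>\<close>, which settles
    injectivity and surjectivity together.\<close>
  have inv_pure: "x = pure_tensor A B V (\<Phi> x) e" if "x \<in> carrier ?T" for x
    using that
  proof (induction rule: T.tensor_induct)
    case zero
    have "T.cls 0 \<in> carrier ?T" by (rule cls_closed) simp
    then have "\<Phi> (T.cls 0) = \<zero>\<^bsub>A\<^esub>"
      using \<Phi>diff[of 0 0] \<Phi>cl by (simp add: A.r_neg a_minus_def)
    moreover have "T.cls (frag_of (\<zero>\<^bsub>A\<^esub>, e)) = T.cls 0"
      using T.kernel_uminus[OF T.kernel_add_left[of "\<zero>\<^bsub>A\<^esub>" "\<zero>\<^bsub>A\<^esub>" e]] e by (simp add: T.cls_eq_iff)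
    ultimately show ?case by (simp add: T.pure_tensor_eq)
  next
    case (diff c d)
    let ?p = "\<lambda>a. frag_of (a, e)"
    have cd: "\<Phi> (T.cls c) \<in> carrier A" "\<Phi> (T.cls d) \<in> carrier A"
      using diff \<Phi>cl cls_closed by auto
    have 1: "c - ?p (\<Phi> (T.cls c)) \<in> T.ker" "d - ?p (\<Phi> (T.cls d)) \<in> T.ker"
      using diff by (simp_all add: T.pure_tensor_eq T.cls_eq_iff)
    have 2: "?p (\<Phi> (T.cls c)) - ?p (\<Phi> (T.cls c) \<ominus>\<^bsub>A\<^esub> \<Phi> (T.cls d)) - ?p (\<Phi> (T.cls d)) \<in> T.ker"
      using T.kernel_add_left[of "\<Phi> (T.cls c) \<ominus>\<^bsub>A\<^esub> \<Phi> (T.cls d)" "\<Phi> (T.cls d)" e] cd e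
      by (simp add: a_minus_def A.a_assoc A.l_neg)
    have "c - d - ?p (\<Phi> (T.cls c) \<ominus>\<^bsub>A\<^esub> \<Phi> (T.cls d)) \<in> T.ker"
      using T.kernel_add[OF T.kernel_diff[OF 1] 2] by (simp add: algebra_simps)
    then show ?case
      using \<Phi>diff[of c d] diff by (simp add: T.pure_tensor_eq T.cls_eq_iff)
  next
    case (pure a v)
    have "\<psi> (\<psi> v \<odot>\<^bsub>V\<^esub> e) = \<psi> v"
      using pure e \<psi>B \<psi>A by (simp add: \<psi>smult)
    then have "\<psi> v \<odot>\<^bsub>V\<^esub> e = v"
      using \<psi>(2) pure e \<psi>B V.smult_closed by (metis bij_betw_inv_into_left)
    then show ?case
      using pure e \<psi>B T.pure_tensor_balance[of a "\<psi> v" e] \<Phi>pure[of a v] by (simp add: T.pure_tensor_eq)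
  qed
  \<comment> \<open>The value of \<open>tensor_map\<close> is known only after checking that left
    multiplication by \<open>s\<close> preserves the relations; for the balancing relation this is
    associativity in \<open>A\<close>.\<close>
  have smult: "s \<odot>\<^bsub>?I\<^esub> T.cls c = T.cls (frag_extend (\<lambda>(a, x). frag_of (s \<otimes>\<^bsub>A\<^esub> a, x)) c)"
    if s: "s \<in> carrier A" for s c
  proof -
    have "frag_extend (\<lambda>(a, x). frag_of (s \<otimes>\<^bsub>A\<^esub> a, x)) k \<in> T.ker" if "k \<in> T.ker" for k
      using that
    proof (rule T.tensor_kernel_induct)
      fix a a' x assume "a \<in> carrier A" "a' \<in> carrier A" "x \<in> carrier V"
      then show "frag_extend (\<lambda>(a, x). frag_of (s \<otimes>\<^bsub>A\<^esub> a, x))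
          (frag_of (a \<oplus>\<^bsub>A\<^esub> a', x) - frag_of (a, x) - frag_of (a', x)) \<in> T.ker"
        using s T.kernel_add_left[of "s \<otimes>\<^bsub>A\<^esub> a" "s \<otimes>\<^bsub>A\<^esub> a'" x] by (simp add: frag_extend_diff A.r_distr)
    next
      fix a b x assume *: "a \<in> carrier A" "b \<in> carrier B" "x \<in> carrier V"
      then have "b \<in> carrier A" using assms(2) by blast
      then show "frag_extend (\<lambda>(a, x). frag_of (s \<otimes>\<^bsub>A\<^esub> a, x))
          (frag_of (a \<otimes>\<^bsub>A\<^esub> b, x) - frag_of (a, b \<odot>\<^bsub>V\<^esub> x)) \<in> T.ker"
        using s * T.kernel_balance[of "s \<otimes>\<^bsub>A\<^esub> a" b x] by (simp add: frag_extend_diff A.m_assoc)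
    qed (use s in \<open>auto simp: frag_extend_diff T.kernel_zero T.kernel_diff T.kernel_add_right\<close>)
    then show ?thesis
      using T.tensor_map_cls[OF T.tensor_data_axioms] by (simp add: induced_module_def)
  qed
  have \<Phi>smult: "s \<odot>\<^bsub>?I\<^esub> x \<in> carrier ?I \<and> \<Phi> (s \<odot>\<^bsub>?I\<^esub> x) = s \<otimes>\<^bsub>A\<^esub> \<Phi> x"
    if s: "s \<in> carrier A" and x: "x \<in> carrier ?I" for s x
  proof -
    have \<Phi>x: "\<Phi> x \<in> carrier A"
      using x \<Phi>cl by (simp add: I)
    have "s \<odot>\<^bsub>?I\<^esub> x = s \<odot>\<^bsub>?I\<^esub> T.cls (frag_of (\<Phi> x, e))"
      using inv_pure[of x] x by (simp add: I T.pure_tensor_eq)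
    also have "\<dots> = pure_tensor A B V (s \<otimes>\<^bsub>A\<^esub> \<Phi> x) e"
      using s by (simp add: smult T.pure_tensor_eq)
    finally show ?thesis
      using s \<Phi>x e \<Phi>pure[of "s \<otimes>\<^bsub>A\<^esub> \<Phi> x" e] T.pure_tensor_closed[of "s \<otimes>\<^bsub>A\<^esub> \<Phi> x" e] by (simp add: I)
  qed
  have "bij_betw \<Phi> (carrier ?T) (carrier A)"
  proof (rule bij_betw_byWitness[where f' = "\<lambda>a. pure_tensor A B V a e"])
    show "\<forall>x\<in>carrier ?T. pure_tensor A B V (\<Phi> x) e = x"
      using inv_pure by simp
    show "\<forall>a\<in>carrier A. \<Phi> (pure_tensor A B V a e) = a"
      using \<Phi>pure e by simp
    show "\<Phi> ` carrier ?T \<subseteq> carrier A" using \<Phi>cl by auto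
    show "(\<lambda>a. pure_tensor A B V a e) ` carrier A \<subseteq> carrier ?T"
      using e T.pure_tensor_closed by auto
  qed
  then show thesis
    using that[of \<Phi>] \<Phi>add \<Phi>pure \<Phi>smult by (simp add: I)
qed

text \<open>Seen through \<open>\<Phi>\<close>, the image of \<open>A' \<otimes> X\<close> in
  \<open>A \<otimes> V\<close> is the additive group generated by the images of the
  \<open>a \<otimes> j x\<close>. The last two claims are the two halves of this: it lies in every
  subgroup containing these elements, and it contains their finite sums. Working with the image
  avoids any question of injectivity of the map between the tensor products.\<close>

lemma tensor_image_span:
  fixes j :: "'x \<Rightarrow> 'v"
  assumes "tensor_data A' B' X" "tensor_data A B V"
    and A': "carrier A' \<subseteq> carrier A" "\<And>a a'. \<lbrakk>a \<in> carrier A'; a' \<in> carrier A'\<rbrakk> \<Longrightarrow> a \<oplus>\<^bsub>A'\<^esub> a' = a \<oplus>\<^bsub>A\<^esub> a'"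
      "\<And>a b. \<lbrakk>a \<in> carrier A'; b \<in> carrier B'\<rbrakk> \<Longrightarrow> a \<otimes>\<^bsub>A'\<^esub> b = a \<otimes>\<^bsub>A\<^esub> b"
    and B': "carrier B' \<subseteq> carrier B"
    and j: "j \<in> carrier X \<rightarrow> carrier V"
      "\<And>x y. \<lbrakk>x \<in> carrier X; y \<in> carrier X\<rbrakk> \<Longrightarrow> j (x \<oplus>\<^bsub>X\<^esub> y) = j x \<oplus>\<^bsub>V\<^esub> j y"
      "\<And>b x. \<lbrakk>b \<in> carrier B'; x \<in> carrier X\<rbrakk> \<Longrightarrow> j (b \<odot>\<^bsub>X\<^esub> x) = b \<odot>\<^bsub>V\<^esub> j x"
    and "abelian_group Z" and \<Phi>: "\<Phi> \<in> hom (tensor_group A B V) (add_monoid Z)"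
  defines "img \<equiv> tensor_map (tensor_kernel A B V) (\<lambda>(a, x). frag_of (a, j x)) ` carrier (tensor_group A' B' X)"
  shows "img \<subseteq> carrier (tensor_group A B V)"
    and "\<lbrakk>subgroup U (add_monoid Z);
      \<And>a x. \<lbrakk>a \<in> carrier A'; x \<in> carrier X\<rbrakk> \<Longrightarrow> \<Phi> (pure_tensor A B V a (j x)) \<in> U\<rbrakk> \<Longrightarrow> \<Phi> ` img \<subseteq> U"
    and "\<lbrakk>finite I; a \<in> I \<rightarrow> carrier A'; x \<in> I \<rightarrow> carrier X\<rbrakk> \<Longrightarrow>
      (\<Oplus>\<^bsub>Z\<^esub>i\<in>I. \<Phi> (pure_tensor A B V (a i) (j (x i)))) \<in> \<Phi> ` img"
proof -
  interpret S: tensor_data A' B' X by fact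
  interpret T: tensor_data A B V by fact
  interpret Z: abelian_group Z by fact
  let ?f = "\<lambda>(a, x). frag_of (a, j x)"
  have jV: "j x \<in> carrier V" if "x \<in> carrier X" for x
    using j(1) that by blast
  have ker: "frag_extend ?f k \<in> T.ker" if "k \<in> S.ker" for k
    using that
  proof (rule S.tensor_kernel_induct)
    fix a a' x assume "a \<in> carrier A'" "a' \<in> carrier A'" "x \<in> carrier X"
    then show "frag_extend ?f (frag_of (a \<oplus>\<^bsub>A'\<^esub> a', x) - frag_of (a, x) - frag_of (a', x)) \<in> T.ker"
      using A' jV T.kernel_add_left[of a a' "j x"] by (auto simp: frag_extend_diff)
  next
    fix a x x' assume "a \<in> carrier A'" "x \<in> carrier X" "x' \<in> carrier X"
    then show "frag_extend ?f (frag_of (a, x \<oplus>\<^bsub>X\<^esub> x') - frag_of (a, x) - frag_of (a, x')) \<in> T.ker"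
      using A' jV j(2) T.kernel_add_right[of a "j x" "j x'"] by (auto simp: frag_extend_diff)
  next
    fix a b x assume "a \<in> carrier A'" "b \<in> carrier B'" "x \<in> carrier X"
    then show "frag_extend ?f (frag_of (a \<otimes>\<^bsub>A'\<^esub> b, x) - frag_of (a, b \<odot>\<^bsub>X\<^esub> x)) \<in> T.ker"
      using A' B' jV j(3) T.kernel_balance[of a b "j x"]
      by (auto simp: frag_extend_diff subset_iff)
  qed (auto simp: frag_extend_diff T.kernel_zero T.kernel_diff)
  have img: "img = (\<lambda>c. T.cls (frag_extend ?f c)) ` carrier S.frags"
    unfolding img_def S.tensor_carrier image_image
    using S.tensor_map_cls[OF assms(2) ker] by auto
  have ext: "frag_extend ?f c \<in> carrier T.frags" if "c \<in> carrier S.frags" for c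
  proof -
    have "Poly_Mapping.keys c \<subseteq> carrier A' \<times> carrier X" using that by simp
    then show ?thesis
    proof (rule free_Abelian_group_induct)
      fix u assume "u \<in> carrier A' \<times> carrier X"
      then show "frag_extend ?f (frag_of u) \<in> carrier T.frags"
        using A'(1) jV by auto
    next
      fix u v assume "frag_extend ?f u \<in> carrier T.frags" "frag_extend ?f v \<in> carrier T.frags"
      then show "frag_extend ?f (u - v) \<in> carrier T.frags"
        by (auto simp: frag_extend_diff dest: subsetD[OF keys_diff])
    qed simp
  qed
  then show "img \<subseteq> carrier (tensor_group A B V)"
    by (auto simp: img T.tensor_carrier simp del: carrier_free_Abelian_group_iff)
  interpret \<Phi>: group_hom "tensor_group A B V" "add_monoid Z" \<Phi>
    using \<Phi> Z.a_group comm_group.axioms(2)[OF T.tensor_comm_group]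
    by (simp add: group_hom_def group_hom_axioms_def)
  have cls: "T.cls c \<in> carrier (tensor_group A B V)" if "c \<in> carrier T.frags" for c
    using that by (auto simp: T.tensor_carrier)
  have \<Phi>add: "\<Phi> (T.cls (c + d)) = \<Phi> (T.cls c) \<oplus>\<^bsub>Z\<^esub> \<Phi> (T.cls d)"
    if "c \<in> carrier T.frags" "d \<in> carrier T.frags" for c d
    using \<Phi>.hom_mult[OF cls[OF that(1)] cls[OF that(2)]] by (simp add: T.tensor_mult)
  have \<Phi>0: "\<Phi> (T.cls 0) = \<zero>\<^bsub>Z\<^esub>"
    using \<Phi>.hom_one by (simp add: T.tensor_one)
  {
    assume U: "subgroup U (add_monoid Z)"
      and gen: "\<And>a x. \<lbrakk>a \<in> carrier A'; x \<in> carrier X\<rbrakk> \<Longrightarrow> \<Phi> (pure_tensor A B V a (j x)) \<in> U"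
    have "\<Phi> (T.cls (frag_extend ?f c)) \<in> U" if "c \<in> carrier S.frags" for c
    proof -
      have "Poly_Mapping.keys c \<subseteq> carrier A' \<times> carrier X" using that by simp
      then show ?thesis
      proof (rule free_Abelian_group_induct)
        show "\<Phi> (T.cls (frag_extend ?f 0)) \<in> U"
          using \<Phi>0 subgroup.one_closed[OF U] by simp
      next
        fix u assume "u \<in> carrier A' \<times> carrier X"
        then show "\<Phi> (T.cls (frag_extend ?f (frag_of u))) \<in> U"
          using gen by (auto simp: T.pure_tensor_eq)
      next
        fix u v assume uv: "Poly_Mapping.keys u \<subseteq> carrier A' \<times> carrier X" "Poly_Mapping.keys v \<subseteq> carrier A' \<times> carrier X"
          and IH: "\<Phi> (T.cls (frag_extend ?f u)) \<in> U" "\<Phi> (T.cls (frag_extend ?f v)) \<in> U"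
        have c: "frag_extend ?f u \<in> carrier T.frags" "frag_extend ?f v \<in> carrier T.frags"
            "frag_extend ?f (u - v) \<in> carrier T.frags"
          using uv by (auto intro!: ext simp del: carrier_free_Abelian_group_iff)
            (auto dest: subsetD[OF keys_diff])
        have "\<Phi> (T.cls (frag_extend ?f (u - v))) \<oplus>\<^bsub>Z\<^esub> \<Phi> (T.cls (frag_extend ?f v)) = \<Phi> (T.cls (frag_extend ?f u))"
          using \<Phi>add[OF c(3,2)] by (simp add: frag_extend_diff)
        then have "\<Phi> (T.cls (frag_extend ?f (u - v))) =
            \<Phi> (T.cls (frag_extend ?f u)) \<oplus>\<^bsub>Z\<^esub> (\<ominus>\<^bsub>Z\<^esub> \<Phi> (T.cls (frag_extend ?f v)))"
          using \<Phi>.hom_closed[OF cls[OF c(1)]] \<Phi>.hom_closed[OF cls[OF c(2)]] \<Phi>.hom_closed[OF cls[OF c(3)]]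
          by (simp add: Z.add.inv_solve_right)
        then show "\<Phi> (T.cls (frag_extend ?f (u - v))) \<in> U"
          using IH subgroup.m_closed[OF U] subgroup.m_inv_closed[OF U] by (simp add: a_inv_def)
      qed
    qed
    then show "\<Phi> ` img \<subseteq> U" by (auto simp: img simp del: carrier_free_Abelian_group_iff)
  next
    assume "finite I" "a \<in> I \<rightarrow> carrier A'" "x \<in> I \<rightarrow> carrier X"
    then have "\<exists>c\<in>carrier S.frags. (\<Oplus>\<^bsub>Z\<^esub>i\<in>I. \<Phi> (pure_tensor A B V (a i) (j (x i)))) = \<Phi> (T.cls (frag_extend ?f c))"
    proof (induction I)
      case empty
      show ?case using \<Phi>0 by (intro bexI[of _ 0]) auto
    next
      case (insert i I)
      then obtain c where c: "c \<in> carrier S.frags"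
        "(\<Oplus>\<^bsub>Z\<^esub>i\<in>I. \<Phi> (pure_tensor A B V (a i) (j (x i)))) = \<Phi> (T.cls (frag_extend ?f c))" by auto
      have cl: "\<Phi> (pure_tensor A B V (a k) (j (x k))) \<in> carrier Z" if "k \<in> insert i I" for k
        using insert.prems that A'(1) jV \<Phi>.hom_closed[of "pure_tensor A B V (a k) (j (x k))"]
          T.pure_tensor_closed[of "a k" "j (x k)"] by auto
      have i: "frag_of (a i, x i) \<in> carrier S.frags" using insert.prems by auto
      have "(\<Oplus>\<^bsub>Z\<^esub>i\<in>insert i I. \<Phi> (pure_tensor A B V (a i) (j (x i)))) =
          \<Phi> (pure_tensor A B V (a i) (j (x i))) \<oplus>\<^bsub>Z\<^esub> \<Phi> (T.cls (frag_extend ?f c))"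
        using insert.hyps cl c(2) by (subst Z.finsum_insert) auto
      also have "\<dots> = \<Phi> (T.cls (frag_extend ?f (frag_of (a i, x i) + c)))"
        using \<Phi>add[OF ext[OF i] ext[OF c(1)]] by (simp add: frag_extend_add T.pure_tensor_eq)
      finally show ?case
        using i c(1) by (intro bexI[of _ "frag_of (a i, x i) + c"]) (auto dest: subsetD[OF keys_add])
    qed
    then show "(\<Oplus>\<^bsub>Z\<^esub>i\<in>I. \<Phi> (pure_tensor A B V (a i) (j (x i)))) \<in> \<Phi> ` img"
      by (auto simp: img simp del: carrier_free_Abelian_group_iff)
  }
qed

section \<open>Orders attached to subgroups\<close>

lemma (in abelian_group) add_minus_add_cancel:
  assumes "x \<in> carrier G" "y \<in> carrier G" "z \<in> carrier G"
  shows "(x \<oplus> z) \<ominus> (y \<oplus> z) = x \<ominus> y"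
proof -
  have "(x \<oplus> z) \<ominus> (y \<oplus> z) = x \<oplus> (z \<oplus> (\<ominus> z \<oplus> \<ominus> y))"
    using assms by (simp add: a_minus_def minus_add a_assoc a_comm[of "\<ominus> z"])
  then show ?thesis
    using assms by (simp add: a_minus_def r_neg2)
qed


text \<open>The choice defining \<open>\<tau> g\<close> is made from a predicate that depends only
  on the coset of \<open>g\<close>, so \<open>\<tau>\<close> is constant on left cosets; idempotence
  follows because \<open>\<tau> g\<close> lies in the coset of \<open>g\<close>.\<close>

lemma (in group) left_transversal:
  assumes "subgroup P G"
  obtains \<tau> where "\<And>g. g \<in> carrier G \<Longrightarrow> \<tau> g \<in> carrier G"
    and "\<And>g. g \<in> carrier G \<Longrightarrow> inv g \<otimes> \<tau> g \<in> P"
    and "\<And>g k. \<lbrakk>g \<in> carrier G; k \<in> P\<rbrakk> \<Longrightarrow> \<tau> (g \<otimes> k) = \<tau> g"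
    and "\<And>g. g \<in> carrier G \<Longrightarrow> \<tau> (\<tau> g) = \<tau> g"
proof -
  interpret P: subgroup P G by fact
  define \<tau> where "\<tau> g = (SOME x. x \<in> carrier G \<and> inv g \<otimes> x \<in> P)" for g
  have \<tau>: "\<tau> g \<in> carrier G \<and> inv g \<otimes> \<tau> g \<in> P" if "g \<in> carrier G" for g
    unfolding \<tau>_def by (rule someI[of _ g]) (use that in auto)
  have eq: "\<tau> (g \<otimes> k) = \<tau> g" if g: "g \<in> carrier G" and k: "k \<in> P" for g k
  proof -
    have "inv (g \<otimes> k) \<otimes> x \<in> P \<longleftrightarrow> inv g \<otimes> x \<in> P" if x: "x \<in> carrier G" for x
    proof -
      have "inv (g \<otimes> k) \<otimes> x = inv k \<otimes> (inv g \<otimes> x)"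
        using g k x by (simp add: inv_mult_group m_assoc)
      moreover have "k \<otimes> (inv k \<otimes> (inv g \<otimes> x)) = inv g \<otimes> x"
        using g k x by (simp add: m_assoc[symmetric])
      ultimately show ?thesis
        using k by (metis P.m_closed P.m_inv_closed)
    qed
    then show ?thesis unfolding \<tau>_def by metis
  qed
  have "\<tau> (\<tau> g) = \<tau> g" if "g \<in> carrier G" for g
    using eq[of g "inv g \<otimes> \<tau> g"] \<tau>[OF that] that by (simp add: m_assoc[symmetric])
  then show thesis
    using that[of \<tau>] \<tau> eq by blast
qed

lemma (in group)
  assumes "P \<subseteq> carrier G"
  shows normal_closure_normal: "normal_closure G P \<lhd> G"
    and normal_closure_superset: "P \<subseteq> normal_closure G P"
    and normal_closure_minimal: "\<lbrakk>N \<lhd> G; P \<subseteq> N\<rbrakk> \<Longrightarrow> normal_closure G P \<subseteq> N"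
proof -
  let ?S = "{N. N \<lhd> G \<and> P \<subseteq> N}"
  \<comment> \<open>The family of normal subgroups containing \<open>P\<close> must be nonempty,
    since the intersection of the empty family would be the whole type.\<close>
  have "carrier G \<lhd> G"
    by (rule normal_invI) (auto simp: subgroup_self)
  then have ne: "?S \<noteq> {}" using assms by blast
  show "normal_closure G P \<lhd> G"
  proof (rule normal_invI)
    show "subgroup (normal_closure G P) G"
      unfolding normal_closure_def using ne
      by (intro subgroups_Inter) (auto simp: normal_imp_subgroup)
    fix x h assume "x \<in> carrier G" "h \<in> normal_closure G P"
    then show "x \<otimes> h \<otimes> inv x \<in> normal_closure G P"
      by (auto simp: normal_closure_def dest: normal.inv_op_closed2)
  qed
qed (auto simp: normal_closure_def)

text \<open>This is \<open>R[G] + c\<^sup>-\<^sup>1R[G]Tr\<^sub>P\<close>.\<close>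

definition coset_order ::
    "('a, 'e) ring_scheme \<Rightarrow> 'a set \<Rightarrow> 'a \<Rightarrow> ('g, 'r) monoid_scheme \<Rightarrow> 'g set \<Rightarrow> ('g \<Rightarrow> 'a) set" where
  "coset_order F R c G P = {a \<in> carrier (group_ring F G).
     (\<forall>x\<in>carrier G. c \<otimes>\<^bsub>F\<^esub> a x \<in> R) \<and>
     (\<forall>x\<in>carrier G. \<forall>k\<in>P. a x \<ominus>\<^bsub>F\<^esub> a (x \<otimes>\<^bsub>G\<^esub> k) \<in> R)}"

text \<open>\<open>R\<close> is any subring of the field here. What a valuation ring contributes, an
  inverse of \<open>c\<close> outside \<open>R\<close>, enters as an explicit hypothesis where it is
  used, and so do denominators in \<open>R\<close>.\<close>

locale integral_group_ring = field F + FG: finite_group_ring F G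
  for F :: "'a ring" (structure) and G :: "'g monoid" +
  fixes R :: "'a set"
  assumes R_subring: "subring R F"
begin

abbreviation "FG \<equiv> group_ring F G"
abbreviation "RG \<equiv> group_ring (F\<lparr>carrier := R\<rparr>) G"
abbreviation FG_mult (infixl "\<cdot>" 70) where "a \<cdot> b \<equiv> a \<otimes>\<^bsub>FG\<^esub> b"
abbreviation G_mult (infixl "\<star>" 70) where "g \<star> h \<equiv> g \<otimes>\<^bsub>G\<^esub> h"

lemma integral_group_ring_finite: "finite_group_ring (F\<lparr>carrier := R\<rparr>) G"
proof -
  have "cring (F\<lparr>carrier := R\<rparr>)"
    using subcring_iff[OF subringE(1)[OF R_subring]] R_subring
    by (simp add: subcringI')
  then show ?thesis
    unfolding finite_group_ring_def finite_group_ring_axioms_def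
    using FG.finite_group FG.G.is_group by blast
qed

lemma R_closed:
  "r \<in> R \<Longrightarrow> s \<in> R \<Longrightarrow> r \<oplus> s \<in> R" "r \<in> R \<Longrightarrow> s \<in> R \<Longrightarrow> r \<otimes> s \<in> R"
  "r \<in> R \<Longrightarrow> s \<in> R \<Longrightarrow> r \<ominus> s \<in> R" "r \<in> R \<Longrightarrow> \<ominus> r \<in> R" "\<zero> \<in> R" "\<one> \<in> R"
  "r \<in> R \<Longrightarrow> r \<in> carrier F"
  using subringE[OF R_subring] by (auto simp: a_minus_def)

lemma R_power:
  assumes "p \<in> R" "p \<noteq> \<zero>"
  shows "p [^] (m::nat) \<in> R \<and> p [^] m \<noteq> \<zero>"
  by (induction m) (use assms R_closed(2,6,7) in \<open>simp_all add: integral_iff\<close>)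

lemma RG_carrier_iff: "a \<in> carrier RG \<longleftrightarrow> a \<in> carrier FG \<and> (\<forall>g. a g \<in> R)"
  using R_closed(5,7) by (auto simp: group_ring_carrier_iff)

lemma RG_mult:
  assumes "a \<in> carrier RG" "b \<in> carrier RG"
  shows "a \<otimes>\<^bsub>RG\<^esub> b = a \<cdot> b"
  using assms
  by (intro ext) (auto simp: group_ring_mult RG_carrier_iff R_closed intro!: finsum_subring(1)[OF R_subring])

lemma RG_mult_closed:
  assumes "a \<in> carrier RG" "b \<in> carrier RG"
  shows "a \<cdot> b \<in> carrier RG"
  using finite_group_ring.group_ring_mult_closed[OF integral_group_ring_finite assms] RG_mult[OF assms]
  by simp

lemma monomial_RG: "r \<in> R \<Longrightarrow> g \<in> carrier G \<Longrightarrow> monomial F r g \<in> carrier RG"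
  by (simp add: RG_carrier_iff FG.monomial_closed R_closed) (simp add: monomial_def R_closed)

lemma group_elem_RG: "g \<in> carrier G \<Longrightarrow> monomial F \<one> g \<in> carrier RG"
  using R_closed(6) by (rule monomial_RG)

lemma trace_elem_RG: "P \<subseteq> carrier G \<Longrightarrow> trace_elem F G P \<in> carrier RG"
  by (simp add: RG_carrier_iff FG.trace_elem_closed)
    (simp add: FG.trace_elem_apply R_closed)

text \<open>Right multiplication by the inverse of \<open>k\<close> fixes the trace, since
  \<open>P\<close> absorbs \<open>k\<close>, and it moves the coefficient at
  \<open>x \<star> k\<close> to \<open>x\<close>. Associativity transfers this to \<open>y\<close>
  times the trace.\<close>

lemma mult_trace_elem_invariant:
  assumes P: "subgroup P G" and y: "y \<in> carrier FG" and x: "x \<in> carrier G" and k: "k \<in> P"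
  shows "(y \<cdot> trace_elem F G P) (x \<star> k) = (y \<cdot> trace_elem F G P) x"
proof -
  interpret P: subgroup P G by fact
  let ?t = "trace_elem F G P" and ?d = "monomial F \<one> (inv\<^bsub>G\<^esub> k)"
  have t: "?t \<in> carrier FG" and d: "?d \<in> carrier FG"
    using k by (auto simp: FG.trace_elem_closed P.subset FG.monomial_closed)
  have mem: "g \<star> k \<in> P \<longleftrightarrow> g \<in> P" if "g \<in> carrier G" for g
  proof
    assume "g \<star> k \<in> P"
    then have "g \<star> k \<star> inv\<^bsub>G\<^esub> k \<in> P" using k by blast
    then show "g \<in> P" using that k by (simp add: FG.G.m_assoc)
  qed (use k in blast)
  have "?t \<cdot> ?d = ?t"
    using k t mem P.subset
    by (auto simp: FG.mult_monomial FG.coeff_closed) (auto simp: FG.trace_elem_apply fun_eq_iff)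
  then have "(y \<cdot> ?t) \<cdot> ?d = y \<cdot> ?t"
    using y t d by (simp add: FG.KG.m_assoc)
  moreover have "((y \<cdot> ?t) \<cdot> ?d) x = (y \<cdot> ?t) (x \<star> k)"
    using k x y t by (simp add: FG.mult_monomial FG.coeff_closed)
  ultimately show ?thesis by simp
qed

text \<open>In one direction, the trace part is constant on left cosets and becomes integral after
  multiplication by \<open>c\<close>. Conversely, the values of \<open>a\<close> at coset
  representatives determine a trace part, and the remainder is integral because \<open>a\<close> is
  constant on cosets modulo \<open>R\<close>.\<close>

lemma trace_set_eq_coset_order:
  assumes P: "subgroup P G" and p: "p \<in> R" "p \<noteq> \<zero>"
  shows "trace_set F R p n G P = coset_order F R (p [^] n) G P"
proof -
  interpret P: subgroup P G by fact
  define c where "c = p [^] n"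
  have pF: "p \<in> carrier F" using R_closed(7)[OF p(1)] .
  have c: "c \<in> R" "c \<noteq> \<zero>" "c \<in> carrier F"
    using R_power[OF p, of n] pF by (simp_all add: c_def)
  then have ci: "inv\<^bsub>F\<^esub> c \<in> carrier F" "c \<otimes> inv\<^bsub>F\<^esub> c = \<one>" "inv\<^bsub>F\<^esub> c \<otimes> c = \<one>"
    using field_Units by (auto intro: Units_r_inv Units_l_inv)
  let ?t = "trace_elem F G P"
  have tRG: "?t \<in> carrier RG" using P.subset by (rule trace_elem_RG)
  show ?thesis
  proof (intro equalityI subsetI)
    fix z assume "z \<in> trace_set F R p n G P"
    then obtain x y where x: "x \<in> carrier RG" and y: "y \<in> carrier RG"
      and z: "z = (\<lambda>g. x g \<oplus> inv\<^bsub>F\<^esub> c \<otimes> (y \<cdot> ?t) g)"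
      by (auto simp: trace_set_def c_def)
    define w where "w = y \<cdot> ?t"
    have w: "w \<in> carrier RG" unfolding w_def using RG_mult_closed[OF y tRG] .
    have xR: "x g \<in> R" "x g \<in> carrier F" for g using x R_closed(7) by (auto simp: RG_carrier_iff)
    have wR: "w g \<in> R" "w g \<in> carrier F" for g using w R_closed(7) by (auto simp: RG_carrier_iff)
    have "z \<in> carrier FG"
      using x w ci by (auto simp: z group_ring_carrier_iff w_def[symmetric] xR wR)
    moreover have "c \<otimes> z g \<in> R" for g
    proof -
      have "c \<otimes> z g = c \<otimes> x g \<oplus> w g"
        using c ci xR wR by (simp add: z w_def[symmetric] r_distr m_assoc[symmetric])
      then show ?thesis using c xR wR by (simp add: R_closed)
    qed
    moreover have "z g \<ominus> z (g \<star> k) \<in> R" if "g \<in> carrier G" "k \<in> P" for g k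
    proof -
      have "w (g \<star> k) = w g"
        unfolding w_def using y that by (intro mult_trace_elem_invariant[OF P]) (auto simp: RG_carrier_iff)
      then have "z g \<ominus> z (g \<star> k) = x g \<ominus> x (g \<star> k)"
        using ci xR wR by (simp add: z w_def[symmetric] add_minus_add_cancel)
      then show ?thesis using xR by (simp add: R_closed)
    qed
    ultimately show "z \<in> coset_order F R (p [^] n) G P"
      by (simp add: coset_order_def c_def)
  next
    fix a assume "a \<in> coset_order F R (p [^] n) G P"
    then have a: "a \<in> carrier FG" and ac: "\<And>x. x \<in> carrier G \<Longrightarrow> c \<otimes> a x \<in> R"
      and ad: "\<And>x k. \<lbrakk>x \<in> carrier G; k \<in> P\<rbrakk> \<Longrightarrow> a x \<ominus> a (x \<star> k) \<in> R"
      by (auto simp: coset_order_def c_def)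
    obtain \<tau> where \<tau>: "\<And>g. g \<in> carrier G \<Longrightarrow> \<tau> g \<in> carrier G"
      and \<tau>P: "\<And>g. g \<in> carrier G \<Longrightarrow> inv\<^bsub>G\<^esub> g \<star> \<tau> g \<in> P"
      and \<tau>k: "\<And>g k. \<lbrakk>g \<in> carrier G; k \<in> P\<rbrakk> \<Longrightarrow> \<tau> (g \<star> k) = \<tau> g"
      and \<tau>\<tau>: "\<And>g. g \<in> carrier G \<Longrightarrow> \<tau> (\<tau> g) = \<tau> g"
      using FG.G.left_transversal[OF P] by blast
    \<comment> \<open>\<open>y\<close> carries \<open>c \<otimes> a\<close> at the representatives
      alone, so that each coset contributes a single term to the product with the trace.\<close>
    define y where "y = (\<lambda>g. if g \<in> carrier G \<and> \<tau> g = g then c \<otimes> a g else \<zero>)"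
    have y: "y \<in> carrier RG"
      using ac R_closed(5,7) by (auto simp: RG_carrier_iff group_ring_carrier_iff y_def)
    then have yF: "y \<in> carrier FG" by (simp add: RG_carrier_iff)
    have yt: "(y \<cdot> ?t) g = c \<otimes> a (\<tau> g)" if g: "g \<in> carrier G" for g
    proof -
      \<comment> \<open>The only element \<open>k\<close> of \<open>P\<close> for which
        \<open>g\<close> times the inverse of \<open>k\<close> is the chosen representative.\<close>
      let ?k = "inv\<^bsub>G\<^esub> (inv\<^bsub>G\<^esub> g \<star> \<tau> g)"
      have k: "?k \<in> P" "g \<star> inv\<^bsub>G\<^esub> ?k = \<tau> g"
        using \<tau>P[OF g] \<tau>[OF g] g by (auto simp: FG.G.m_assoc[symmetric])
      have "y (g \<star> inv\<^bsub>G\<^esub> k) = (if ?k = k then c \<otimes> a (\<tau> g) else \<zero>)" if "k \<in> P" for k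
      proof (cases "?k = k")
        case True
        then show ?thesis
          using k \<tau>[OF g] \<tau>\<tau>[OF g] by (auto simp: y_def)
      next
        case False
        have "\<tau> (g \<star> inv\<^bsub>G\<^esub> k) = \<tau> g"
          using \<tau>k[OF g, of "inv\<^bsub>G\<^esub> k"] that by simp
        moreover have "\<tau> g \<noteq> g \<star> inv\<^bsub>G\<^esub> k"
        proof
          assume "\<tau> g = g \<star> inv\<^bsub>G\<^esub> k"
          then have "?k = k" using g that by (simp add: FG.G.m_assoc[symmetric])
          with False show False by simp
        qed
        ultimately show ?thesis using False by (simp add: y_def)
      qed
      then have "(y \<cdot> ?t) g = (\<Oplus>k\<in>P. if ?k = k then c \<otimes> a (\<tau> g) else \<zero>)"
        unfolding FG.mult_trace_elem[OF P.subset yF g]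
        using c a by (intro finsum_cong') (auto simp: FG.coeff_closed)
      also have "\<dots> = c \<otimes> a (\<tau> g)"
        using k(1) c a finite_subset[OF P.subset FG.finite_group]
        by (intro finsum_singleton) (auto simp: FG.coeff_closed)
      finally show ?thesis .
    qed
    define x where "x = (\<lambda>g. if g \<in> carrier G then a g \<ominus> a (\<tau> g) else \<zero>)"
    have "a g \<ominus> a (\<tau> g) \<in> R" if "g \<in> carrier G" for g
      using ad[OF that \<tau>P[OF that]] \<tau>[OF that] that by (simp add: FG.G.m_assoc[symmetric])
    then have x: "x \<in> carrier RG"
      using R_closed(5,7) by (auto simp: RG_carrier_iff group_ring_carrier_iff x_def)
    have "a = (\<lambda>g. x g \<oplus> inv\<^bsub>F\<^esub> c \<otimes> (y \<cdot> ?t) g)"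
    proof
      fix g
      show "a g = x g \<oplus> inv\<^bsub>F\<^esub> c \<otimes> (y \<cdot> ?t) g"
      proof (cases "g \<in> carrier G")
        case True
        have "a g \<in> carrier F" "a (\<tau> g) \<in> carrier F" using a by (auto simp: FG.coeff_closed)
        then show ?thesis
          using True c ci by (simp add: yt x_def m_assoc[symmetric] a_minus_def a_assoc l_neg)
      next
        case False
        then show ?thesis
          using a ci by (simp add: x_def group_ring_mult FG.coeff_outside)
      qed
    qed
    then show "a \<in> trace_set F R p n G P"
      unfolding trace_set_def group_ring_add group_ring_smult c_def using x y by blast
  qed
qed

end

section \<open>Closure properties of the orders and recovery of the subgroup\<close>

lemma (in abelian_group) subgroup_finsum_closed:
  assumes "subgroup U (add_monoid G)" "f \<in> I \<rightarrow> U"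
  shows "(\<Oplus>i\<in>I. f i) \<in> U"
  using assms(2)
proof (induction I rule: infinite_finite_induct)
  case (insert i I)
  then have "f \<in> insert i I \<rightarrow> carrier G"
    using subgroup.mem_carrier[OF assms(1)] by auto
  with insert show ?case
    using subgroup.m_closed[OF assms(1)] by (simp add: Pi_iff)
qed (use subgroup.one_closed[OF assms(1)] in simp_all)

lemma (in abelian_group) add_subgroupI:
  assumes "U \<subseteq> carrier G" "\<zero> \<in> U" "\<And>x y. \<lbrakk>x \<in> U; y \<in> U\<rbrakk> \<Longrightarrow> x \<oplus> y \<in> U" "\<And>x. x \<in> U \<Longrightarrow> \<ominus> x \<in> U"
  shows "subgroup U (add_monoid G)"
  using assms by (intro add.subgroupI) auto

lemma add_subgroup_a_inv_closed:
  "subgroup U (add_monoid A) \<Longrightarrow> x \<in> U \<Longrightarrow> \<ominus>\<^bsub>A\<^esub> x \<in> U"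
  unfolding a_inv_def by (rule subgroup.m_inv_closed)

context integral_group_ring
begin

lemma coset_order_mem:
  assumes "a \<in> coset_order F R c G P"
  shows "a \<in> carrier FG" "x \<in> carrier G \<Longrightarrow> c \<otimes> a x \<in> R"
    "\<lbrakk>x \<in> carrier G; k \<in> P\<rbrakk> \<Longrightarrow> a x \<ominus> a (x \<star> k) \<in> R"
  using assms by (auto simp: coset_order_def)

lemma coset_order_subgroup:
  assumes "c \<in> carrier F"
  shows "subgroup (coset_order F R c G P) (add_monoid FG)"
proof (rule FG.KG.add_subgroupI)
  show "coset_order F R c G P \<subseteq> carrier FG" "\<zero>\<^bsub>FG\<^esub> \<in> coset_order F R c G P"
    using assms R_closed(5) by (auto simp: coset_order_def group_ring_carrier_iff a_minus_def)
next
  fix a b assume a: "a \<in> coset_order F R c G P" and b: "b \<in> coset_order F R c G P"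
  note ab = coset_order_mem(1)[OF a] coset_order_mem(1)[OF b]
  note cl = FG.coeff_closed[OF ab(1)] FG.coeff_closed[OF ab(2)]
  have "c \<otimes> (a x \<oplus> b x) \<in> R" if "x \<in> carrier G" for x
    using that cl assms coset_order_mem(2)[OF a that] coset_order_mem(2)[OF b that]
    by (simp add: r_distr R_closed)
  moreover have "(a x \<oplus> b x) \<ominus> (a (x \<star> k) \<oplus> b (x \<star> k)) \<in> R"
    if "x \<in> carrier G" "k \<in> P" for x k
  proof -
    have "(u \<oplus> v) \<ominus> (u' \<oplus> v') = (u \<ominus> u') \<oplus> (v \<ominus> v')"
      if "u \<in> carrier F" "v \<in> carrier F" "u' \<in> carrier F" "v' \<in> carrier F" for u v u' v'
      using that by (simp add: a_minus_def minus_add a_ac)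
    then show ?thesis
      using cl coset_order_mem(3)[OF a that] coset_order_mem(3)[OF b that] by (simp add: R_closed)
  qed
  ultimately show "a \<oplus>\<^bsub>FG\<^esub> b \<in> coset_order F R c G P"
    using FG.KG.a_closed[OF ab] by (simp add: coset_order_def)
next
  fix a assume a: "a \<in> coset_order F R c G P"
  note ac = coset_order_mem(1)[OF a]
  note cl = FG.coeff_closed[OF ac]
  have "c \<otimes> (\<ominus> a x) \<in> R" if "x \<in> carrier G" for x
    using that cl assms coset_order_mem(2)[OF a that] by (simp add: r_minus R_closed)
  moreover have "(\<ominus> a x) \<ominus> (\<ominus> a (x \<star> k)) \<in> R" if "x \<in> carrier G" "k \<in> P" for x k
  proof -
    have "(\<ominus> a x) \<ominus> (\<ominus> a (x \<star> k)) = \<ominus> (a x \<ominus> a (x \<star> k))"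
      using cl by (simp add: a_minus_def minus_add)
    then show ?thesis using coset_order_mem(3)[OF a that] by (simp add: R_closed)
  qed
  ultimately show "\<ominus>\<^bsub>FG\<^esub> a \<in> coset_order F R c G P"
    using FG.KG.a_inv_closed[OF ac] by (simp add: coset_order_def FG.group_ring_a_inv[OF ac])
qed

lemma RG_subset_coset_order: "c \<in> R \<Longrightarrow> carrier RG \<subseteq> coset_order F R c G P"
  by (auto simp: coset_order_def RG_carrier_iff R_closed)

text \<open>The point \<open>x k g\<^sup>-\<^sup>1\<close> is \<open>x g\<^sup>-\<^sup>1\<close>
  times a conjugate of \<open>k\<close>, which stays in the normal subgroup.\<close>

lemma coset_order_mult_group_elem:
  assumes "N \<lhd> G" "a \<in> coset_order F R c G N" "g \<in> carrier G"
  shows "a \<cdot> monomial F \<one> g \<in> coset_order F R c G N"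
proof -
  note a = coset_order_mem[OF assms(2)]
  interpret N: normal N G by fact
  have "a (x \<star> inv\<^bsub>G\<^esub> g) \<ominus> a (x \<star> k \<star> inv\<^bsub>G\<^esub> g) \<in> R" if "x \<in> carrier G" "k \<in> N" for x k
  proof -
    have "x \<star> inv\<^bsub>G\<^esub> g \<star> (g \<star> k \<star> inv\<^bsub>G\<^esub> g) = x \<star> k \<star> inv\<^bsub>G\<^esub> g"
      using that assms(3) by (simp add: FG.G.m_assoc) (simp add: FG.G.m_assoc[symmetric])
    then show ?thesis
      using a(3)[of "x \<star> inv\<^bsub>G\<^esub> g" "g \<star> k \<star> inv\<^bsub>G\<^esub> g"] that assms(3) N.inv_op_closed2 by simp
  qed
  moreover have "a \<cdot> monomial F \<one> g \<in> carrier FG"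
    using a(1) assms(3) by (simp add: FG.monomial_closed)
  ultimately show ?thesis
    using a assms(3) N.subset
    by (auto simp: coset_order_def FG.mult_monomial FG.coeff_closed)
qed

text \<open>The function is \<open>c\<^sup>-\<^sup>1Tr\<^sub>P\<close> written out. It is the test
  element from which subgroups are recovered below.\<close>

lemma scaled_trace_mem:
  assumes P: "subgroup P G" and c: "c \<in> carrier F" "c \<noteq> \<zero>"
  shows "(\<lambda>x. if x \<in> P then inv\<^bsub>F\<^esub> c else \<zero>) \<in> coset_order F R c G P"
proof -
  interpret P: subgroup P G by fact
  have ci: "inv\<^bsub>F\<^esub> c \<in> carrier F" "c \<otimes> inv\<^bsub>F\<^esub> c = \<one>"
    using c field_Units by (auto intro: Units_r_inv)
  have "x \<star> k \<in> P \<longleftrightarrow> x \<in> P" if "x \<in> carrier G" "k \<in> P" for x k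
  proof
    assume "x \<star> k \<in> P"
    then have "x \<star> k \<star> inv\<^bsub>G\<^esub> k \<in> P" using that by blast
    then show "x \<in> P" using that by (simp add: FG.G.m_assoc)
  qed (use that in blast)
  then show ?thesis
    using ci c P.subset R_closed(5,6)
    by (auto simp: coset_order_def group_ring_carrier_iff a_minus_def r_neg)
qed

text \<open>Compare the coefficients of \<open>c\<^sup>-\<^sup>1Tr\<^sub>P\<close> at the identity
  and at \<open>k\<close> in \<open>N\<close>: for \<open>k\<close> outside \<open>P\<close> they
  would differ by the inverse of \<open>c\<close>, which is not in \<open>R\<close>.\<close>

lemma coset_order_trace_imp_subset:
  assumes "(\<lambda>x. if x \<in> P then inv\<^bsub>F\<^esub> c else \<zero>) \<in> coset_order F R c G N"
    and "c \<in> carrier F" "c \<noteq> \<zero>" "inv\<^bsub>F\<^esub> c \<notin> R" "\<one>\<^bsub>G\<^esub> \<in> P" "N \<subseteq> carrier G"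
  shows "N \<subseteq> P"
proof
  fix k assume k: "k \<in> N"
  have "inv\<^bsub>F\<^esub> c \<in> carrier F" using assms(2,3) field_Units by auto
  then show "k \<in> P"
    using coset_order_mem(3)[OF assms(1) _ k, of "\<one>\<^bsub>G\<^esub>"] assms k by (auto simp: a_minus_def split: if_splits)
qed

text \<open>Multiplying \<open>c\<^sup>-\<^sup>1Tr\<^sub>P\<close> by \<open>g\<close> on the right
  gives the coefficient \<open>c\<^sup>-\<^sup>1\<close> at \<open>g\<close>, while the coefficient
  at \<open>g k\<close> is the one that \<open>c\<^sup>-\<^sup>1Tr\<^sub>P\<close> has at
  \<open>g k g\<^sup>-\<^sup>1\<close>. Both must agree modulo \<open>R\<close>, so this conjugate
  lies in \<open>P\<close>.\<close>

lemma coset_order_subring_imp_normal: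
  assumes P: "subgroup P G" and c: "c \<in> R" "c \<noteq> \<zero>" "inv\<^bsub>F\<^esub> c \<notin> R"
    and S: "subring (coset_order F R c G P) FG"
  shows "P \<lhd> G"
proof (rule FG.G.normal_invI[OF P])
  interpret P: subgroup P G by fact
  fix g k assume g: "g \<in> carrier G" and k: "k \<in> P"
  let ?q = "\<lambda>x. if x \<in> P then inv\<^bsub>F\<^esub> c else \<zero>"
  have cF: "c \<in> carrier F" using c R_closed(7) by blast
  have ci: "inv\<^bsub>F\<^esub> c \<in> carrier F" using cF c(2) field_Units by auto
  have q: "?q \<in> coset_order F R c G P" using scaled_trace_mem[OF P cF c(2)] .
  have "?q \<cdot> monomial F \<one> g \<in> coset_order F R c G P"
    using subringE(6)[OF S q] group_elem_RG[OF g] RG_subset_coset_order[OF c(1)] by blast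
  from coset_order_mem(3)[OF this g k]
  have "?q (g \<star> inv\<^bsub>G\<^esub> g) \<ominus> ?q (g \<star> k \<star> inv\<^bsub>G\<^esub> g) \<in> R"
    using g k coset_order_mem(1)[OF q] ci
    by (simp add: FG.mult_monomial del: FG.G.r_inv)
  then show "g \<star> k \<star> inv\<^bsub>G\<^esub> g \<in> P"
    using g ci c(3) by (auto simp: a_minus_def split: if_splits)
qed

text \<open>Membership of \<open>a g\<close> in the order of \<open>P\<close> says that, modulo
  \<open>R\<close>, the elements of \<open>g P g\<^sup>-\<^sup>1\<close> are right periods of
  \<open>a\<close>. The elements all of whose conjugates are periods form a normal subgroup, which
  contains the normal closure as soon as it contains \<open>P\<close>.\<close>

lemma coset_order_normal_closure_iff:
  assumes P: "subgroup P G" and a: "a \<in> carrier FG"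
  shows "a \<in> coset_order F R c G (normal_closure G P) \<longleftrightarrow>
    (\<forall>g\<in>carrier G. a \<cdot> monomial F \<one> g \<in> coset_order F R c G P)"
proof
  have PG: "P \<subseteq> carrier G" using P by (rule subgroup.subset)
  let ?N = "normal_closure G P"
  have sub: "coset_order F R c G ?N \<subseteq> coset_order F R c G P"
    using FG.G.normal_closure_superset[OF PG] by (auto simp: coset_order_def)
  {
    assume "a \<in> coset_order F R c G ?N"
    then show "\<forall>g\<in>carrier G. a \<cdot> monomial F \<one> g \<in> coset_order F R c G P"
      using coset_order_mult_group_elem[OF FG.G.normal_closure_normal[OF PG]] sub by blast
  next
    assume *: "\<forall>g\<in>carrier G. a \<cdot> monomial F \<one> g \<in> coset_order F R c G P"
    note ac = FG.coeff_closed[OF a]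
    have conj: "a x \<ominus> a (x \<star> (g \<star> k \<star> inv\<^bsub>G\<^esub> g)) \<in> R"
      if x: "x \<in> carrier G" and g: "g \<in> carrier G" and k: "k \<in> P" for x g k
    proof -
      have kG: "k \<in> carrier G" using k PG by blast
      have "a (x \<star> g \<star> inv\<^bsub>G\<^esub> g) \<ominus> a (x \<star> g \<star> k \<star> inv\<^bsub>G\<^esub> g) \<in> R"
        using coset_order_mem(3)[OF *[rule_format, OF g], of "x \<star> g" k] x g k kG a ac
        by (simp add: FG.mult_monomial)
      then show ?thesis using x g kG by (simp add: FG.G.m_assoc)
    qed
    \<comment> \<open>Invariance is demanded under every conjugate of \<open>k\<close>, which builds
      normality into \<open>?D\<close>; the periods of \<open>a\<close> alone form a subgroup that
      need not be normal.\<close>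
    let ?D = "{k \<in> carrier G. \<forall>g\<in>carrier G. \<forall>x\<in>carrier G. a x \<ominus> a (x \<star> (g \<star> k \<star> inv\<^bsub>G\<^esub> g)) \<in> R}"
    have "?D \<lhd> G"
    proof (rule FG.G.normal_invI)
      show "subgroup ?D G"
      proof (rule FG.G.subgroupI)
        have "\<one>\<^bsub>G\<^esub> \<in> ?D" using ac R_closed(5) by (simp add: a_minus_def r_neg)
        then show "?D \<noteq> {}" by blast
      next
        fix k assume k: "k \<in> ?D"
        have "a x \<ominus> a (x \<star> (g \<star> inv\<^bsub>G\<^esub> k \<star> inv\<^bsub>G\<^esub> g)) \<in> R"
          if g: "g \<in> carrier G" and x: "x \<in> carrier G" for g x
        proof -
          let ?y = "x \<star> (g \<star> inv\<^bsub>G\<^esub> k \<star> inv\<^bsub>G\<^esub> g)"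
          have inv: "g \<star> inv\<^bsub>G\<^esub> k \<star> inv\<^bsub>G\<^esub> g = inv\<^bsub>G\<^esub> (g \<star> k \<star> inv\<^bsub>G\<^esub> g)"
            using g k by (simp add: FG.G.inv_mult_group FG.G.m_assoc)
          have "?y \<star> (g \<star> k \<star> inv\<^bsub>G\<^esub> g) = x"
            unfolding inv using g k x by (simp add: FG.G.m_assoc[of x])
          moreover have "?y \<in> carrier G" using g k x by simp
          ultimately have "a ?y \<ominus> a x \<in> R" using k g by force
          moreover have "a x \<ominus> a ?y = \<ominus> (a ?y \<ominus> a x)"
            using ac by (simp add: a_minus_def minus_add a_comm)
          ultimately show ?thesis by (simp add: R_closed)
        qed
        then show "inv\<^bsub>G\<^esub> k \<in> ?D" using k by simp
      next
        fix k l assume k: "k \<in> ?D" and l: "l \<in> ?D"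
        have "a x \<ominus> a (x \<star> (g \<star> (k \<star> l) \<star> inv\<^bsub>G\<^esub> g)) \<in> R"
          if g: "g \<in> carrier G" and x: "x \<in> carrier G" for g x
        proof -
          let ?y = "x \<star> (g \<star> k \<star> inv\<^bsub>G\<^esub> g)"
          let ?z = "?y \<star> (g \<star> l \<star> inv\<^bsub>G\<^esub> g)"
          have y: "?y \<in> carrier G" using g k x by simp
          have "g \<star> (k \<star> l) \<star> inv\<^bsub>G\<^esub> g = (g \<star> k \<star> inv\<^bsub>G\<^esub> g) \<star> (g \<star> l \<star> inv\<^bsub>G\<^esub> g)"
          proof -
            have "inv\<^bsub>G\<^esub> g \<star> (g \<star> (l \<star> inv\<^bsub>G\<^esub> g)) = l \<star> inv\<^bsub>G\<^esub> g"
              using g l by (simp add: FG.G.m_assoc[symmetric])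
            then show ?thesis using g k l by (simp add: FG.G.m_assoc)
          qed
          then have z: "x \<star> (g \<star> (k \<star> l) \<star> inv\<^bsub>G\<^esub> g) = ?z"
            using g k l x by (simp add: FG.G.m_assoc[of x])
          have "a x \<ominus> a ?y \<in> R" "a ?y \<ominus> a ?z \<in> R" using k l g x y by auto
          moreover have "a x \<ominus> a ?z = (a x \<ominus> a ?y) \<oplus> (a ?y \<ominus> a ?z)"
            using ac by (simp add: a_minus_def a_assoc r_neg1)
          ultimately show ?thesis unfolding z by (simp add: R_closed)
        qed
        then show "k \<star> l \<in> ?D" using k l by simp
      qed auto
      fix h k assume h: "h \<in> carrier G" and k: "k \<in> ?D"
      have "g \<star> (h \<star> k \<star> inv\<^bsub>G\<^esub> h) \<star> inv\<^bsub>G\<^esub> g = (g \<star> h) \<star> k \<star> inv\<^bsub>G\<^esub> (g \<star> h)"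
        if "g \<in> carrier G" for g
        using that h k by (simp add: FG.G.inv_mult_group FG.G.m_assoc)
      then show "h \<star> k \<star> inv\<^bsub>G\<^esub> h \<in> ?D" using h k by simp
    qed
    moreover have "P \<subseteq> ?D" using conj PG by auto
    ultimately have ND: "?N \<subseteq> ?D"
      by (rule FG.G.normal_closure_minimal[OF PG])
    have "a x \<ominus> a (x \<star> k) \<in> R" if "x \<in> carrier G" "k \<in> ?N" for x k
    proof -
      have "k \<in> ?D" using ND that(2) by blast
      then have "k \<in> carrier G" "a x \<ominus> a (x \<star> (\<one>\<^bsub>G\<^esub> \<star> k \<star> inv\<^bsub>G\<^esub> \<one>\<^bsub>G\<^esub>)) \<in> R"
        using that(1) FG.G.one_closed by blast+
      then show ?thesis by simp
    qed
    moreover have "c \<otimes> a x \<in> R" if "x \<in> carrier G" for x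
      using coset_order_mem(2)[OF *[rule_format, OF FG.G.one_closed] that] that a ac
      by (simp add: FG.mult_monomial)
    ultimately show "a \<in> coset_order F R c G ?N" using a by (simp add: coset_order_def)
  }
qed

end

section \<open>Restriction to a subgroup\<close>

lemma (in finite_group_ring) group_ring_comm:
  assumes "comm_group G" "a \<in> carrier KG" "b \<in> carrier KG"
  shows "a \<otimes>\<^bsub>KG\<^esub> b = b \<otimes>\<^bsub>KG\<^esub> a"
  using assms(2)
proof (induction rule: group_ring_induct)
  case zero
  then show ?case using assms(3) KG.l_null KG.r_null by (simp del: group_ring_zero)
next
  case (add r h a)
  interpret G: comm_group G by fact
  have "monomial K r h \<otimes>\<^bsub>KG\<^esub> b = b \<otimes>\<^bsub>KG\<^esub> monomial K r h"
    using add assms(3) by (auto simp: monomial_mult mult_monomial fun_eq_iff coeff_closed K.m_comm G.m_comm)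
  then show ?case
    using add assms(3) by (simp add: KG.l_distr KG.r_distr monomial_closed del: group_ring_add)
qed

locale subgroup_integral_group_ring = integral_group_ring F G R
  for F :: "'a ring" (structure) and G :: "'g monoid" and R +
  fixes H :: "'g set"
  assumes H_subgroup: "subgroup H G"
begin

lemma H_integral_group_ring: "integral_group_ring F (G\<lparr>carrier := H\<rparr>) R"
proof -
  have "finite H" using subgroup.subset[OF H_subgroup] FG.finite_group finite_subset by blast
  moreover have "group (G\<lparr>carrier := H\<rparr>)"
    using subgroup.subgroup_is_group[OF H_subgroup FG.G.is_group] .
  ultimately show ?thesis
    using integral_group_ring_axioms
    by (simp add: integral_group_ring_def integral_group_ring_axioms_def finite_group_ring_def
        finite_group_ring_axioms_def)
qed

end

text \<open>The same locale is entered a second time, so that every fact about F[G] and R[G] is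
  available for F[H] and R[H] under the prefix \<open>sub\<close>.\<close>

sublocale subgroup_integral_group_ring \<subseteq> sub: integral_group_ring F "G\<lparr>carrier := H\<rparr>" R
  by (rule H_integral_group_ring)

context subgroup_integral_group_ring
begin

abbreviation "GH \<equiv> G\<lparr>carrier := H\<rparr>"
abbreviation "FH \<equiv> group_ring F GH"
abbreviation "RH \<equiv> group_ring (F\<lparr>carrier := R\<rparr>) GH"
abbreviation FH_mult (infixl "\<cdot>\<^sub>H" 70) where "a \<cdot>\<^sub>H b \<equiv> a \<otimes>\<^bsub>FH\<^esub> b"

lemma H_closed: "h \<in> H \<Longrightarrow> h \<in> carrier G"
  using subgroup.mem_carrier[OF H_subgroup] .

lemma inv_H: "h \<in> H \<Longrightarrow> inv\<^bsub>GH\<^esub> h = inv\<^bsub>G\<^esub> h"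
  using FG.G.m_inv_consistent[OF H_subgroup] .

lemma mem_H_iff:
  assumes "k \<in> carrier G" "h \<in> H"
  shows "inv\<^bsub>G\<^esub> k \<star> h \<in> H \<longleftrightarrow> k \<in> H"
proof
  interpret H: subgroup H G by (rule H_subgroup)
  assume "inv\<^bsub>G\<^esub> k \<star> h \<in> H"
  then have "h \<star> inv\<^bsub>G\<^esub> (inv\<^bsub>G\<^esub> k \<star> h) \<in> H" using assms by blast
  then show "k \<in> H"
    using assms by (simp add: FG.G.inv_mult_group FG.G.m_assoc[symmetric])
next
  interpret H: subgroup H G by (rule H_subgroup)
  assume "k \<in> H" then show "inv\<^bsub>G\<^esub> k \<star> h \<in> H" using assms by blast
qed

lemma FH_carrier_iff: "a \<in> carrier FH \<longleftrightarrow> a \<in> carrier FG \<and> (\<forall>g. g \<notin> H \<longrightarrow> a g = \<zero>)"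
  using H_closed by (auto simp: group_ring_carrier_iff)

lemma FH_one: "\<one>\<^bsub>FH\<^esub> = \<one>\<^bsub>FG\<^esub>"
  by (simp add: group_ring_one)

lemma RH_subset_RG: "carrier RH \<subseteq> carrier RG"
  by (auto simp: sub.RG_carrier_iff RG_carrier_iff FH_carrier_iff)

text \<open>This is the restriction of \<open>g\<^sup>-\<^sup>1a\<close> to \<open>H\<close>, that
  is, the part of \<open>a\<close> on the coset gH moved into F[H]. Another representative of the
  coset changes it by a left factor from \<open>H\<close>, which is harmless for subsets stable
  under R[H].\<close>

definition coset_part :: "'g \<Rightarrow> ('g \<Rightarrow> 'a) \<Rightarrow> 'g \<Rightarrow> 'a" where
  "coset_part g a = (\<lambda>h. if h \<in> H then a (g \<star> h) else \<zero>)"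

lemma coset_part_closed: "a \<in> carrier FG \<Longrightarrow> coset_part g a \<in> carrier FH"
  by (auto simp: group_ring_carrier_iff[of _ F GH] coset_part_def FG.coeff_closed)

lemma coset_part_RH: "a \<in> carrier RG \<Longrightarrow> coset_part g a \<in> carrier RH"
  using coset_part_closed[of a g] by (auto simp: sub.RG_carrier_iff RG_carrier_iff coset_part_def R_closed)

lemma coset_part_add: "coset_part g (a \<oplus>\<^bsub>FG\<^esub> b) = coset_part g a \<oplus>\<^bsub>FH\<^esub> coset_part g b"
  by (auto simp: coset_part_def)

lemma coset_part_zero: "coset_part g \<zero>\<^bsub>FG\<^esub> = \<zero>\<^bsub>FH\<^esub>"
  by (auto simp: coset_part_def)

lemma coset_part_a_inv: "a \<in> carrier FG \<Longrightarrow> coset_part g (\<ominus>\<^bsub>FG\<^esub> a) = \<ominus>\<^bsub>FH\<^esub> coset_part g a"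
  by (auto simp: FG.group_ring_a_inv sub.FG.group_ring_a_inv coset_part_closed) 
    (auto simp: coset_part_def)

lemma coset_part_one: "a \<in> carrier FH \<Longrightarrow> coset_part \<one>\<^bsub>G\<^esub> a = a"
  by (auto simp: coset_part_def FH_carrier_iff fun_eq_iff H_closed)

lemma finsum_restrict_H:
  assumes "f \<in> carrier G \<rightarrow> carrier F" "\<And>k. \<lbrakk>k \<in> carrier G; k \<notin> H\<rbrakk> \<Longrightarrow> f k = \<zero>" "\<And>k. k \<in> H \<Longrightarrow> f k = f' k"
  shows "(\<Oplus>k\<in>carrier G. f k) = (\<Oplus>k\<in>H. f' k)"
  using assms FG.finite_group H_closed
  by (intro add.finprod_mono_neutral_cong_right) auto

text \<open>Right multiplication by F[H] preserves each left coset of \<open>H\<close>: after the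
  substitution of \<open>g k\<close> for \<open>k\<close>, the factor \<open>l\<close> vanishes
  unless \<open>k \<in> H\<close>, and the sum over \<open>G\<close> shrinks to the product in
  F[H].\<close>

lemma coset_part_mult:
  assumes a: "a \<in> carrier FG" and l: "l \<in> carrier FH" and g: "g \<in> carrier G"
  shows "coset_part g (a \<cdot> l) = coset_part g a \<cdot>\<^sub>H l"
proof
  interpret H: subgroup H G by (rule H_subgroup)
  fix h
  have lG: "l \<in> carrier FG" and l0: "\<And>x. x \<notin> H \<Longrightarrow> l x = \<zero>" using l by (auto simp: FH_carrier_iff)
  show "coset_part g (a \<cdot> l) h = (coset_part g a \<cdot>\<^sub>H l) h"
  proof (cases "h \<in> H")
    case True
    then have hG: "h \<in> carrier G" by (rule H_closed)
    have "(a \<cdot> l) (g \<star> h) =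
        (\<Oplus>k\<in>carrier G. a k \<otimes> l (inv\<^bsub>G\<^esub> k \<star> (g \<star> h)))"
      using g hG by (simp add: group_ring_mult)
    also have "\<dots> = (\<Oplus>k\<in>carrier G. a (g \<star> k) \<otimes> l (inv\<^bsub>G\<^esub> (g \<star> k) \<star> (g \<star> h)))"
      using g a lG by (intro FG.finsum_shift) (auto simp: FG.coeff_closed)
    also have "\<dots> = (\<Oplus>k\<in>H. coset_part g a k \<otimes> l (inv\<^bsub>GH\<^esub> k \<star> h))"
    proof (rule finsum_restrict_H)
      have inv: "inv\<^bsub>G\<^esub> (g \<star> k) \<star> (g \<star> h) = inv\<^bsub>G\<^esub> k \<star> h" if "k \<in> carrier G" for k
      proof -
        have "inv\<^bsub>G\<^esub> g \<star> (g \<star> h) = h" using g hG by (simp add: FG.G.m_assoc[symmetric])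
        then show ?thesis using g hG that by (simp add: FG.G.inv_mult_group FG.G.m_assoc)
      qed
      {
        fix k assume "k \<in> carrier G" "k \<notin> H"
        then show "a (g \<star> k) \<otimes> l (inv\<^bsub>G\<^esub> (g \<star> k) \<star> (g \<star> h)) = \<zero>"
          using a True l0 mem_H_iff by (simp add: inv FG.coeff_closed)
      next
        fix k assume "k \<in> H"
        then show "a (g \<star> k) \<otimes> l (inv\<^bsub>G\<^esub> (g \<star> k) \<star> (g \<star> h)) =
          coset_part g a k \<otimes> l (inv\<^bsub>GH\<^esub> k \<star> h)"
          by (simp add: inv inv_H H_closed coset_part_def)
      }
    qed (use a lG in \<open>auto simp: FG.coeff_closed\<close>)
    finally show ?thesis
      using True by (simp add: coset_part_def[of g "a \<cdot> l"] group_ring_mult[where G = GH])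
  qed (simp add: coset_part_def group_ring_mult)
qed

lemma FH_mult_outside:
  assumes "a \<in> carrier FH" "b \<in> carrier FH" "g \<notin> H"
  shows "(a \<cdot> b) g = \<zero>"
proof (cases "g \<in> carrier G")
  case True
  interpret H: subgroup H G by (rule H_subgroup)
  have "a h \<otimes> b (inv\<^bsub>G\<^esub> h \<star> g) = \<zero>" if h: "h \<in> carrier G" for h
  proof (cases "h \<in> H")
    case hH: True
    have "inv\<^bsub>G\<^esub> h \<star> g \<notin> H"
    proof
      assume "inv\<^bsub>G\<^esub> h \<star> g \<in> H"
      then have "h \<star> (inv\<^bsub>G\<^esub> h \<star> g) \<in> H" using hH by blast
      with assms(3) h True show False by (simp add: FG.G.m_assoc[symmetric])
    qed
    then show ?thesis
      using assms by (simp add: FH_carrier_iff FG.coeff_closed)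
  next
    case False
    then show ?thesis using assms by (simp add: FH_carrier_iff FG.coeff_closed)
  qed
  then have "(\<Oplus>h\<in>carrier G. a h \<otimes> b (inv\<^bsub>G\<^esub> h \<star> g)) = (\<Oplus>h\<in>carrier G. \<zero>)"
    by (intro finsum_cong') auto
  then show ?thesis using True by (simp add: group_ring_mult)
qed (simp add: group_ring_mult)

text \<open>Once the product in F[G] is known to be supported on \<open>H\<close>, this is right
  linearity of the part at the identity coset, where taking the part changes nothing.\<close>

lemma FH_mult_eq:
  assumes "a \<in> carrier FH" "b \<in> carrier FH"
  shows "a \<cdot>\<^sub>H b = a \<cdot> b"
proof -
  have "a \<cdot> b \<in> carrier FH"
    using assms FH_mult_outside[OF assms] by (simp add: FH_carrier_iff)
  then show ?thesis
    using coset_part_mult[of a b "\<one>\<^bsub>G\<^esub>"] assms coset_part_one by (simp add: FH_carrier_iff)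
qed

text \<open>\<open>H\<close> is a left and a right coset at once, so on it the part is linear over
  F[H] on the left as well. The dual basis argument depends on having both sides.\<close>

lemma coset_part_one_mult:
  assumes l: "l \<in> carrier FH" and a: "a \<in> carrier FG"
  shows "coset_part \<one>\<^bsub>G\<^esub> (l \<cdot> a) = l \<cdot>\<^sub>H coset_part \<one>\<^bsub>G\<^esub> a"
proof
  fix h
  have lG: "l \<in> carrier FG" and l0: "\<And>x. x \<notin> H \<Longrightarrow> l x = \<zero>" using l by (auto simp: FH_carrier_iff)
  show "coset_part \<one>\<^bsub>G\<^esub> (l \<cdot> a) h = (l \<cdot>\<^sub>H coset_part \<one>\<^bsub>G\<^esub> a) h"
  proof (cases "h \<in> H")
    case True
    then have hG: "h \<in> carrier G" by (rule H_closed)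
    have "(l \<cdot> a) h = (\<Oplus>k\<in>carrier G. l k \<otimes> a (inv\<^bsub>G\<^esub> k \<star> h))"
      using hG by (simp add: group_ring_mult)
    also have "\<dots> = (\<Oplus>k\<in>H. l k \<otimes> coset_part \<one>\<^bsub>G\<^esub> a (inv\<^bsub>GH\<^esub> k \<star> h))"
      using True l0 a lG mem_H_iff
      by (intro finsum_restrict_H) (auto simp: inv_H H_closed coset_part_def FG.coeff_closed hG)
    finally show ?thesis
      using True hG by (simp add: coset_part_def[of _ "l \<cdot> a"] group_ring_mult[where G = GH])
  qed (simp add: coset_part_def group_ring_mult)
qed

lemma coset_decomposition:
  obtains T where "finite T" "T \<subseteq> carrier G"
    and "\<And>a. a \<in> carrier FG \<Longrightarrow> a = (\<Oplus>\<^bsub>FG\<^esub>t\<in>T. monomial F \<one> t \<cdot> coset_part t a)"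
proof -
  interpret H: subgroup H G by (rule H_subgroup)
  obtain \<tau> where \<tau>: "\<And>g. g \<in> carrier G \<Longrightarrow> \<tau> g \<in> carrier G"
    and \<tau>H: "\<And>g. g \<in> carrier G \<Longrightarrow> inv\<^bsub>G\<^esub> g \<star> \<tau> g \<in> H"
    and \<tau>k: "\<And>g k. \<lbrakk>g \<in> carrier G; k \<in> H\<rbrakk> \<Longrightarrow> \<tau> (g \<star> k) = \<tau> g"
    and \<tau>\<tau>: "\<And>g. g \<in> carrier G \<Longrightarrow> \<tau> (\<tau> g) = \<tau> g"
    using FG.G.left_transversal[OF H_subgroup] by blast
  \<comment> \<open>The fixed points of \<open>\<tau>\<close> are representatives, one for each left
    coset.\<close>
  define T where "T = {g \<in> carrier G. \<tau> g = g}"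
  have T: "finite T" "T \<subseteq> carrier G" using FG.finite_group by (auto simp: T_def)
  have "a = (\<Oplus>\<^bsub>FG\<^esub>t\<in>T. monomial F \<one> t \<cdot> coset_part t a)" if a: "a \<in> carrier FG" for a
  proof (rule FG.group_ring_eqI[OF a])
    note cp = coset_part_closed[OF a]
    have cl: "(\<lambda>t. monomial F \<one> t \<cdot> coset_part t a) \<in> T \<rightarrow> carrier FG"
      using T cp by (auto simp: FH_carrier_iff FG.monomial_closed)
    then show "(\<Oplus>\<^bsub>FG\<^esub>t\<in>T. monomial F \<one> t \<cdot> coset_part t a) \<in> carrier FG" by simp
    fix x assume x: "x \<in> carrier G"
    have "(\<Oplus>\<^bsub>FG\<^esub>t\<in>T. monomial F \<one> t \<cdot> coset_part t a) x =
        (\<Oplus>t\<in>T. (monomial F \<one> t \<cdot> coset_part t a) x)"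
      using T cl by (simp add: FG.group_ring_finsum)
    also have "\<dots> = (\<Oplus>t\<in>T. if \<tau> x = t then a x else \<zero>)"
    proof (intro finsum_cong')
      fix t assume "t \<in> T"
      then have t: "t \<in> carrier G" "\<tau> t = t" by (auto simp: T_def)
      have eq: "t \<star> (inv\<^bsub>G\<^esub> t \<star> x) = x" using t x by (simp add: FG.G.m_assoc[symmetric])
      have "inv\<^bsub>G\<^esub> t \<star> x \<in> H \<longleftrightarrow> \<tau> x = t"
      proof
        assume "inv\<^bsub>G\<^esub> t \<star> x \<in> H"
        then show "\<tau> x = t" using \<tau>k[OF t(1), of "inv\<^bsub>G\<^esub> t \<star> x"] eq t by simp
      next
        assume "\<tau> x = t"
        then have "inv\<^bsub>G\<^esub> (inv\<^bsub>G\<^esub> x \<star> t) \<in> H" using \<tau>H[OF x] by auto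
        then show "inv\<^bsub>G\<^esub> t \<star> x \<in> H" using t x by (simp add: FG.G.inv_mult_group)
      qed
      moreover have "(monomial F \<one> t \<cdot> coset_part t a) x = coset_part t a (inv\<^bsub>G\<^esub> t \<star> x)"
        using t x cp[of t] by (simp add: FH_carrier_iff FG.monomial_mult FG.coeff_closed)
      ultimately show "(monomial F \<one> t \<cdot> coset_part t a) x = (if \<tau> x = t then a x else \<zero>)"
        using eq by (simp add: coset_part_def)
    qed (use a in \<open>auto simp: FG.coeff_closed\<close>)
    also have "\<dots> = a x"
      using T \<tau>[OF x] \<tau>\<tau>[OF x] a by (intro finsum_singleton) (auto simp: T_def FG.coeff_closed)
    finally show "a x = (\<Oplus>\<^bsub>FG\<^esub>t\<in>T. monomial F \<one> t \<cdot> coset_part t a) x" by simp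
  qed
  then show thesis using that T by blast
qed

text \<open>As \<open>P \<subseteq> H\<close>, each left coset of \<open>P\<close> lies inside one
  left coset of \<open>H\<close>, so the defining conditions can be checked on the parts
  separately.\<close>

lemma coset_order_coset_part_iff:
  assumes "P \<subseteq> H" "a \<in> carrier FG"
  shows "(\<forall>g\<in>carrier G. coset_part g a \<in> coset_order F R c GH P) \<longleftrightarrow> a \<in> coset_order F R c G P"
proof
  interpret H: subgroup H G by (rule H_subgroup)
  assume *: "\<forall>g\<in>carrier G. coset_part g a \<in> coset_order F R c GH P"
  have "c \<otimes> a g \<in> R \<and> (\<forall>k\<in>P. a g \<ominus> a (g \<star> k) \<in> R)" if g: "g \<in> carrier G" for g
    using sub.coset_order_mem(2,3)[OF *[rule_format, OF g], of "\<one>\<^bsub>G\<^esub>"] g assms(1) H_closed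
    by (auto simp: coset_part_def subset_iff)
  then show "a \<in> coset_order F R c G P" using assms(2) by (simp add: coset_order_def)
next
  interpret H: subgroup H G by (rule H_subgroup)
  assume a: "a \<in> coset_order F R c G P"
  show "\<forall>g\<in>carrier G. coset_part g a \<in> coset_order F R c GH P"
  proof
    fix g assume g: "g \<in> carrier G"
    have "a (g \<star> h) \<ominus> a (g \<star> (h \<star> k)) \<in> R" if "h \<in> H" "k \<in> P" for h k
      using coset_order_mem(3)[OF a, of "g \<star> h" k] that g assms(1) H_closed
      by (auto simp: FG.G.m_assoc subset_iff)
    then show "coset_part g a \<in> coset_order F R c GH P"
      using coset_part_closed[OF assms(2), of g] coset_order_mem(2)[OF a] g assms(1) H_closed
      by (auto simp: coset_order_def) (auto simp: coset_part_def subset_iff)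
  qed
qed

end

section \<open>The induced lattice R[G]L inside F[G] and its multipliers\<close>

context subgroup_integral_group_ring
begin

text \<open>\<open>R[G]L\<close> as a subset of \<open>F[G]\<close>, for an \<open>R[H]\<close>-submodule \<open>L\<close> of \<open>F[H]\<close>.\<close>

definition induced_sub :: "('g \<Rightarrow> 'a) set \<Rightarrow> ('g \<Rightarrow> 'a) set" where
  "induced_sub L = {a \<in> carrier FG. \<forall>g\<in>carrier G. coset_part g a \<in> L}"

text \<open>Part (i) in coordinates; the coset-wise test of membership is all that it needs.\<close>

lemma induced_sub_coset_order:
  assumes "P \<subseteq> H"
  shows "induced_sub (coset_order F R c GH P) = coset_order F R c G P"
  unfolding induced_sub_def
  using coset_order_coset_part_iff[OF assms] coset_order_mem(1)[of _ c P] by blast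

context
  fixes L :: "('g \<Rightarrow> 'a) set"
  assumes L: "subgroup L (add_monoid FH)"
begin

lemma L_closed: "l \<in> L \<Longrightarrow> l \<in> carrier FH"
  using subgroup.mem_carrier[OF L] by simp

lemma induced_sub_subgroup: "subgroup (induced_sub L) (add_monoid FG)"
proof (rule FG.KG.add_subgroupI)
  show "\<zero>\<^bsub>FG\<^esub> \<in> induced_sub L"
    using subgroup.one_closed[OF L] coset_part_zero by (simp add: induced_sub_def group_ring_carrier_iff)
next
  fix x y assume "x \<in> induced_sub L" "y \<in> induced_sub L"
  then show "x \<oplus>\<^bsub>FG\<^esub> y \<in> induced_sub L"
    using subgroup.m_closed[OF L] FG.KG.a_closed
    by (simp add: induced_sub_def coset_part_add del: group_ring_add)
next
  fix x assume "x \<in> induced_sub L"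
  then show "\<ominus>\<^bsub>FG\<^esub> x \<in> induced_sub L"
    using add_subgroup_a_inv_closed[OF L] by (simp add: induced_sub_def coset_part_a_inv)
qed (auto simp: induced_sub_def)

context
  assumes stable: "\<And>b l. \<lbrakk>b \<in> carrier RH; l \<in> L\<rbrakk> \<Longrightarrow> b \<cdot>\<^sub>H l \<in> L"
begin

text \<open>The part of \<open>a \<cdot> l\<close> at \<open>g\<close> is the part of
  \<open>a\<close> times \<open>l\<close>, and parts of elements of R[G] lie in R[H].\<close>

lemma RG_mult_L_mem:
  assumes "a \<in> carrier RG" "l \<in> L"
  shows "a \<cdot> l \<in> induced_sub L"
proof -
  have "l \<in> carrier FH" "l \<in> carrier FG" "a \<in> carrier FG"
    using L_closed[OF assms(2)] assms(1) by (auto simp: FH_carrier_iff RG_carrier_iff)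
  then show ?thesis
    using assms stable coset_part_RH by (simp add: induced_sub_def coset_part_mult)
qed

lemma L_subset_induced_sub: "L \<subseteq> induced_sub L"
proof
  fix l assume l: "l \<in> L"
  then have "\<one>\<^bsub>FG\<^esub> \<cdot> l \<in> induced_sub L"
    using RG_mult_L_mem[OF group_elem_RG l] by (simp add: group_ring_one)
  then show "l \<in> induced_sub L"
    using L_closed[OF l] by (simp add: FH_carrier_iff)
qed

lemma induced_sub_order:
  assumes P: "subgroup P G" "P \<subseteq> H"
    and order: "{s \<in> carrier FH. \<forall>l\<in>L. s \<cdot>\<^sub>H l \<in> L} = coset_order F R c GH P"
  shows "{s \<in> carrier FG. \<forall>x\<in>induced_sub L. s \<cdot> x \<in> induced_sub L} =
    coset_order F R c G (normal_closure G P)"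
proof -
  have "(\<forall>x\<in>induced_sub L. s \<cdot> x \<in> induced_sub L) \<longleftrightarrow>
      (\<forall>g\<in>carrier G. s \<cdot> monomial F \<one> g \<in> coset_order F R c G P)" if s: "s \<in> carrier FG" for s
  proof -
    let ?d = "monomial F \<one>"
    have sd: "s \<cdot> ?d g \<in> carrier FG" if "g \<in> carrier G" for g
      using s that by (simp add: FG.monomial_closed)
    have mem: "s \<cdot> ?d g \<in> coset_order F R c G P \<longleftrightarrow>
        (\<forall>l\<in>L. s \<cdot> (?d g \<cdot> l) \<in> induced_sub L)" if g: "g \<in> carrier G" for g
    proof -
      have "s \<cdot> ?d g \<in> coset_order F R c G P \<longleftrightarrow>
          (\<forall>x\<in>carrier G. \<forall>l\<in>L. coset_part x (s \<cdot> ?d g) \<cdot>\<^sub>H l \<in> L)"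
        unfolding coset_order_coset_part_iff[OF P(2) sd[OF g], symmetric] order[symmetric]
        using coset_part_closed[OF sd[OF g]] by blast
      also have "\<dots> \<longleftrightarrow> (\<forall>l\<in>L. s \<cdot> ?d g \<cdot> l \<in> induced_sub L)"
        using L_closed sd[OF g] by (auto simp: induced_sub_def coset_part_mult FH_carrier_iff)
      also have "\<dots> \<longleftrightarrow> (\<forall>l\<in>L. s \<cdot> (?d g \<cdot> l) \<in> induced_sub L)"
        using L_closed s g by (auto simp: FH_carrier_iff FG.KG.m_assoc FG.monomial_closed)
      finally show ?thesis .
    qed
    show ?thesis
    proof
      assume *: "\<forall>x\<in>induced_sub L. s \<cdot> x \<in> induced_sub L"
      then show "\<forall>g\<in>carrier G. s \<cdot> ?d g \<in> coset_order F R c G P"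
        using mem RG_mult_L_mem group_elem_RG by blast
    next
      assume *: "\<forall>g\<in>carrier G. s \<cdot> ?d g \<in> coset_order F R c G P"
      show "\<forall>x\<in>induced_sub L. s \<cdot> x \<in> induced_sub L"
      proof
        fix x assume x: "x \<in> induced_sub L"
        then have xF: "x \<in> carrier FG" by (simp add: induced_sub_def)
        \<comment> \<open>The translates \<open>t l\<close> span R[G]L additively: \<open>x\<close>
          is the sum of its parts moved back to their cosets, and \<open>mem\<close> handles each
          summand.\<close>
        obtain T where T: "finite T" "T \<subseteq> carrier G"
          and dec: "\<And>a. a \<in> carrier FG \<Longrightarrow> a = (\<Oplus>\<^bsub>FG\<^esub>t\<in>T. ?d t \<cdot> coset_part t a)"
          by (rule coset_decomposition) (rule that, assumption+)
        have cl: "(\<lambda>t. ?d t \<cdot> coset_part t x) \<in> T \<rightarrow> carrier FG"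
          using T(2) coset_part_closed[OF xF] by (auto simp: FH_carrier_iff FG.monomial_closed)
        have "s \<cdot> x = s \<cdot> (\<Oplus>\<^bsub>FG\<^esub>t\<in>T. ?d t \<cdot> coset_part t x)"
          using dec[OF xF] by (rule arg_cong)
        also have "\<dots> = (\<Oplus>\<^bsub>FG\<^esub>t\<in>T. s \<cdot> (?d t \<cdot> coset_part t x))"
          using T(1) s cl by (rule FG.KG.finsum_rdistr)
        also have "\<dots> \<in> induced_sub L"
          using * mem x T(2)
          by (intro FG.KG.subgroup_finsum_closed[OF induced_sub_subgroup]) (auto simp: induced_sub_def)
        finally show "s \<cdot> x \<in> induced_sub L" .
      qed
    qed
  qed
  then have "s \<in> carrier FG \<Longrightarrow> (\<forall>x\<in>induced_sub L. s \<cdot> x \<in> induced_sub L) \<longleftrightarrow>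
      s \<in> coset_order F R c G (normal_closure G P)" for s
    using coset_order_normal_closure_iff[OF P(1)] by blast
  then show ?thesis using coset_order_mem(1) by blast
qed

text \<open>The \<open>b\<^sub>i\<close> and \<open>e\<^sub>i\<close> come from a dual basis of \<open>R[G]L\<close>.  Commutativity of \<open>F[H]\<close> allows one to move
  \<open>s\<close> past the \<open>b\<^sub>i\<close> in the \<open>H\<close>-part of \<open>rs = \<Sum>\<^sub>i s b\<^sub>i e\<^sub>i\<close>.\<close>

lemma dual_basis_imp_order_subset:
  assumes comm: "comm_group GH" and N: "N \<lhd> G" "N \<subseteq> H"
    and c: "c \<in> carrier F" and r: "r \<in> carrier F" "r \<noteq> \<zero>"
    and J: "finite J" and b: "b \<in> J \<rightarrow> carrier FG" and e: "e \<in> J \<rightarrow> induced_sub L"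
    and sum: "monomial F r \<one>\<^bsub>G\<^esub> = (\<Oplus>\<^bsub>FG\<^esub>i\<in>J. b i \<cdot> e i)"
    and dual: "\<And>i x. \<lbrakk>i \<in> J; x \<in> L\<rbrakk> \<Longrightarrow> \<exists>y\<in>coset_order F R c G N. x \<cdot> b i = r \<odot>\<^bsub>FG\<^esub> y"
    and s: "s \<in> carrier FH" "\<And>l. l \<in> L \<Longrightarrow> s \<cdot>\<^sub>H l \<in> L"
  shows "s \<in> coset_order F R c GH N"
proof -
  let ?T = "coset_order F R c GH N" and ?d = "monomial F \<one>"
  let ?r = "monomial F r \<one>\<^bsub>G\<^esub>"
  let ?cp = "coset_part \<one>\<^bsub>G\<^esub>"
  \<comment> \<open>\<open>W\<close> reduces the claim to generators: it is an additive subgroup,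
    and the goal is \<open>?r \<in> W\<close>, which says that \<open>s r\<close> is
    \<open>r\<close> times an element of the order.\<close>
  define W where "W = {w \<in> carrier FG. \<exists>y\<in>?T. s \<cdot>\<^sub>H ?cp w = ?r \<cdot>\<^sub>H y}"
  have one: "\<one>\<^bsub>GH\<^esub> = \<one>\<^bsub>G\<^esub>" by simp
  have rFH: "?r \<in> carrier FH" using sub.FG.monomial_closed[OF r(1), of "\<one>\<^bsub>G\<^esub>"] sub.FG.G.one_closed by simp
  note rF = sub.FG.group_ring_smult_eq_mult[OF r(1), unfolded one]
  have T: "subgroup ?T (add_monoid FH)" using sub.coset_order_subgroup[OF c] .
  have TF: "y \<in> carrier FH" if "y \<in> ?T" for y using sub.coset_order_mem(1)[OF that] .
  have W: "subgroup W (add_monoid FG)"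
  proof (rule FG.KG.add_subgroupI)
    have "s \<cdot>\<^sub>H ?cp \<zero>\<^bsub>FG\<^esub> = ?r \<cdot>\<^sub>H \<zero>\<^bsub>FH\<^esub>"
      unfolding coset_part_zero using s(1) rFH sub.FG.KG.r_null by metis
    moreover have "\<zero>\<^bsub>FH\<^esub> \<in> ?T" using subgroup.one_closed[OF T] by simp
    ultimately show "\<zero>\<^bsub>FG\<^esub> \<in> W" unfolding W_def using FG.KG.zero_closed by blast
  next
    fix v w assume "v \<in> W" "w \<in> W"
    then obtain x y where vw: "v \<in> carrier FG" "w \<in> carrier FG" and xy: "x \<in> ?T" "y \<in> ?T"
      "s \<cdot>\<^sub>H ?cp v = ?r \<cdot>\<^sub>H x" "s \<cdot>\<^sub>H ?cp w = ?r \<cdot>\<^sub>H y" by (auto simp: W_def)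
    have "s \<cdot>\<^sub>H ?cp (v \<oplus>\<^bsub>FG\<^esub> w) = ?r \<cdot>\<^sub>H (x \<oplus>\<^bsub>FH\<^esub> y)"
      unfolding coset_part_add using s(1) vw xy rFH TF
      by (simp add: sub.FG.KG.r_distr coset_part_closed del: group_ring_add)
    moreover have "x \<oplus>\<^bsub>FH\<^esub> y \<in> ?T" using subgroup.m_closed[OF T] xy by simp
    ultimately show "v \<oplus>\<^bsub>FG\<^esub> w \<in> W" unfolding W_def using FG.KG.a_closed vw by blast
  next
    fix v assume "v \<in> W"
    then obtain x where v: "v \<in> carrier FG" and x: "x \<in> ?T" "s \<cdot>\<^sub>H ?cp v = ?r \<cdot>\<^sub>H x"
      by (auto simp: W_def)
    have "s \<cdot>\<^sub>H ?cp (\<ominus>\<^bsub>FG\<^esub> v) = ?r \<cdot>\<^sub>H (\<ominus>\<^bsub>FH\<^esub> x)"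
      unfolding coset_part_a_inv[OF v] using s(1) v x rFH TF
      by (simp add: sub.FG.KG.r_minus coset_part_closed)
    moreover have "\<ominus>\<^bsub>FH\<^esub> x \<in> ?T" using add_subgroup_a_inv_closed[OF T] x by simp
    ultimately show "\<ominus>\<^bsub>FG\<^esub> v \<in> W" unfolding W_def using v by blast
  qed (auto simp: W_def)
  have gen: "(b i \<cdot> ?d t) \<cdot> l \<in> W" if i: "i \<in> J" and t: "t \<in> carrier G" and l: "l \<in> L" for i t l
  proof -
    have bi: "b i \<in> carrier FG" using b i by blast
    have lF: "l \<in> carrier FH" "l \<in> carrier FG" using L_closed[OF l] by (auto simp: FH_carrier_iff)
    have dt: "?d t \<in> carrier FG" using t by (simp add: FG.monomial_closed)
    let ?bt = "b i \<cdot> ?d t"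
    have bt: "?bt \<in> carrier FG" "?cp ?bt \<in> carrier FH" using bi dt coset_part_closed by auto
    \<comment> \<open>The duality hypothesis will be applied to \<open>s l\<close> in place of
      \<open>l\<close>; this is where \<open>s\<close> must stabilise \<open>L\<close>.\<close>
    have sl: "s \<cdot>\<^sub>H l \<in> L" using s(2) l .
    then have slF: "s \<cdot>\<^sub>H l \<in> carrier FH" "s \<cdot>\<^sub>H l \<in> carrier FG"
      using L_closed by (auto simp: FH_carrier_iff)
    obtain y where y: "y \<in> coset_order F R c G N" "(s \<cdot>\<^sub>H l) \<cdot> b i = r \<odot>\<^bsub>FG\<^esub> y"
      using dual[OF i sl] by blast
    note yF = coset_order_mem(1)[OF y(1)]
    have "s \<cdot>\<^sub>H ?cp (?bt \<cdot> l) = s \<cdot>\<^sub>H (?cp ?bt \<cdot>\<^sub>H l)"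
      using coset_part_mult[OF bt(1) lF(1)] by simp
    \<comment> \<open>Commutativity brings \<open>s\<close> next to \<open>l\<close>: the part of
      \<open>b i t\<close>, which stood between them, passes to the right.\<close>
    also have "\<dots> = s \<cdot>\<^sub>H (l \<cdot>\<^sub>H ?cp ?bt)"
      using sub.FG.group_ring_comm[OF comm bt(2) lF(1)] by simp
    also have "\<dots> = (s \<cdot>\<^sub>H l) \<cdot>\<^sub>H ?cp ?bt"
      using s(1) lF bt by (simp add: sub.FG.KG.m_assoc)
    also have "\<dots> = ?cp ((s \<cdot>\<^sub>H l) \<cdot> ?bt)"
      using coset_part_one_mult[OF slF(1) bt(1)] by simp
    also have "(s \<cdot>\<^sub>H l) \<cdot> ?bt = ?r \<cdot> (y \<cdot> ?d t)"
    proof -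
      have "(s \<cdot>\<^sub>H l) \<cdot> ?bt = (r \<odot>\<^bsub>FG\<^esub> y) \<cdot> ?d t"
        using slF bi dt y(2) by (simp add: FG.KG.m_assoc[symmetric] del: group_ring_smult)
      also have "\<dots> = (?r \<cdot> y) \<cdot> ?d t"
        using FG.group_ring_smult_eq_mult[OF r(1) yF] by simp
      also have "\<dots> = ?r \<cdot> (y \<cdot> ?d t)"
        using r(1) yF dt by (simp add: FG.KG.m_assoc FG.monomial_closed)
      finally show ?thesis .
    qed
    also have "?cp (?r \<cdot> (y \<cdot> ?d t)) = ?r \<cdot>\<^sub>H ?cp (y \<cdot> ?d t)"
      using rFH yF dt by (simp add: coset_part_one_mult)
    finally have "s \<cdot>\<^sub>H ?cp (?bt \<cdot> l) = ?r \<cdot>\<^sub>H ?cp (y \<cdot> ?d t)" .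
    \<comment> \<open>Normality of \<open>N\<close> keeps \<open>y t\<close> in the order, and
      \<open>N \<subseteq> H\<close> allows membership to be read off from the part in
      \<open>H\<close>.\<close>
    moreover have "?cp (y \<cdot> ?d t) \<in> ?T"
      using coset_order_coset_part_iff[OF N(2) FG.KG.m_closed[OF yF dt], of c]
        coset_order_mult_group_elem[OF N(1) y(1) t] FG.G.one_closed by blast
    moreover have "?bt \<cdot> l \<in> carrier FG" using bt(1) lF by simp
    ultimately show ?thesis unfolding W_def by blast
  qed
  have be: "b i \<cdot> e i \<in> W" if i: "i \<in> J" for i
  proof -
    have bi: "b i \<in> carrier FG" and ei: "e i \<in> induced_sub L" using b e i by auto
    then have eF: "e i \<in> carrier FG" by (simp add: induced_sub_def)
    obtain T where T: "finite T" "T \<subseteq> carrier G"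
      and dec: "\<And>a. a \<in> carrier FG \<Longrightarrow> a = (\<Oplus>\<^bsub>FG\<^esub>t\<in>T. ?d t \<cdot> coset_part t a)"
      by (rule coset_decomposition) (rule that, assumption+)
    have cpF: "coset_part t (e i) \<in> carrier FG" for t
      using coset_part_closed[OF eF] by (simp add: FH_carrier_iff)
    have cl: "(\<lambda>t. ?d t \<cdot> coset_part t (e i)) \<in> T \<rightarrow> carrier FG"
      using T(2) cpF by (auto simp: FG.monomial_closed)
    have "b i \<cdot> e i = b i \<cdot> (\<Oplus>\<^bsub>FG\<^esub>t\<in>T. ?d t \<cdot> coset_part t (e i))"
      using dec[OF eF] by (rule arg_cong)
    also have "\<dots> = (\<Oplus>\<^bsub>FG\<^esub>t\<in>T. b i \<cdot> (?d t \<cdot> coset_part t (e i)))"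
      using T(1) bi cl by (rule FG.KG.finsum_rdistr)
    also have "\<dots> \<in> W"
    proof (rule FG.KG.subgroup_finsum_closed[OF W], rule)
      fix t assume "t \<in> T"
      then have t: "t \<in> carrier G" "coset_part t (e i) \<in> L" using T(2) ei by (auto simp: induced_sub_def)
      show "b i \<cdot> (?d t \<cdot> coset_part t (e i)) \<in> W"
        using gen[OF i t] bi t(1) cpF by (simp add: FG.KG.m_assoc FG.monomial_closed)
    qed
    finally show ?thesis .
  qed
  have "?r \<in> W"
    unfolding sum by (rule FG.KG.subgroup_finsum_closed[OF W]) (use be in auto)
  then obtain y where y: "y \<in> ?T" "s \<cdot>\<^sub>H ?r = ?r \<cdot>\<^sub>H y"
    using coset_part_one[OF rFH] by (auto simp: W_def)
  \<comment> \<open>The scalar \<open>r\<close> is central and a nonzero element of a field, so it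
    cancels coefficientwise.\<close>
  have "r \<odot>\<^bsub>FH\<^esub> s = r \<odot>\<^bsub>FH\<^esub> y"
    using y rF[OF s(1)] rF[OF TF[OF y(1)]] sub.FG.scalar_central[OF r(1) s(1)] by simp
  then have "r \<otimes> s x = r \<otimes> y x" for x by (simp add: fun_eq_iff)
  then have "s x = y x" for x
    using r sub.FG.coeff_closed[OF s(1)] sub.FG.coeff_closed[OF TF[OF y(1)]] m_lcancel by blast
  then show ?thesis using y(1) by (simp add: ext[of s y])
qed

end

end

end

section \<open>Coordinates and dual bases\<close>

lemma (in left_module) smult_zero_left:
  assumes "x \<in> carrier M"
  shows "\<zero>\<^bsub>A\<^esub> \<odot>\<^bsub>M\<^esub> x = \<zero>\<^bsub>M\<^esub>"
proof -
  have "\<zero>\<^bsub>A\<^esub> \<odot>\<^bsub>M\<^esub> x \<oplus>\<^bsub>M\<^esub> \<zero>\<^bsub>A\<^esub> \<odot>\<^bsub>M\<^esub> x = \<zero>\<^bsub>A\<^esub> \<odot>\<^bsub>M\<^esub> x"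
    using smult_l_distr[of "\<zero>\<^bsub>A\<^esub>" "\<zero>\<^bsub>A\<^esub>" x] assms by simp
  then show ?thesis
    using smult_closed[OF A.zero_closed assms] by simp
qed

lemma additive_map_finsum:
  assumes "abelian_group M" "abelian_group N"
    and f: "f \<in> carrier M \<rightarrow> carrier N"
    and add: "\<And>x y. \<lbrakk>x \<in> carrier M; y \<in> carrier M\<rbrakk> \<Longrightarrow> f (x \<oplus>\<^bsub>M\<^esub> y) = f x \<oplus>\<^bsub>N\<^esub> f y"
    and "finite I" "y \<in> I \<rightarrow> carrier M"
  shows "f (\<Oplus>\<^bsub>M\<^esub>i\<in>I. y i) = (\<Oplus>\<^bsub>N\<^esub>i\<in>I. f (y i))"
proof -
  interpret M: abelian_group M by fact
  interpret N: abelian_group N by fact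
  show ?thesis
    using assms(5,6)
  proof (induction I)
    case empty
    have "f \<zero>\<^bsub>M\<^esub> \<oplus>\<^bsub>N\<^esub> f \<zero>\<^bsub>M\<^esub> = f \<zero>\<^bsub>M\<^esub>" using add[of "\<zero>\<^bsub>M\<^esub>" "\<zero>\<^bsub>M\<^esub>"] by simp
    then show ?case using f by (simp add: Pi_iff)
  next
    case (insert i I)
    then have "(\<lambda>i. f (y i)) \<in> I \<rightarrow> carrier N" "f (y i) \<in> carrier N" using f by auto
    with insert show ?case by (simp add: add Pi_iff)
  qed
qed

lemma free_rank_one_coordinate:
  assumes "ring A" "free_of_rank A M 1"
  obtains \<psi> where "\<psi> \<in> left_module_hom A M (regular_module A)" "bij_betw \<psi> (carrier M) (carrier A)"
proof -
  interpret A: ring A by fact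
  let ?C = "coproduct_module A {..<1::nat}"
  obtain f where f: "f \<in> left_module_hom A ?C M" "bij_betw f (carrier ?C) (carrier M)"
    using assms(2) by (auto simp: free_of_rank_def free_on_def)
  \<comment> \<open>The direct sum over one index is a copy of \<open>A\<close>; \<open>u\<close>
    fills its only coordinate.\<close>
  define u where "u a = (\<lambda>i::nat. if i = 0 then a else \<zero>\<^bsub>A\<^esub>)" for a
  have fin: "finite {i. u a i \<noteq> \<zero>\<^bsub>A\<^esub>}" for a
    by (rule finite_subset[of _ "{0}"]) (auto simp: u_def)
  have u: "u a \<in> carrier ?C" if "a \<in> carrier A" for a
    using that fin[of a] by (auto simp: coproduct_module_def u_def)
  have u_bij: "bij_betw u (carrier A) (carrier ?C)"
    by (rule bij_betw_byWitness[where f' = "\<lambda>c. c 0"])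
      (use u in \<open>auto simp: u_def coproduct_module_def fun_eq_iff\<close>)
  have u_add: "u (a \<oplus>\<^bsub>A\<^esub> b) = u a \<oplus>\<^bsub>?C\<^esub> u b" "u (a \<otimes>\<^bsub>A\<^esub> b) = a \<odot>\<^bsub>?C\<^esub> u b"
    if "a \<in> carrier A" "b \<in> carrier A" for a b
    using that by (auto simp: u_def coproduct_module_def)
  define \<theta> where "\<theta> = f \<circ> u"
  have \<theta>: "bij_betw \<theta> (carrier A) (carrier M)"
    unfolding \<theta>_def using u_bij f(2) by (rule bij_betw_trans)
  have \<theta>_add: "\<theta> (a \<oplus>\<^bsub>A\<^esub> b) = \<theta> a \<oplus>\<^bsub>M\<^esub> \<theta> b" "\<theta> (a \<otimes>\<^bsub>A\<^esub> b) = a \<odot>\<^bsub>M\<^esub> \<theta> b"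
    if "a \<in> carrier A" "b \<in> carrier A" for a b
    using that f(1) u by (auto simp: \<theta>_def u_add left_module_hom_def)
  let ?\<psi> = "inv_into (carrier A) \<theta>"
  have \<psi>: "bij_betw ?\<psi> (carrier M) (carrier A)" using \<theta> by (rule bij_betw_inv_into)
  have \<psi>cl: "?\<psi> x \<in> carrier A" "\<theta> (?\<psi> x) = x" if "x \<in> carrier M" for x
    using \<psi> \<theta> that by (auto simp: bij_betw_def f_inv_into_f)
  have eq: "?\<psi> x = a" if "a \<in> carrier A" "\<theta> a = x" for a x
    using that \<theta> by (auto simp: bij_betw_def)
  have "?\<psi> (x \<oplus>\<^bsub>M\<^esub> y) = ?\<psi> x \<oplus>\<^bsub>A\<^esub> ?\<psi> y" if "x \<in> carrier M" "y \<in> carrier M" for x y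
    by (rule eq) (use that \<psi>cl \<theta>_add in auto)
  moreover have "?\<psi> (a \<odot>\<^bsub>M\<^esub> x) = a \<otimes>\<^bsub>A\<^esub> ?\<psi> x" if "a \<in> carrier A" "x \<in> carrier M" for a x
    by (rule eq) (use that \<psi>cl \<theta>_add in auto)
  ultimately have "?\<psi> \<in> left_module_hom A M (regular_module A)"
    using \<psi>cl by (auto simp: left_module_hom_def regular_module_def)
  then show thesis using that \<psi> by blast
qed

text \<open>With \<open>p\<close> split by \<open>s\<close>, the functionals are the coordinates of
  \<open>s\<close>, and the \<open>e j\<close> are the images under \<open>p\<close> of the unit
  vectors. The expansion is made for one element \<open>x0\<close>, so the finite support of
  \<open>s x0\<close> serves as \<open>J\<close>.\<close>

lemma projective_dual_basis:
  fixes A :: "('a, 'e) ring_scheme" and M :: "('a, 'm, 'r) module_scheme"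
  assumes "projective_module A M" and x0: "x0 \<in> carrier M"
  obtains J :: "'m set" and \<phi> e where "finite J" "e \<in> J \<rightarrow> carrier M"
    and "\<And>j. j \<in> J \<Longrightarrow> \<phi> j \<in> left_module_hom A M (regular_module A)"
    and "x0 = (\<Oplus>\<^bsub>M\<^esub>j\<in>J. \<phi> j x0 \<odot>\<^bsub>M\<^esub> e j)"
proof -
  interpret M: left_module A M using assms(1) by (simp add: projective_module_def)
  obtain I :: "'m set" and s p where s: "s \<in> left_module_hom A M (coproduct_module A I)"
    and p: "p \<in> left_module_hom A (coproduct_module A I) M" and ps: "\<And>x. x \<in> carrier M \<Longrightarrow> p (s x) = x"
    using assms(1) by (auto simp: projective_module_def)
  let ?C = "coproduct_module A I"
  define u where "u i = (\<lambda>j. if j = i then \<one>\<^bsub>A\<^esub> else \<zero>\<^bsub>A\<^esub>)" for i :: 'm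
  have "finite {j. u i j \<noteq> \<zero>\<^bsub>A\<^esub>}" for i
    by (rule finite_subset[of _ "{i}"]) (auto simp: u_def)
  then have u: "u i \<in> carrier ?C" if "i \<in> I" for i
    using that by (auto simp: coproduct_module_def u_def)
  have s_cl: "s x i \<in> carrier A" if "x \<in> carrier M" for x i
  proof -
    have "s x \<in> carrier ?C" using s that by (auto simp: left_module_hom_def)
    then show ?thesis by (cases "i \<in> I") (auto simp: coproduct_module_def)
  qed
  have \<phi>: "(\<lambda>x. s x i) \<in> left_module_hom A M (regular_module A)" for i
    using s s_cl by (auto simp: left_module_hom_def regular_module_def coproduct_module_def)
  define J where "J = {i. s x0 i \<noteq> \<zero>\<^bsub>A\<^esub>}"
  have sx0: "s x0 \<in> carrier ?C" using s x0 by (auto simp: left_module_hom_def)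
  then have J: "finite J" "J \<subseteq> I" by (auto simp: J_def coproduct_module_def)
  have p_add: "p (c \<oplus>\<^bsub>?C\<^esub> d) = p c \<oplus>\<^bsub>M\<^esub> p d" if "c \<in> carrier ?C" "d \<in> carrier ?C" for c d
    using p that by (auto simp: left_module_hom_def)
  have p_smult: "p (a \<odot>\<^bsub>?C\<^esub> c) = a \<odot>\<^bsub>M\<^esub> p c" if "a \<in> carrier A" "c \<in> carrier ?C" for a c
    using p that by (auto simp: left_module_hom_def)
  have p_cl: "p c \<in> carrier M" if "c \<in> carrier ?C" for c
    using p that by (auto simp: left_module_hom_def)
  \<comment> \<open>Truncating \<open>s x0\<close> to a finite \<open>K\<close> lets additivity of
    \<open>p\<close> take in one index at a time.\<close>
  have "p (\<lambda>i. if i \<in> K then s x0 i else \<zero>\<^bsub>A\<^esub>) = (\<Oplus>\<^bsub>M\<^esub>i\<in>K. s x0 i \<odot>\<^bsub>M\<^esub> p (u i))" if "finite K" "K \<subseteq> I" for K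
    using that
  proof (induction K)
    case empty
    have "(\<lambda>i. \<zero>\<^bsub>A\<^esub>) = \<zero>\<^bsub>A\<^esub> \<odot>\<^bsub>?C\<^esub> s x0" using s_cl[OF x0] by (simp add: coproduct_module_def)
    then have "p (\<lambda>i. \<zero>\<^bsub>A\<^esub>) = \<zero>\<^bsub>A\<^esub> \<odot>\<^bsub>M\<^esub> p (s x0)" using p_smult[of "\<zero>\<^bsub>A\<^esub>" "s x0"] sx0 by simp
    then show ?case using M.smult_zero_left p_cl[OF sx0] by simp
  next
    case (insert k K)
    have "finite {i. (if i \<in> K then s x0 i else \<zero>\<^bsub>A\<^esub>) \<noteq> \<zero>\<^bsub>A\<^esub>}"
      by (rule finite_subset[of _ K]) (use insert in auto)
    then have cK: "(\<lambda>i. if i \<in> K then s x0 i else \<zero>\<^bsub>A\<^esub>) \<in> carrier ?C"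
      using insert.prems s_cl[OF x0] by (auto simp: coproduct_module_def)
    have "finite {i. (s x0 k \<odot>\<^bsub>?C\<^esub> u k) i \<noteq> \<zero>\<^bsub>A\<^esub>}"
      by (rule finite_subset[of _ "{k}"]) (use s_cl[OF x0] in \<open>auto simp: u_def coproduct_module_def\<close>)
    then have ck: "s x0 k \<odot>\<^bsub>?C\<^esub> u k \<in> carrier ?C"
      using insert.prems s_cl[OF x0] by (auto simp: coproduct_module_def u_def)
    have "(\<lambda>i. if i \<in> insert k K then s x0 i else \<zero>\<^bsub>A\<^esub>) =
        (s x0 k \<odot>\<^bsub>?C\<^esub> u k) \<oplus>\<^bsub>?C\<^esub> (\<lambda>i. if i \<in> K then s x0 i else \<zero>\<^bsub>A\<^esub>)"
      using insert.hyps s_cl[OF x0] by (auto simp: coproduct_module_def u_def)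
    then have "p (\<lambda>i. if i \<in> insert k K then s x0 i else \<zero>\<^bsub>A\<^esub>) =
        s x0 k \<odot>\<^bsub>M\<^esub> p (u k) \<oplus>\<^bsub>M\<^esub> (\<Oplus>\<^bsub>M\<^esub>i\<in>K. s x0 i \<odot>\<^bsub>M\<^esub> p (u i))"
      using p_add[OF ck cK] p_smult s_cl[OF x0] u insert by simp
    also have "\<dots> = (\<Oplus>\<^bsub>M\<^esub>i\<in>insert k K. s x0 i \<odot>\<^bsub>M\<^esub> p (u i))"
      using insert s_cl[OF x0] u p_cl by (intro M.finsum_insert[symmetric]) (auto intro!: M.smult_closed)
    finally show ?case .
  qed
  from this[OF J] have "p (\<lambda>i. if i \<in> J then s x0 i else \<zero>\<^bsub>A\<^esub>) = (\<Oplus>\<^bsub>M\<^esub>i\<in>J. s x0 i \<odot>\<^bsub>M\<^esub> p (u i))" .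
  moreover have "(\<lambda>i. if i \<in> J then s x0 i else \<zero>\<^bsub>A\<^esub>) = s x0" by (auto simp: J_def)
  ultimately have "x0 = (\<Oplus>\<^bsub>M\<^esub>i\<in>J. s x0 i \<odot>\<^bsub>M\<^esub> p (u i))" using ps[OF x0] by simp
  then show thesis
    using that[of J "\<lambda>i. p (u i)" "\<lambda>i x. s x i"] J \<phi> u p_cl by auto
qed

lemma regular_module_left_module:
  assumes "ring A" "subring S A"
  shows "left_module (A\<lparr>carrier := S\<rparr>) ((regular_module A)\<lparr>carrier := S\<rparr>)"
proof -
  interpret S: ring "A\<lparr>carrier := S\<rparr>" using ring.subring_is_ring[OF assms] .
  have "abelian_group ((regular_module A)\<lparr>carrier := S\<rparr>)"
  proof (rule abelian_groupI)
    fix x assume "x \<in> carrier ((regular_module A)\<lparr>carrier := S\<rparr>)"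
    then have "\<ominus>\<^bsub>A\<lparr>carrier := S\<rparr>\<^esub> x \<in> S" "(\<ominus>\<^bsub>A\<lparr>carrier := S\<rparr>\<^esub> x) \<oplus>\<^bsub>A\<^esub> x = \<zero>\<^bsub>A\<^esub>"
      using S.a_inv_closed[of x] S.l_neg[of x] by auto
    then show "\<exists>y\<in>carrier ((regular_module A)\<lparr>carrier := S\<rparr>).
        y \<oplus>\<^bsub>(regular_module A)\<lparr>carrier := S\<rparr>\<^esub> x = \<zero>\<^bsub>(regular_module A)\<lparr>carrier := S\<rparr>\<^esub>"
      by (auto simp: regular_module_def)
  next
    fix x y assume "x \<in> carrier ((regular_module A)\<lparr>carrier := S\<rparr>)" "y \<in> carrier ((regular_module A)\<lparr>carrier := S\<rparr>)"
    then show "x \<oplus>\<^bsub>(regular_module A)\<lparr>carrier := S\<rparr>\<^esub> y = y \<oplus>\<^bsub>(regular_module A)\<lparr>carrier := S\<rparr>\<^esub> x"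
      using S.a_comm[of x y] by (simp add: regular_module_def)
  qed (use subringE(2,7)[OF assms(2)] S.a_assoc S.l_zero in \<open>auto simp: regular_module_def\<close>)
  then show ?thesis
    unfolding left_module_def left_module_axioms_def
    using S.ring_axioms S.m_assoc S.l_distr S.r_distr S.l_one subringE(6)[OF assms(2)]
    by (auto simp: regular_module_def)
qed

text \<open>A ring has the basis 1 over itself. \<open>free_module\<close> draws its index set from
  the type of the module, and the element \<open>undefined\<close> of that type serves as the single
  index.\<close>

lemma regular_module_free:
  assumes "ring A" "subring S A"
  shows "free_module (A\<lparr>carrier := S\<rparr>) ((regular_module A)\<lparr>carrier := S\<rparr>)"
proof -
  let ?A = "A\<lparr>carrier := S\<rparr>"
  let ?C = "coproduct_module ?A {undefined :: 'a}"
  have u: "(\<lambda>i. if i = undefined then a else \<zero>\<^bsub>A\<^esub>) \<in> carrier ?C" if "a \<in> S" for a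
  proof -
    have "finite {i. (if i = undefined then a else \<zero>\<^bsub>A\<^esub>) \<noteq> \<zero>\<^bsub>A\<^esub>}"
      by (rule finite_subset[of _ "{undefined}"]) auto
    then show ?thesis using that by (auto simp: coproduct_module_def)
  qed
  have "bij_betw (\<lambda>c. c undefined) (carrier ?C) S"
    by (rule bij_betw_byWitness[where f' = "\<lambda>a i. if i = undefined then a else \<zero>\<^bsub>A\<^esub>"])
      (use u in \<open>auto simp: coproduct_module_def fun_eq_iff\<close>)
  moreover have "(\<lambda>c. c undefined) \<in> left_module_hom ?A ?C ((regular_module A)\<lparr>carrier := S\<rparr>)"
    by (auto simp: left_module_hom_def coproduct_module_def regular_module_def)
  ultimately have "free_on ?A ((regular_module A)\<lparr>carrier := S\<rparr>) {undefined :: 'a}"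
    unfolding free_on_def using regular_module_left_module[OF assms] by auto
  then show ?thesis unfolding free_module_def by blast
qed

section \<open>The scalar extension FM and the embedding of M\<close>

context integral_group_ring
begin

context
  fixes M :: "('g \<Rightarrow> 'a, 'm) module"
  assumes M: "left_module RG M" and V: "left_module FG (scalar_ext F R G M)"
begin

abbreviation "baseR \<equiv> F\<lparr>carrier := R\<rparr>"
abbreviation "baseM \<equiv> restrict_to_base baseR G M"
abbreviation "extM \<equiv> scalar_ext F R G M"
abbreviation "ext_emb \<equiv> scalar_ext_emb F R G M"

interpretation M: left_module RG M by (rule M)
interpretation extM: left_module FG extM by (rule V)
interpretation RG: finite_group_ring baseR G by (rule integral_group_ring_finite)

lemma baseM_smult: "r \<in> R \<Longrightarrow> r \<odot>\<^bsub>baseM\<^esub> x = monomial F r \<one>\<^bsub>G\<^esub> \<odot>\<^bsub>M\<^esub> x"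
  using RG.smult_one_eq_monomial[of r] by (simp add: restrict_to_base_def)

lemma scalar_ext_tensor_data: "tensor_data F baseR baseM"
  by unfold_locales
    (auto simp: R_closed baseM_smult monomial_RG M.smult_closed, auto simp: restrict_to_base_def M.smult_closed monomial_RG)

interpretation T: tensor_data F baseR baseM by (rule scalar_ext_tensor_data)

lemma extM_sel: "carrier extM = carrier (tensor_group F baseR baseM)" "add extM = monoid.mult (tensor_group F baseR baseM)"
  "\<zero>\<^bsub>extM\<^esub> = T.cls 0"
  by (simp_all add: scalar_ext_def Let_def T.tensor_one)

lemma baseM_sel: "carrier baseM = carrier M" "add baseM = add M"
  by (simp_all add: restrict_to_base_def)

lemma ext_emb_closed: "m \<in> carrier M \<Longrightarrow> ext_emb m \<in> carrier extM"
  by (simp add: scalar_ext_emb_def extM_sel T.pure_tensor_closed baseM_sel)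

lemma ext_emb_add:
  "\<lbrakk>m \<in> carrier M; m' \<in> carrier M\<rbrakk> \<Longrightarrow> ext_emb (m \<oplus>\<^bsub>M\<^esub> m') = ext_emb m \<oplus>\<^bsub>extM\<^esub> ext_emb m'"
  using T.pure_tensor_add_right[of "\<one>" m m'] by (simp add: scalar_ext_emb_def extM_sel baseM_sel)

lemma ext_emb_zero: "ext_emb \<zero>\<^bsub>M\<^esub> = \<zero>\<^bsub>extM\<^esub>"
proof -
  have "ext_emb \<zero>\<^bsub>M\<^esub> \<oplus>\<^bsub>extM\<^esub> ext_emb \<zero>\<^bsub>M\<^esub> = ext_emb \<zero>\<^bsub>M\<^esub>"
    using ext_emb_add[of "\<zero>\<^bsub>M\<^esub>" "\<zero>\<^bsub>M\<^esub>"] by simp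
  then show ?thesis using ext_emb_closed[of "\<zero>\<^bsub>M\<^esub>"] by simp
qed

lemma pure_tensor_R:
  "\<lbrakk>r \<in> R; m \<in> carrier M\<rbrakk> \<Longrightarrow> pure_tensor F baseR baseM r m = ext_emb (monomial F r \<one>\<^bsub>G\<^esub> \<odot>\<^bsub>M\<^esub> m)"
  using T.pure_tensor_balance[of "\<one>" r m] by (simp add: scalar_ext_emb_def baseM_sel baseM_smult R_closed)

abbreviation "frag_act s \<equiv> \<lambda>(c, m). \<Sum>h\<in>carrier G. frag_of (s h \<otimes> c, monomial F \<one> h \<odot>\<^bsub>M\<^esub> m)"

text \<open>The action is checked against the relations one group element \<open>h\<close> at a
  time. The balancing relation requires that \<open>h\<close> commutes with scalars from
  \<open>R\<close>, which are central in R[G].\<close>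

lemma scalar_ext_smult:
  assumes s: "s \<in> carrier FG"
  shows "s \<odot>\<^bsub>extM\<^esub> T.cls c = T.cls (frag_extend (frag_act s) c)"
proof -
  note sc = FG.coeff_closed[OF s]
  have el: "group_elem baseR h = monomial F \<one> h" for h
    by (simp add: group_elem_eq_monomial)
  have hm: "monomial F \<one> h \<odot>\<^bsub>M\<^esub> m \<in> carrier M" if "h \<in> carrier G" "m \<in> carrier M" for h m
    using that by (simp add: M.smult_closed group_elem_RG)
  have "frag_extend (frag_act s) k \<in> T.ker" if "k \<in> T.ker" for k
    using that
  proof (rule T.tensor_kernel_induct)
    fix a a' x assume a: "a \<in> carrier F" "a' \<in> carrier F" "x \<in> carrier baseM"
    have "(\<Sum>h\<in>carrier G. frag_of (s h \<otimes> (a \<oplus> a'), monomial F \<one> h \<odot>\<^bsub>M\<^esub> x)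
        - frag_of (s h \<otimes> a, monomial F \<one> h \<odot>\<^bsub>M\<^esub> x)
        - frag_of (s h \<otimes> a', monomial F \<one> h \<odot>\<^bsub>M\<^esub> x)) \<in> T.ker"
      using a sc hm by (intro T.kernel_sum) (simp add: r_distr T.kernel_add_left baseM_sel)
    then show "frag_extend (frag_act s) (frag_of (a \<oplus> a', x) - frag_of (a, x) - frag_of (a', x)) \<in> T.ker"
      by (simp add: frag_extend_diff sum_subtractf)
  next
    fix a x x' assume a: "a \<in> carrier F" "x \<in> carrier baseM" "x' \<in> carrier baseM"
    have "(\<Sum>h\<in>carrier G. frag_of (s h \<otimes> a, monomial F \<one> h \<odot>\<^bsub>M\<^esub> (x \<oplus>\<^bsub>M\<^esub> x'))
        - frag_of (s h \<otimes> a, monomial F \<one> h \<odot>\<^bsub>M\<^esub> x)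
        - frag_of (s h \<otimes> a, monomial F \<one> h \<odot>\<^bsub>M\<^esub> x')) \<in> T.ker"
    proof (intro T.kernel_sum)
      fix h assume "h \<in> carrier G"
      then show "frag_of (s h \<otimes> a, monomial F \<one> h \<odot>\<^bsub>M\<^esub> (x \<oplus>\<^bsub>M\<^esub> x'))
        - frag_of (s h \<otimes> a, monomial F \<one> h \<odot>\<^bsub>M\<^esub> x)
        - frag_of (s h \<otimes> a, monomial F \<one> h \<odot>\<^bsub>M\<^esub> x') \<in> T.ker"
        using a sc hm T.kernel_add_right[of "s h \<otimes> a" "monomial F \<one> h \<odot>\<^bsub>M\<^esub> x" "monomial F \<one> h \<odot>\<^bsub>M\<^esub> x'"]
        by (simp add: baseM_sel M.smult_r_distr group_elem_RG)
    qed
    then show "frag_extend (frag_act s) (frag_of (a, x \<oplus>\<^bsub>baseM\<^esub> x') - frag_of (a, x) - frag_of (a, x')) \<in> T.ker"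
      by (simp add: frag_extend_diff sum_subtractf baseM_sel)
  next
    fix a b x assume a: "a \<in> carrier F" "b \<in> carrier baseR" "x \<in> carrier baseM"
    have "(\<Sum>h\<in>carrier G. frag_of (s h \<otimes> (a \<otimes> b), monomial F \<one> h \<odot>\<^bsub>M\<^esub> x)
        - frag_of (s h \<otimes> a, monomial F \<one> h \<odot>\<^bsub>M\<^esub> (b \<odot>\<^bsub>baseM\<^esub> x))) \<in> T.ker"
    proof (intro T.kernel_sum)
      fix h assume h: "h \<in> carrier G"
      have bR: "b \<in> R" "b \<in> carrier F" using a R_closed(7) by auto
      have "monomial F \<one> h \<odot>\<^bsub>M\<^esub> (b \<odot>\<^bsub>baseM\<^esub> x) = b \<odot>\<^bsub>baseM\<^esub> (monomial F \<one> h \<odot>\<^bsub>M\<^esub> x)"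
        using a bR h RG.scalar_central[of b "monomial F \<one> h"]
        by (simp add: baseM_smult baseM_sel M.smult_assoc[symmetric] group_elem_RG monomial_RG)
      then show "frag_of (s h \<otimes> (a \<otimes> b), monomial F \<one> h \<odot>\<^bsub>M\<^esub> x)
        - frag_of (s h \<otimes> a, monomial F \<one> h \<odot>\<^bsub>M\<^esub> (b \<odot>\<^bsub>baseM\<^esub> x)) \<in> T.ker"
        using a bR sc h hm T.kernel_balance[of "s h \<otimes> a" b "monomial F \<one> h \<odot>\<^bsub>M\<^esub> x"]
        by (simp add: baseM_sel m_assoc)
    qed
    then show "frag_extend (frag_act s) (frag_of (a \<otimes> b, x) - frag_of (a, b \<odot>\<^bsub>baseM\<^esub> x)) \<in> T.ker"
      by (simp add: frag_extend_diff sum_subtractf)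
  qed (auto simp: frag_extend_diff T.kernel_zero T.kernel_diff)
  then show ?thesis
    using T.tensor_map_cls[OF T.tensor_data_axioms] by (simp add: scalar_ext_def Let_def el)
qed

text \<open>In the sum defining the action, each summand except the one at \<open>h\<close> has
  first component zero. Such a generator is not zero in the free abelian group but lies in the
  kernel, by the relation for \<open>\<zero> \<oplus> \<zero>\<close>.\<close>

lemma scalar_ext_smult_monomial:
  assumes r: "r \<in> carrier F" and h: "h \<in> carrier G" and c: "c \<in> carrier F" and m: "m \<in> carrier M"
  shows "monomial F r h \<odot>\<^bsub>extM\<^esub> pure_tensor F baseR baseM c m =
    pure_tensor F baseR baseM (r \<otimes> c) (monomial F \<one> h \<odot>\<^bsub>M\<^esub> m)"
proof -
  have zero: "frag_of (\<zero>, x) \<in> T.ker" if "x \<in> carrier M" for x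
    using T.kernel_uminus[OF T.kernel_add_left[of "\<zero>" "\<zero>" x]] that by (simp add: baseM_sel)
  let ?f = "\<lambda>k. frag_of (monomial F r h k \<otimes> c, monomial F \<one> k \<odot>\<^bsub>M\<^esub> m)"
  have "sum ?f (carrier G) = ?f h + sum ?f (carrier G - {h})"
    using h FG.finite_group by (simp add: sum.remove)
  moreover have "sum ?f (carrier G - {h}) \<in> T.ker"
  proof (rule T.kernel_sum)
    fix k assume k: "k \<in> carrier G - {h}"
    then have "monomial F r h k \<otimes> c = \<zero>" using c by (simp add: monomial_def)
    then show "?f k \<in> T.ker" using zero[of "monomial F \<one> k \<odot>\<^bsub>M\<^esub> m"] k m by (simp add: M.smult_closed group_elem_RG)
  qed
  ultimately have "T.cls (sum ?f (carrier G)) = T.cls (?f h)"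
    by (simp add: T.cls_eq_iff)
  then show ?thesis
    using scalar_ext_smult[OF FG.monomial_closed[OF r h], of "frag_of (c, m)"]
    by (simp add: T.pure_tensor_eq) (simp add: monomial_def[of F r])
qed

lemma ext_emb_smult:
  assumes "b \<in> carrier RG" "m \<in> carrier M"
  shows "ext_emb (b \<odot>\<^bsub>M\<^esub> m) = b \<odot>\<^bsub>extM\<^esub> ext_emb m"
  using assms
proof (induction rule: RG.group_ring_induct)
  case zero
  then show ?case
    using M.smult_zero_left extM.smult_zero_left[OF ext_emb_closed] ext_emb_zero by simp
next
  case (add r h b)
  then have r: "r \<in> R" by simp
  have hm: "monomial F \<one> h \<odot>\<^bsub>M\<^esub> m \<in> carrier M"
    using add by (simp add: M.smult_closed group_elem_RG)
  have RGF: "x \<in> carrier FG" if "x \<in> carrier RG" for x using that by (simp add: RG_carrier_iff)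
  \<comment> \<open>The action puts \<open>r\<close> into the first tensor factor; as it lies in
    \<open>R\<close>, the next step moves it across to act on M.\<close>
  have "monomial F r h \<odot>\<^bsub>extM\<^esub> ext_emb m = pure_tensor F baseR baseM r (monomial F \<one> h \<odot>\<^bsub>M\<^esub> m)"
    using scalar_ext_smult_monomial[of r h "\<one>" m] add r by (simp add: scalar_ext_emb_def R_closed)
  also have "\<dots> = ext_emb ((monomial F r \<one>\<^bsub>G\<^esub> \<otimes>\<^bsub>RG\<^esub> monomial F \<one> h) \<odot>\<^bsub>M\<^esub> m)"
    using r hm add by (simp add: pure_tensor_R M.smult_assoc monomial_RG group_elem_RG)
  also have "monomial F r \<one>\<^bsub>G\<^esub> \<otimes>\<^bsub>RG\<^esub> monomial F \<one> h = monomial F r h"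
    using RG.monomial_mult_monomial[of r "\<one>" "\<one>\<^bsub>G\<^esub>" h] r add by (simp add: R_closed)
  finally have mon: "ext_emb (monomial F r h \<odot>\<^bsub>M\<^esub> m) = monomial F r h \<odot>\<^bsub>extM\<^esub> ext_emb m" by simp
  have rh: "monomial F r h \<in> carrier RG" using r add by (simp add: monomial_RG)
  have "ext_emb ((monomial F r h \<oplus>\<^bsub>RG\<^esub> b) \<odot>\<^bsub>M\<^esub> m) = ext_emb (monomial F r h \<odot>\<^bsub>M\<^esub> m) \<oplus>\<^bsub>extM\<^esub> ext_emb (b \<odot>\<^bsub>M\<^esub> m)"
    using rh add M.smult_l_distr[OF rh, of b m] by (simp add: ext_emb_add M.smult_closed)
  also have "\<dots> = (monomial F r h \<oplus>\<^bsub>FG\<^esub> b) \<odot>\<^bsub>extM\<^esub> ext_emb m"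
    using rh add mon RGF by (simp add: extM.smult_l_distr ext_emb_closed del: group_ring_add)
  finally show ?case by simp
qed

text \<open>Denominators multiply: for a difference, the product of both denominators works because
  M is stable under \<open>R\<close>. Applied to the basis vector of FM, this yields a nonzero
  scalar of \<open>R\<close> in the coordinate lattice, the substitute for 1.\<close>

lemma ext_emb_denominator:
  assumes frac: "\<And>x. x \<in> carrier F \<Longrightarrow> \<exists>r\<in>R - {\<zero>}. r \<otimes> x \<in> R" and v: "v \<in> carrier extM"
  shows "\<exists>r\<in>R - {\<zero>}. monomial F r \<one>\<^bsub>G\<^esub> \<odot>\<^bsub>extM\<^esub> v \<in> ext_emb ` carrier M"
proof -
  let ?m = "\<lambda>r. monomial F r \<one>\<^bsub>G\<^esub>"
  have smult: "?m r \<odot>\<^bsub>extM\<^esub> w \<in> ext_emb ` carrier M" if r: "r \<in> R" and w: "w \<in> ext_emb ` carrier M" for r w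
  proof -
    obtain m where m: "m \<in> carrier M" "w = ext_emb m" using w by blast
    have "?m r \<in> carrier RG" using r by (simp add: monomial_RG)
    then have "?m r \<odot>\<^bsub>extM\<^esub> w = ext_emb (?m r \<odot>\<^bsub>M\<^esub> m)" "?m r \<odot>\<^bsub>M\<^esub> m \<in> carrier M"
      using m ext_emb_smult M.smult_closed by auto
    then show ?thesis by blast
  qed
  have mF: "?m r \<in> carrier FG" if "r \<in> R" for r using that by (simp add: FG.monomial_closed R_closed)
  have ext_emb_uminus: "\<ominus>\<^bsub>extM\<^esub> ext_emb m = ext_emb (\<ominus>\<^bsub>M\<^esub> m)" if "m \<in> carrier M" for m
  proof -
    have "ext_emb (\<ominus>\<^bsub>M\<^esub> m) \<oplus>\<^bsub>extM\<^esub> ext_emb m = \<zero>\<^bsub>extM\<^esub>"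
      using ext_emb_add[of "\<ominus>\<^bsub>M\<^esub> m" m] that by (simp add: M.M.l_neg ext_emb_zero)
    then show ?thesis using that ext_emb_closed by (intro extM.M.minus_equality) auto
  qed
  from v have "v \<in> carrier (tensor_group F baseR baseM)" by (simp add: extM_sel)
  then show ?thesis
  proof (induction rule: T.tensor_induct)
    case zero
    have "?m \<one> \<odot>\<^bsub>extM\<^esub> \<zero>\<^bsub>extM\<^esub> = \<zero>\<^bsub>extM\<^esub>" using extM.smult_one by (simp add: group_ring_one)
    moreover have "\<zero>\<^bsub>extM\<^esub> \<in> ext_emb ` carrier M"
      using ext_emb_zero by (metis M.M.zero_closed image_eqI)
    ultimately show ?case using R_closed(6) one_not_zero by (intro bexI[of _ "\<one>"]) (auto simp: extM_sel)
  next
    case (diff c d)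
    then obtain r t where r: "r \<in> R" "r \<noteq> \<zero>" "?m r \<odot>\<^bsub>extM\<^esub> T.cls c \<in> ext_emb ` carrier M"
      and t: "t \<in> R" "t \<noteq> \<zero>" "?m t \<odot>\<^bsub>extM\<^esub> T.cls d \<in> ext_emb ` carrier M" by auto
    have cd: "T.cls c \<in> carrier extM" "T.cls d \<in> carrier extM" "T.cls (c - d) \<in> carrier extM"
    proof -
      have "c - d \<in> carrier T.frags" using diff(1,2) by (auto dest: subsetD[OF keys_diff])
      then show "T.cls c \<in> carrier extM" "T.cls d \<in> carrier extM" "T.cls (c - d) \<in> carrier extM"
        using diff(1,2) by (auto simp: extM_sel T.tensor_carrier)
    qed
    have rt: "r \<otimes> t \<in> R" "r \<otimes> t \<noteq> \<zero>" using r t by (auto simp: R_closed integral_iff)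
    have mm: "?m (r \<otimes> t) = ?m r \<cdot> ?m t" "?m (r \<otimes> t) = ?m t \<cdot> ?m r"
      using r t by (simp_all add: FG.monomial_mult_monomial R_closed m_comm)
    have 1: "?m (r \<otimes> t) \<odot>\<^bsub>extM\<^esub> T.cls c \<in> ext_emb ` carrier M"
      using smult[OF t(1) r(3)] cd r t by (simp add: mm(2) extM.smult_assoc mF)
    have 2: "?m (r \<otimes> t) \<odot>\<^bsub>extM\<^esub> T.cls d \<in> ext_emb ` carrier M"
      using smult[OF r(1) t(3)] cd r t by (simp add: mm(1) extM.smult_assoc mF)
    have "T.cls (c - d) \<oplus>\<^bsub>extM\<^esub> T.cls d = T.cls c" by (simp add: extM_sel T.tensor_mult)
    then have "?m (r \<otimes> t) \<odot>\<^bsub>extM\<^esub> T.cls (c - d) \<oplus>\<^bsub>extM\<^esub> ?m (r \<otimes> t) \<odot>\<^bsub>extM\<^esub> T.cls d = ?m (r \<otimes> t) \<odot>\<^bsub>extM\<^esub> T.cls c"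
      using extM.smult_r_distr[OF mF[OF rt(1)] cd(3,2)] by simp
    then have eq: "?m (r \<otimes> t) \<odot>\<^bsub>extM\<^esub> T.cls (c - d) = ?m (r \<otimes> t) \<odot>\<^bsub>extM\<^esub> T.cls c \<oplus>\<^bsub>extM\<^esub> (\<ominus>\<^bsub>extM\<^esub> (?m (r \<otimes> t) \<odot>\<^bsub>extM\<^esub> T.cls d))"
      using extM.smult_closed[OF mF[OF rt(1)]] cd by (simp add: extM.M.add.inv_solve_right)
    obtain m m' where "m \<in> carrier M" "m' \<in> carrier M"
      "?m (r \<otimes> t) \<odot>\<^bsub>extM\<^esub> T.cls c = ext_emb m" "?m (r \<otimes> t) \<odot>\<^bsub>extM\<^esub> T.cls d = ext_emb m'"
      using 1 2 by blast
    then have "?m (r \<otimes> t) \<odot>\<^bsub>extM\<^esub> T.cls (c - d) = ext_emb (m \<oplus>\<^bsub>M\<^esub> (\<ominus>\<^bsub>M\<^esub> m'))" "m \<oplus>\<^bsub>M\<^esub> (\<ominus>\<^bsub>M\<^esub> m') \<in> carrier M"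
      using eq by (simp_all add: ext_emb_add ext_emb_uminus)
    then show ?case using rt by blast
  next
    case (pure c m)
    then have m: "m \<in> carrier M" by (simp add: baseM_sel)
    obtain r where r: "r \<in> R" "r \<noteq> \<zero>" "r \<otimes> c \<in> R" using frac[OF pure(1)] by blast
    have "?m r \<odot>\<^bsub>extM\<^esub> pure_tensor F baseR baseM c m = pure_tensor F baseR baseM (r \<otimes> c) (?m \<one> \<odot>\<^bsub>M\<^esub> m)"
      using r pure m by (intro scalar_ext_smult_monomial) (auto simp: R_closed)
    also have "\<dots> = ext_emb (?m (r \<otimes> c) \<odot>\<^bsub>M\<^esub> (?m \<one> \<odot>\<^bsub>M\<^esub> m))"
      using r m by (intro pure_tensor_R) (auto intro!: M.smult_closed group_elem_RG)
    finally show ?case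
      using r m by (auto simp: T.pure_tensor_eq intro!: bexI[of _ r] imageI M.smult_closed group_elem_RG monomial_RG)
  qed
qed

end

end

section \<open>Induced lattices\<close>

text \<open>The ideal generated by \<open>p\<close> is proper, so neither \<open>p\<close> nor a
  positive power of it has an inverse in \<open>R\<close>. A zero \<open>p\<close> would make the
  zero ideal maximal, against the nonzero prime ideal in the definition of a discrete valuation
  ring.\<close>

lemma uniformizer_power_inverse_not_mem:
  assumes F: "field F" and R: "subring R F" and dvr: "discrete_valuation_ring (F\<lparr>carrier := R\<rparr>)"
    and p: "uniformizer (F\<lparr>carrier := R\<rparr>) p"
  shows "p \<in> R" "p \<noteq> \<zero>\<^bsub>F\<^esub>" "0 < n \<Longrightarrow> inv\<^bsub>F\<^esub> (p [^]\<^bsub>F\<^esub> (n::nat)) \<notin> R"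
proof -
  interpret F: field F by fact
  let ?K = "F\<lparr>carrier := R\<rparr>"
  show pR: "p \<in> R" using p by (simp add: uniformizer_def)
  then have pF: "p \<in> carrier F" using subringE(1)[OF R] by blast
  have max: "maximalideal (PIdl\<^bsub>?K\<^esub> p) ?K" using p by (simp add: uniformizer_def)
  interpret max: maximalideal "PIdl\<^bsub>?K\<^esub> p" ?K by (rule max)
  show p0: "p \<noteq> \<zero>\<^bsub>F\<^esub>"
  proof
    assume "p = \<zero>\<^bsub>F\<^esub>"
    then have zero: "PIdl\<^bsub>?K\<^esub> p = {\<zero>\<^bsub>F\<^esub>}"
      using subringE(1,2)[OF R] by (auto simp: cgenideal_def subset_iff intro!: exI[of _ "\<zero>\<^bsub>F\<^esub>"])
    obtain I where I: "primeideal I ?K" "I \<noteq> {\<zero>\<^bsub>?K\<^esub>}"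
      using dvr by (auto simp: discrete_valuation_ring_def)
    interpret I: primeideal I ?K by (rule I(1))
    have "{\<zero>\<^bsub>F\<^esub>} \<subseteq> I" using I.zero_closed by simp
    then have "I = PIdl\<^bsub>?K\<^esub> p \<or> I = carrier ?K"
      using max.I_maximal[OF I.is_ideal] I.a_subset zero by simp
    then show False using I(2) zero I.I_notcarr by auto
  qed
  assume n: "0 < n"
  show "inv\<^bsub>F\<^esub> (p [^]\<^bsub>F\<^esub> n) \<notin> R"
  proof
    assume inv: "inv\<^bsub>F\<^esub> (p [^]\<^bsub>F\<^esub> n) \<in> R"
    \<comment> \<open>Positivity of \<open>n\<close> leaves one factor \<open>p\<close>, which puts
      1 into the ideal generated by \<open>p\<close>.\<close>
    obtain m where m: "n = Suc m" using n gr0_implies_Suc by blast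
    have pow: "p [^]\<^bsub>F\<^esub> k \<in> R \<and> p [^]\<^bsub>F\<^esub> k \<noteq> \<zero>\<^bsub>F\<^esub>" for k :: nat
      by (induction k) (use pR p0 pF subringE(3,6)[OF R] in \<open>simp_all add: F.integral_iff\<close>)
    then have cF: "p [^]\<^bsub>F\<^esub> n \<in> Units F" using pF by (simp add: F.field_Units)
    have "inv\<^bsub>F\<^esub> (p [^]\<^bsub>F\<^esub> n) \<otimes>\<^bsub>F\<^esub> p [^]\<^bsub>F\<^esub> m \<otimes>\<^bsub>F\<^esub> p = inv\<^bsub>F\<^esub> (p [^]\<^bsub>F\<^esub> n) \<otimes>\<^bsub>F\<^esub> p [^]\<^bsub>F\<^esub> n"
      using pF F.Units_inv_closed[OF cF] by (simp add: m F.m_assoc)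
    also have "\<dots> = \<one>\<^bsub>F\<^esub>" using F.Units_l_inv[OF cF] .
    finally have eq: "\<one>\<^bsub>F\<^esub> = inv\<^bsub>F\<^esub> (p [^]\<^bsub>F\<^esub> n) \<otimes>\<^bsub>F\<^esub> p [^]\<^bsub>F\<^esub> m \<otimes>\<^bsub>F\<^esub> p" by simp
    have "inv\<^bsub>F\<^esub> (p [^]\<^bsub>F\<^esub> n) \<otimes>\<^bsub>F\<^esub> p [^]\<^bsub>F\<^esub> m \<in> R"
      using inv pow subringE(6)[OF R] by blast
    with eq have "\<one>\<^bsub>F\<^esub> \<in> PIdl\<^bsub>?K\<^esub> p" by (auto simp: cgenideal_def)
    then show False using max.one_imp_carrier max.I_notcarr by simp
  qed
qed

lemma associated_order_transport:
  assumes "inj_on f (carrier V)" "E \<subseteq> carrier V"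
    and "\<And>a x. \<lbrakk>a \<in> carrier A; x \<in> carrier V\<rbrakk> \<Longrightarrow> a \<odot>\<^bsub>V\<^esub> x \<in> carrier V \<and> f (a \<odot>\<^bsub>V\<^esub> x) = a \<otimes>\<^bsub>A\<^esub> f x"
  shows "associated_order A V E = {a \<in> carrier A. \<forall>y\<in>f ` E. a \<otimes>\<^bsub>A\<^esub> y \<in> f ` E}"
proof -
  have "a \<odot>\<^bsub>V\<^esub> x \<in> E \<longleftrightarrow> a \<otimes>\<^bsub>A\<^esub> f x \<in> f ` E" if "a \<in> carrier A" "x \<in> E" for a x
    using that assms inj_on_image_mem_iff[OF assms(1), of "a \<odot>\<^bsub>V\<^esub> x" E] by (metis subsetD)
  then show ?thesis by (auto simp: associated_order_def)
qed

lemma induced_module_sel: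
  "carrier (induced_module A B X) = carrier (tensor_group A B X)"
  "add (induced_module A B X) = monoid.mult (tensor_group A B X)"
  by (simp_all add: induced_module_def)

text \<open>Applied to R[G]L, this shows that the order of the normal closure is a ring; applied to
  \<open>L\<close>, that the order of \<open>P\<close> in F[H] is closed under products. Neither
  needs a computation with coefficients.\<close>

lemma (in ring) multiplier_subring:
  assumes U: "subgroup U (add_monoid R)"
  shows "subring {s \<in> carrier R. \<forall>x\<in>U. s \<otimes> x \<in> U} R"
proof (rule subringI)
  have UR: "x \<in> carrier R" if "x \<in> U" for x using subgroup.mem_carrier[OF U that] by simp
  fix s assume s: "s \<in> {s \<in> carrier R. \<forall>x\<in>U. s \<otimes> x \<in> U}"
  then show "\<ominus> s \<in> {s \<in> carrier R. \<forall>x\<in>U. s \<otimes> x \<in> U}"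
    using add_subgroup_a_inv_closed[OF U] UR by (auto simp: l_minus)
  fix t assume t: "t \<in> {s \<in> carrier R. \<forall>x\<in>U. s \<otimes> x \<in> U}"
  show "s \<otimes> t \<in> {s \<in> carrier R. \<forall>x\<in>U. s \<otimes> x \<in> U}"
    using s t UR by (auto simp: m_assoc)
  show "s \<oplus> t \<in> {s \<in> carrier R. \<forall>x\<in>U. s \<otimes> x \<in> U}"
    using s t UR subgroup.m_closed[OF U] by (auto simp: l_distr)
next
  show "\<one> \<in> {s \<in> carrier R. \<forall>x\<in>U. s \<otimes> x \<in> U}"
    using subgroup.mem_carrier[OF U] by auto
qed auto

context integral_group_ring
begin

lemma common_denominator:
  assumes frac: "\<And>x. x \<in> carrier F \<Longrightarrow> \<exists>r\<in>R - {\<zero>}. r \<otimes> x \<in> R" and a: "a \<in> carrier FG"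
  shows "\<exists>d\<in>R - {\<zero>}. monomial F d \<one>\<^bsub>G\<^esub> \<cdot> a \<in> carrier RG"
proof -
  note ac = FG.coeff_closed[OF a]
  have "\<exists>d\<in>R - {\<zero>}. \<forall>g\<in>S. d \<otimes> a g \<in> R" if "finite S" for S
    using that
  proof (induction S)
    case empty
    then show ?case using R_closed(6) one_not_zero by auto
  next
    case (insert x S)
    then obtain d where d: "d \<in> R" "d \<noteq> \<zero>" "\<And>g. g \<in> S \<Longrightarrow> d \<otimes> a g \<in> R" by auto
    obtain r where r: "r \<in> R" "r \<noteq> \<zero>" "r \<otimes> a x \<in> R" using frac[OF ac] by blast
    have "d \<otimes> r \<otimes> a g \<in> R" if "g \<in> insert x S" for g
    proof (cases "g = x")
      case True
      have "d \<otimes> r \<otimes> a g = d \<otimes> (r \<otimes> a x)"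
        using True d(1) r(1) ac by (simp add: m_assoc R_closed(7))
      then show ?thesis using R_closed(2)[OF d(1) r(3)] by simp
    next
      case False
      have "d \<otimes> r \<otimes> a g = r \<otimes> (d \<otimes> a g)"
        using d(1) r(1) ac by (simp add: m_lcomm m_assoc R_closed(7))
      then show ?thesis using R_closed(2)[OF r(1) d(3)] False that by simp
    qed
    then show ?case using d r by (intro bexI[of _ "d \<otimes> r"]) (auto simp: R_closed integral_iff)
  qed
  from this[OF FG.finite_group] obtain d where d: "d \<in> R" "d \<noteq> \<zero>"
    "\<And>g. g \<in> carrier G \<Longrightarrow> d \<otimes> a g \<in> R" by auto
  have "d \<otimes> a g \<in> R" for g
    using d a by (cases "g \<in> carrier G") (auto simp: FG.coeff_outside R_closed)
  moreover have dF: "d \<in> carrier F" using R_closed(7)[OF d(1)] .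
  ultimately have "d \<odot>\<^bsub>FG\<^esub> a \<in> carrier RG"
    using FG.group_ring_smult_closed[OF dF a] by (simp add: RG_carrier_iff)
  then have "monomial F d \<one>\<^bsub>G\<^esub> \<cdot> a \<in> carrier RG"
    using FG.group_ring_smult_eq_mult[OF dF a] by simp
  then show ?thesis using d by blast
qed

end

section \<open>Images of induced modules in coordinates\<close>

context subgroup_integral_group_ring
begin

lemma RG_RH_tensor_data:
  assumes "\<And>x y. \<lbrakk>x \<in> carrier X; y \<in> carrier X\<rbrakk> \<Longrightarrow> x \<oplus>\<^bsub>X\<^esub> y \<in> carrier X"
    and "\<And>b x. \<lbrakk>b \<in> carrier RH; x \<in> carrier X\<rbrakk> \<Longrightarrow> b \<odot>\<^bsub>X\<^esub> x \<in> carrier X"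
  shows "tensor_data RG RH X"
proof -
  interpret RG: finite_group_ring "F\<lparr>carrier := R\<rparr>" G by (rule integral_group_ring_finite)
  show ?thesis
  proof (rule tensor_data.intro)
    fix a b assume "a \<in> carrier RG" "b \<in> carrier RH"
    then show "a \<otimes>\<^bsub>RG\<^esub> b \<in> carrier RG"
      using RG.KG.m_closed[of a b] RH_subset_RG by blast
  qed (fact RG.KG.a_closed assms)+
qed

text \<open>The coordinate \<open>\<Phi>\<close> carries the generators
  \<open>a \<otimes> j x\<close> to products \<open>a \<cdot> l\<close> with
  \<open>l \<in> L\<close>, which lie in R[G]L. Conversely, the coset decomposition writes an
  element of R[G]L as a finite sum of terms \<open>t \<cdot> l\<close>, each the image of a
  generator. The lemma is used twice, for M and for a stable subgroup of F[H].\<close>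

lemma induced_image_eq:
  assumes V: "left_module FH V" and \<psi>: "\<psi> ` carrier V \<subseteq> carrier FH"
    and \<Phi>: "\<Phi> \<in> carrier (induced_module FG FH V) \<rightarrow> carrier FG"
      "\<And>x y. \<lbrakk>x \<in> carrier (induced_module FG FH V); y \<in> carrier (induced_module FG FH V)\<rbrakk> \<Longrightarrow>
        \<Phi> (x \<oplus>\<^bsub>induced_module FG FH V\<^esub> y) = \<Phi> x \<oplus>\<^bsub>FG\<^esub> \<Phi> y"
      "\<And>a v. \<lbrakk>a \<in> carrier FG; v \<in> carrier V\<rbrakk> \<Longrightarrow> \<Phi> (pure_tensor FG FH V a v) = a \<cdot> \<psi> v"
    and X: "tensor_data RG RH X"
    and j: "j \<in> carrier X \<rightarrow> carrier V"
      "\<And>x y. \<lbrakk>x \<in> carrier X; y \<in> carrier X\<rbrakk> \<Longrightarrow> j (x \<oplus>\<^bsub>X\<^esub> y) = j x \<oplus>\<^bsub>V\<^esub> j y"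
      "\<And>b x. \<lbrakk>b \<in> carrier RH; x \<in> carrier X\<rbrakk> \<Longrightarrow> j (b \<odot>\<^bsub>X\<^esub> x) = b \<odot>\<^bsub>V\<^esub> j x"
    and L: "L = \<psi> ` j ` carrier X" "subgroup L (add_monoid FH)"
      "\<And>b l. \<lbrakk>b \<in> carrier RH; l \<in> L\<rbrakk> \<Longrightarrow> b \<cdot>\<^sub>H l \<in> L"
  shows "induced_image F R G H X j V \<subseteq> carrier (induced_module FG FH V)"
    and "\<Phi> ` induced_image F R G H X j V = induced_sub L"
proof -
  have FH_FG: "carrier FH \<subseteq> carrier FG" by (auto simp: FH_carrier_iff)
  have T: "tensor_data FG FH V"
    using FG.group_ring_ring FH_FG V by (rule left_module_tensor_data)
  have \<Phi>hom: "\<Phi> \<in> hom (tensor_group FG FH V) (add_monoid FG)"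
    using \<Phi>(1,2) by (auto simp: hom_def induced_module_sel)
  have RG_FG: "carrier RG \<subseteq> carrier FG" by (auto simp: RG_carrier_iff)
  have mult: "a \<otimes>\<^bsub>RG\<^esub> b = a \<cdot> b" if "a \<in> carrier RG" "b \<in> carrier RH" for a b
    using that RG_mult RH_subset_RG by blast
  have RH_FH: "carrier RH \<subseteq> carrier FH" by (auto simp: sub.RG_carrier_iff)
  have add: "a \<oplus>\<^bsub>RG\<^esub> b = a \<oplus>\<^bsub>FG\<^esub> b" for a b by simp
  note span = tensor_image_span[OF X T RG_FG add mult RH_FH j FG.KG.abelian_group_axioms \<Phi>hom]
  have im: "induced_image F R G H X j V =
      tensor_map (tensor_kernel FG FH V) (\<lambda>(a, x). frag_of (a, j x)) ` carrier (tensor_group RG RH X)"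
    by (simp add: induced_image_def induced_module_sel)
  show "induced_image F R G H X j V \<subseteq> carrier (induced_module FG FH V)"
    using span(1) by (simp add: im induced_module_sel)
  have jV: "j x \<in> carrier V" if "x \<in> carrier X" for x using j(1) that by blast
  have "\<Phi> ` induced_image F R G H X j V \<subseteq> induced_sub L"
    unfolding im
  proof (rule span(2))
    show "subgroup (induced_sub L) (add_monoid FG)" using L(2) by (rule induced_sub_subgroup)
    fix a x assume a: "a \<in> carrier RG" and x: "x \<in> carrier X"
    have "\<psi> (j x) \<in> L" using L(1) x by blast
    then show "\<Phi> (pure_tensor FG FH V a (j x)) \<in> induced_sub L"
      using RG_mult_L_mem[OF L(2,3) a] \<Phi>(3)[of a "j x"] jV[OF x] a RG_FG by auto
  qed
  moreover have "y \<in> \<Phi> ` induced_image F R G H X j V" if y: "y \<in> induced_sub L" for y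
  proof -
    have yF: "y \<in> carrier FG" using y by (simp add: induced_sub_def)
    obtain T where T: "finite T" "T \<subseteq> carrier G"
      and dec: "\<And>a. a \<in> carrier FG \<Longrightarrow> a = (\<Oplus>\<^bsub>FG\<^esub>t\<in>T. monomial F \<one> t \<cdot> coset_part t a)"
      by (rule coset_decomposition) (rule that, assumption+)
    have "\<forall>t\<in>T. \<exists>x\<in>carrier X. coset_part t y = \<psi> (j x)"
      using y T(2) L(1) by (auto simp: induced_sub_def)
    then obtain x where x: "\<And>t. t \<in> T \<Longrightarrow> x t \<in> carrier X" "\<And>t. t \<in> T \<Longrightarrow> coset_part t y = \<psi> (j (x t))"
      by metis
    have mono: "monomial F \<one> t \<in> carrier RG" if "t \<in> T" for t using T(2) that group_elem_RG by blast
    have "y = (\<Oplus>\<^bsub>FG\<^esub>t\<in>T. monomial F \<one> t \<cdot> coset_part t y)" by (rule dec[OF yF])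
    also have "\<dots> = (\<Oplus>\<^bsub>FG\<^esub>t\<in>T. \<Phi> (pure_tensor FG FH V (monomial F \<one> t) (j (x t))))"
    proof (rule FG.KG.finsum_cong')
      fix t assume t: "t \<in> T"
      then show "monomial F \<one> t \<cdot> coset_part t y = \<Phi> (pure_tensor FG FH V (monomial F \<one> t) (j (x t)))"
        using \<Phi>(3)[of "monomial F \<one> t" "j (x t)"] x[OF t] mono[OF t] RG_FG jV by auto
    next
      show "(\<lambda>t. \<Phi> (pure_tensor FG FH V (monomial F \<one> t) (j (x t)))) \<in> T \<rightarrow> carrier FG"
      proof
        fix t assume t: "t \<in> T"
        have "\<psi> (j (x t)) \<in> carrier FG" using \<psi> jV x(1)[OF t] FH_FG by blast
        then show "\<Phi> (pure_tensor FG FH V (monomial F \<one> t) (j (x t))) \<in> carrier FG"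
          using \<Phi>(3)[of "monomial F \<one> t" "j (x t)"] x[OF t] mono[OF t] RG_FG jV by auto
      qed
    qed simp
    also have "\<dots> \<in> \<Phi> ` induced_image F R G H X j V"
      unfolding im using T(1) mono x(1) by (intro span(3)) auto
    finally show ?thesis .
  qed
  ultimately show "\<Phi> ` induced_image F R G H X j V = induced_sub L" by blast
qed

lemma FH_sub_FG:
  "carrier FH \<subseteq> carrier FG" "\<And>b c. b \<oplus>\<^bsub>FH\<^esub> c = b \<oplus>\<^bsub>FG\<^esub> c"
  by (auto simp: FH_carrier_iff)

lemma induced_coordinate:
  assumes "left_module FH V" "\<psi> \<in> left_module_hom FH V (regular_module FH)" "bij_betw \<psi> (carrier V) (carrier FH)"
  obtains \<Phi> where "bij_betw \<Phi> (carrier (induced_module FG FH V)) (carrier FG)"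
    and "\<And>x y. \<lbrakk>x \<in> carrier (induced_module FG FH V); y \<in> carrier (induced_module FG FH V)\<rbrakk> \<Longrightarrow>
      \<Phi> (x \<oplus>\<^bsub>induced_module FG FH V\<^esub> y) = \<Phi> x \<oplus>\<^bsub>FG\<^esub> \<Phi> y"
    and "\<And>s x. \<lbrakk>s \<in> carrier FG; x \<in> carrier (induced_module FG FH V)\<rbrakk> \<Longrightarrow>
      s \<odot>\<^bsub>induced_module FG FH V\<^esub> x \<in> carrier (induced_module FG FH V) \<and>
      \<Phi> (s \<odot>\<^bsub>induced_module FG FH V\<^esub> x) = s \<cdot> \<Phi> x"
    and "\<And>a v. \<lbrakk>a \<in> carrier FG; v \<in> carrier V\<rbrakk> \<Longrightarrow> \<Phi> (pure_tensor FG FH V a v) = a \<cdot> \<psi> v"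
  by (rule induced_module_free_rank_one[OF FG.group_ring_ring FH_sub_FG(1) assms(1) FH_mult_eq FH_sub_FG(2) FH_one assms(2,3)])
    (assumption+, rule that, assumption+)

text \<open>F[H] is its own coordinate space, with the identity for \<open>\<psi>\<close>, and
  \<open>\<Phi>\<close> undoes the identification of \<open>x\<close> with
  \<open>x \<otimes> 1\<close> made in \<open>induced_subset\<close>.\<close>

lemma induced_subset_eq:
  assumes S: "subgroup S (add_monoid FH)" "\<And>b l. \<lbrakk>b \<in> carrier RH; l \<in> S\<rbrakk> \<Longrightarrow> b \<cdot>\<^sub>H l \<in> S"
  shows "induced_subset F R G H S = induced_sub S"
proof -
  let ?V = "regular_module FH" and ?X = "(regular_module FH)\<lparr>carrier := S\<rparr>"
  have sel: "carrier ?V = carrier FH" "add ?V = add FH" "smult ?V = monoid.mult FH"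
    by (simp_all add: regular_module_def)
  have SF: "S \<subseteq> carrier FH" using subgroup.subset[OF S(1)] by simp
  have "FH\<lparr>carrier := carrier FH\<rparr> = FH" "?V\<lparr>carrier := carrier FH\<rparr> = ?V" by (simp_all add: regular_module_def)
  then have V: "left_module FH ?V"
    using regular_module_left_module[OF sub.FG.group_ring_ring sub.FG.KG.carrier_is_subring] by simp
  have id: "(\<lambda>v. v) \<in> left_module_hom FH ?V (regular_module FH)" by (simp add: left_module_hom_def)
  have id_bij: "bij_betw (\<lambda>v. v) (carrier ?V) (carrier FH)" by (auto simp: bij_betw_def sel)
  obtain \<Phi> where bij: "bij_betw \<Phi> (carrier (induced_module FG FH ?V)) (carrier FG)"
    and add: "\<And>x y. \<lbrakk>x \<in> carrier (induced_module FG FH ?V); y \<in> carrier (induced_module FG FH ?V)\<rbrakk> \<Longrightarrow>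
      \<Phi> (x \<oplus>\<^bsub>induced_module FG FH ?V\<^esub> y) = \<Phi> x \<oplus>\<^bsub>FG\<^esub> \<Phi> y"
    and smult: "\<And>s x. \<lbrakk>s \<in> carrier FG; x \<in> carrier (induced_module FG FH ?V)\<rbrakk> \<Longrightarrow>
      s \<odot>\<^bsub>induced_module FG FH ?V\<^esub> x \<in> carrier (induced_module FG FH ?V) \<and>
      \<Phi> (s \<odot>\<^bsub>induced_module FG FH ?V\<^esub> x) = s \<cdot> \<Phi> x"
    and pure: "\<And>a v. \<lbrakk>a \<in> carrier FG; v \<in> carrier ?V\<rbrakk> \<Longrightarrow> \<Phi> (pure_tensor FG FH ?V a v) = a \<cdot> v"
    by (rule induced_coordinate[OF V id id_bij]) (rule that, assumption+)
  let ?I = "induced_image F R G H ?X (\<lambda>y. y) ?V"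
  have I: "?I \<subseteq> carrier (induced_module FG FH ?V)" "\<Phi> ` ?I = induced_sub S"
  proof -
    have X: "tensor_data RG RH ?X"
      using S(2) subgroup.m_closed[OF S(1)] by (intro RG_RH_tensor_data) (auto simp: regular_module_def)
    have j: "(\<lambda>y. y) \<in> carrier ?X \<rightarrow> carrier ?V" using SF by (auto simp: sel)
    have \<psi>: "(\<lambda>v. v) ` carrier ?V \<subseteq> carrier FH" by (simp add: sel)
    have j': "x \<oplus>\<^bsub>?X\<^esub> y = x \<oplus>\<^bsub>?V\<^esub> y" "b \<odot>\<^bsub>?X\<^esub> x = b \<odot>\<^bsub>?V\<^esub> x" for b x y by simp_all
    have S': "S = (\<lambda>v. v) ` (\<lambda>y. y) ` carrier ?X" by simp
    show "?I \<subseteq> carrier (induced_module FG FH ?V)" "\<Phi> ` ?I = induced_sub S"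
      by (rule induced_image_eq[OF V \<psi> bij_betw_imp_funcset[OF bij] add pure X j j' S' S]; assumption)+
  qed
  have "pure_tensor FG FH ?V x \<one>\<^bsub>FH\<^esub> \<in> ?I \<longleftrightarrow> x \<in> induced_sub S" if x: "x \<in> carrier FG" for x
  proof -
    have one: "\<one>\<^bsub>FH\<^esub> \<in> carrier ?V" using sub.FG.KG.one_closed by (simp add: sel)
    have "pure_tensor FG FH ?V x \<one>\<^bsub>FH\<^esub> \<in> carrier (induced_module FG FH ?V)"
      using tensor_data.pure_tensor_closed[OF left_module_tensor_data[OF FG.group_ring_ring FH_sub_FG(1) V] x one]
      by (simp add: induced_module_def)
    moreover have "\<Phi> (pure_tensor FG FH ?V x \<one>\<^bsub>FH\<^esub>) = x"
      using pure[OF x one] x by (simp add: FH_one)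
    ultimately show ?thesis
      using inj_on_image_mem_iff[OF bij_betw_imp_inj_on[OF bij] _ I(1)] I(2) by metis
  qed
  then show ?thesis
    by (auto simp: induced_subset_def induced_sub_def Let_def)
qed

end

section \<open>Projective induced lattices\<close>

context subgroup_integral_group_ring
begin

text \<open>Left linear functionals on \<open>R[G]L\<close> are right multiplications by elements of \<open>F[G]\<close>.\<close>

lemma projective_imp_order_subset:
  fixes W :: "('g \<Rightarrow> 'a, 'w, 'r) module_scheme"
  assumes L: "subgroup L (add_monoid FH)"
    and stable: "\<And>b l. \<lbrakk>b \<in> carrier RH; l \<in> L\<rbrakk> \<Longrightarrow> b \<cdot>\<^sub>H l \<in> L"
    and frac: "\<And>x. x \<in> carrier F \<Longrightarrow> \<exists>r\<in>R - {\<zero>}. r \<otimes> x \<in> R"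
    and r: "r \<in> R" "r \<noteq> \<zero>" "monomial F r \<one>\<^bsub>G\<^esub> \<in> L"
    and c: "c \<in> R"
    and comm: "comm_group GH" and N: "N \<lhd> G" "N \<subseteq> H"
    and \<Phi>: "bij_betw \<Phi> (carrier W) (carrier FG)"
      "\<And>x y. \<lbrakk>x \<in> carrier W; y \<in> carrier W\<rbrakk> \<Longrightarrow> \<Phi> (x \<oplus>\<^bsub>W\<^esub> y) = \<Phi> x \<oplus>\<^bsub>FG\<^esub> \<Phi> y"
      "\<And>s x. \<lbrakk>s \<in> carrier FG; x \<in> carrier W\<rbrakk> \<Longrightarrow>
        s \<odot>\<^bsub>W\<^esub> x \<in> carrier W \<and> \<Phi> (s \<odot>\<^bsub>W\<^esub> x) = s \<cdot> \<Phi> x"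
    and E: "E \<subseteq> carrier W" "\<Phi> ` E = induced_sub L"
    and proj: "projective_module (FG\<lparr>carrier := coset_order F R c G N\<rparr>) (W\<lparr>carrier := E\<rparr>)"
    and s: "s \<in> carrier FH" "\<And>l. l \<in> L \<Longrightarrow> s \<cdot>\<^sub>H l \<in> L"
  shows "s \<in> coset_order F R c GH N"
proof -
  let ?O = "coset_order F R c G N" and ?m = "\<lambda>d. monomial F d \<one>\<^bsub>G\<^esub>"
  let ?A = "FG\<lparr>carrier := ?O\<rparr>" and ?E = "W\<lparr>carrier := E\<rparr>"
  have rF: "r \<in> carrier F" and cF: "c \<in> carrier F" using r c R_closed(7) by auto
  have L\<Lambda>: "L \<subseteq> induced_sub L" using L_subset_induced_sub[OF L stable] .
  have EW: "x \<in> carrier W" if "x \<in> E" for x using E(1) that by blast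
  have OF: "a \<in> carrier FG" if "a \<in> ?O" for a using coset_order_mem(1)[OF that] .
  have RO: "a \<in> ?O" if "a \<in> carrier RG" for a using RG_subset_coset_order[OF c] that by blast
  \<comment> \<open>The element of the induced lattice with coordinate \<open>r\<close>; an element
    with coordinate 1 need not belong to the lattice.\<close>
  obtain x0 where x0: "x0 \<in> E" "\<Phi> x0 = ?m r" using r(3) L\<Lambda> E(2) by (metis imageE subsetD)
  interpret E: left_module ?A ?E using proj by (simp add: projective_module_def)
  from x0(1) have x0E: "x0 \<in> carrier ?E" by simp
  obtain J :: "'w set" and \<phi> e where J: "finite J" "e \<in> J \<rightarrow> carrier ?E"
    and \<phi>: "\<And>j. j \<in> J \<Longrightarrow> \<phi> j \<in> left_module_hom ?A ?E (regular_module ?A)"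
    and sum: "x0 = (\<Oplus>\<^bsub>?E\<^esub>j\<in>J. \<phi> j x0 \<odot>\<^bsub>?E\<^esub> e j)"
    by (rule projective_dual_basis[OF proj x0E]) (rule that, assumption+)
  have \<phi>cl: "\<phi> j x \<in> ?O" if "j \<in> J" "x \<in> E" for j x
    using \<phi>[OF that(1)] that(2) by (auto simp: left_module_hom_def regular_module_def)
  have \<phi>smult: "\<phi> j (a \<odot>\<^bsub>W\<^esub> x) = a \<cdot> \<phi> j x" if "j \<in> J" "a \<in> ?O" "x \<in> E" for j a x
    using \<phi>[OF that(1)] that(2,3) by (auto simp: left_module_hom_def regular_module_def)
  have eE: "e j \<in> E" if "j \<in> J" for j using J(2) that by auto
  have terms: "\<phi> j x0 \<odot>\<^bsub>W\<^esub> e j \<in> E" if "j \<in> J" for j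
    using E.smult_closed[of "\<phi> j x0" "e j"] \<phi>cl[OF that x0(1)] eE[OF that] by simp
  \<comment> \<open>The coefficient \<open>b j\<close> is the value of the functional
    \<open>\<phi> j\<close> at \<open>x0\<close>, so the dual basis expansion of \<open>x0\<close>
    becomes an expansion of the scalar \<open>r\<close>.\<close>
  show ?thesis
  proof (rule dual_basis_imp_order_subset[OF L stable comm N cF rF r(2) J(1) _ _ _ _ s,
        where b = "\<lambda>j. \<phi> j x0" and e = "\<lambda>j. \<Phi> (e j)"])
    show "(\<lambda>j. \<phi> j x0) \<in> J \<rightarrow> carrier FG" using \<phi>cl x0(1) OF by blast
    show "(\<lambda>j. \<Phi> (e j)) \<in> J \<rightarrow> induced_sub L" using eE E(2) by blast
    have "\<Phi> x0 = \<Phi> (\<Oplus>\<^bsub>?E\<^esub>j\<in>J. \<phi> j x0 \<odot>\<^bsub>W\<^esub> e j)" using sum by (intro arg_cong[of _ _ \<Phi>]) simp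
    also have "\<dots> = (\<Oplus>\<^bsub>FG\<^esub>j\<in>J. \<Phi> (\<phi> j x0 \<odot>\<^bsub>W\<^esub> e j))"
    proof (rule additive_map_finsum[OF E.M.abelian_group_axioms FG.KG.abelian_group_axioms _ _ J(1)])
      show "\<Phi> \<in> carrier ?E \<rightarrow> carrier FG" using \<Phi>(1) EW by (auto simp: bij_betw_def)
      show "\<Phi> (x \<oplus>\<^bsub>?E\<^esub> y) = \<Phi> x \<oplus>\<^bsub>FG\<^esub> \<Phi> y" if "x \<in> carrier ?E" "y \<in> carrier ?E" for x y
        using \<Phi>(2)[of x y] that EW by simp
      show "(\<lambda>j. \<phi> j x0 \<odot>\<^bsub>W\<^esub> e j) \<in> J \<rightarrow> carrier ?E" using terms by auto
    qed
    also have "\<dots> = (\<Oplus>\<^bsub>FG\<^esub>j\<in>J. \<phi> j x0 \<cdot> \<Phi> (e j))"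
    proof (rule FG.KG.finsum_cong')
      fix j assume j: "j \<in> J"
      show "\<Phi> (\<phi> j x0 \<odot>\<^bsub>W\<^esub> e j) = \<phi> j x0 \<cdot> \<Phi> (e j)"
        using \<Phi>(3)[OF OF[OF \<phi>cl[OF j x0(1)]] EW[OF eE[OF j]]] by simp
    next
      show "(\<lambda>j. \<phi> j x0 \<cdot> \<Phi> (e j)) \<in> J \<rightarrow> carrier FG"
      proof
        fix j assume j: "j \<in> J"
        have "\<Phi> (e j) \<in> carrier FG" using bij_betwE[OF \<Phi>(1)] EW[OF eE[OF j]] by blast
        then show "\<phi> j x0 \<cdot> \<Phi> (e j) \<in> carrier FG"
          using OF[OF \<phi>cl[OF j x0(1)]] by (rule FG.KG.m_closed[rotated])
      qed
    qed simp
    finally show "?m r = (\<Oplus>\<^bsub>FG\<^esub>j\<in>J. \<phi> j x0 \<cdot> \<Phi> (e j))" using x0(2) by simp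
  next
    fix j x assume j: "j \<in> J" and x: "x \<in> L"
    obtain x' where x': "x' \<in> E" "\<Phi> x' = x" using x L\<Lambda> E(2) by (metis imageE subsetD)
    have xF: "x \<in> carrier FG" using L_closed[OF L x] by (simp add: FH_carrier_iff)
    \<comment> \<open>The functionals are linear over the order only, and \<open>x\<close> need not
      lie in it; multiplied by \<open>d\<close> it lies in R[G].\<close>
    obtain d where d: "d \<in> R" "d \<noteq> \<zero>" "?m d \<cdot> x \<in> carrier RG"
      using common_denominator[OF frac xF] by blast
    have dF: "d \<in> carrier F" using R_closed(7)[OF d(1)] .
    have mF: "?m d \<in> carrier FG" "?m r \<in> carrier FG" using dF rF by (simp_all add: FG.monomial_closed)
    have rd: "?m d \<cdot> ?m r \<in> ?O"
      using RG_mult_closed[OF monomial_RG monomial_RG] d(1) r(1) RO by simp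
    have y: "\<phi> j x' \<in> ?O" "\<phi> j x' \<in> carrier FG" and b: "\<phi> j x0 \<in> carrier FG"
      using \<phi>cl[OF j] x'(1) x0(1) OF by auto
    have dx: "?m d \<cdot> x \<in> ?O" using RO d(3) .
    \<comment> \<open>Both \<open>(d x) x0\<close> and \<open>(d r) x'\<close> have the coordinate
      \<open>d r x\<close>, so they are equal. The functional pulls out \<open>d x\<close> and
      \<open>d r\<close>, and cancelling \<open>d\<close> leaves
      \<open>x b\<^sub>j = r \<phi>\<^sub>j(x')\<close>: up to the factor \<open>r\<close>, the
      functional is right multiplication.\<close>
    have "\<Phi> ((?m d \<cdot> x) \<odot>\<^bsub>W\<^esub> x0) = (?m d \<cdot> x) \<cdot> ?m r"
      using \<Phi>(3)[OF OF[OF dx] EW[OF x0(1)]] x0(2) by simp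
    also have "\<dots> = (?m d \<cdot> ?m r) \<cdot> x"
      using mF xF FG.scalar_central[OF rF xF] by (simp add: FG.KG.m_assoc)
    also have "\<dots> = \<Phi> ((?m d \<cdot> ?m r) \<odot>\<^bsub>W\<^esub> x')"
      using \<Phi>(3)[OF OF[OF rd] EW[OF x'(1)]] x'(2) by simp
    finally have "(?m d \<cdot> x) \<odot>\<^bsub>W\<^esub> x0 = (?m d \<cdot> ?m r) \<odot>\<^bsub>W\<^esub> x'"
      using \<Phi>(3)[OF OF[OF rd] EW[OF x'(1)]] \<Phi>(3)[OF OF[OF dx] EW[OF x0(1)]]
        bij_betw_imp_inj_on[OF \<Phi>(1)] by (metis inj_onD)
    then have "\<phi> j ((?m d \<cdot> x) \<odot>\<^bsub>W\<^esub> x0) = \<phi> j ((?m d \<cdot> ?m r) \<odot>\<^bsub>W\<^esub> x')" by simp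
    then have "(?m d \<cdot> x) \<cdot> \<phi> j x0 = (?m d \<cdot> ?m r) \<cdot> \<phi> j x'"
      using \<phi>smult[OF j dx x0(1)] \<phi>smult[OF j rd x'(1)] by simp
    then have "?m d \<cdot> (x \<cdot> \<phi> j x0) = ?m d \<cdot> (?m r \<cdot> \<phi> j x')"
      using mF xF b y by (simp add: FG.KG.m_assoc)
    then have "d \<odot>\<^bsub>FG\<^esub> (x \<cdot> \<phi> j x0) = d \<odot>\<^bsub>FG\<^esub> (r \<odot>\<^bsub>FG\<^esub> \<phi> j x')"
      using FG.group_ring_smult_eq_mult dF rF xF b y mF
      by (simp add: FG.group_ring_smult_closed del: group_ring_smult)
    then have "d \<otimes> (x \<cdot> \<phi> j x0) g = d \<otimes> (r \<odot>\<^bsub>FG\<^esub> \<phi> j x') g" for g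
      unfolding group_ring_smult by (rule fun_cong)
    moreover have "(x \<cdot> \<phi> j x0) g \<in> carrier F" "(r \<odot>\<^bsub>FG\<^esub> \<phi> j x') g \<in> carrier F" for g
      using xF b y rF by (auto simp del: group_ring_smult
          intro!: FG.coeff_closed FG.group_ring_smult_closed)
    ultimately have "x \<cdot> \<phi> j x0 = r \<odot>\<^bsub>FG\<^esub> \<phi> j x'"
      using d(2) dF m_lcancel by blast
    then show "\<exists>y\<in>?O. x \<cdot> \<phi> j x0 = r \<odot>\<^bsub>FG\<^esub> y" using y(1) by blast
  qed
qed

end

theorem theorem7p1:
  fixes F :: "'a ring" and R :: "'a set" and p :: 'a
    and G :: "'g monoid" and H P :: "'g set"
    and M :: "('g \<Rightarrow> 'a, 'm) module" and n :: nat
  assumes "fraction_field_of F R"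
    and "discrete_valuation_ring (F\<lparr>carrier := R\<rparr>)"
    and "char_zero F"
    and "uniformizer (F\<lparr>carrier := R\<rparr>) p"
    and "finite (carrier ((F\<lparr>carrier := R\<rparr>) Quot (PIdl\<^bsub>F\<lparr>carrier := R\<rparr>\<^esub> p)))"
    and "group G" and "finite (carrier G)" and "subgroup H G"
    and "group_lattice (F\<lparr>carrier := R\<rparr>) (G\<lparr>carrier := H\<rparr>) M"
    and "free_of_rank (group_ring F (G\<lparr>carrier := H\<rparr>)) (scalar_ext F R (G\<lparr>carrier := H\<rparr>) M) 1"
    and "0 < n" and "subgroup P (G\<lparr>carrier := H\<rparr>)"
    and "lattice_order F R (G\<lparr>carrier := H\<rparr>) M = trace_set F R p n (G\<lparr>carrier := H\<rparr>) P"
  shows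
    "induced_subset F R G H (lattice_order F R (G\<lparr>carrier := H\<rparr>) M) = trace_set F R p n G P
     \<and> induced_lattice_order F R G H M = trace_set F R p n G (normal_closure G P)
     \<and> (subring (induced_subset F R G H (lattice_order F R (G\<lparr>carrier := H\<rparr>) M)) (group_ring F G)
          \<longleftrightarrow> P \<lhd> G)
     \<and> (P \<lhd> G \<and>
         free_module
           ((group_ring F (G\<lparr>carrier := H\<rparr>))\<lparr>carrier := lattice_order F R (G\<lparr>carrier := H\<rparr>) M\<rparr>)
           ((scalar_ext F R (G\<lparr>carrier := H\<rparr>) M)\<lparr>carrier := lattice_in_ext F R (G\<lparr>carrier := H\<rparr>) M\<rparr>)
         \<longrightarrow>
         free_module
           ((group_ring F G)\<lparr>carrier := induced_lattice_order F R G H M\<rparr>)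
           ((regular_module (group_ring F G))
              \<lparr>carrier := induced_subset F R G H (lattice_order F R (G\<lparr>carrier := H\<rparr>) M)\<rparr>))
     \<and> (comm_group (G\<lparr>carrier := H\<rparr>) \<and> H \<lhd> G \<and>
         projective_module
           ((group_ring F G)\<lparr>carrier := induced_lattice_order F R G H M\<rparr>)
           ((induced_ambient F R G H M)\<lparr>carrier := induced_lattice F R G H M\<rparr>)
         \<longrightarrow> P \<lhd> G)"
proof -
  let ?H = "G\<lparr>carrier := H\<rparr>"
  have F: "field F" and R: "subring R F" using assms(1) by (auto simp: fraction_field_of_def)
  interpret F: field F by (rule F)
  interpret subgroup_integral_group_ring F G R H
    using F F.cring_axioms R assms(6-8)
    by (simp add: subgroup_integral_group_ring_def subgroup_integral_group_ring_axioms_def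
        integral_group_ring_def integral_group_ring_axioms_def finite_group_ring_def finite_group_ring_axioms_def)
  define c where "c = p [^]\<^bsub>F\<^esub> n"
  note p = uniformizer_power_inverse_not_mem[OF F R assms(2,4)]
  have c: "c \<in> R" "c \<noteq> \<zero>\<^bsub>F\<^esub>" "c \<in> carrier F" "inv\<^bsub>F\<^esub> c \<notin> R"
    using R_power[OF p(1,2), of n] p(3)[OF assms(11)] R_closed(7) by (auto simp: c_def)
  have frac: "\<exists>r\<in>R - {\<zero>\<^bsub>F\<^esub>}. r \<otimes>\<^bsub>F\<^esub> x \<in> R" if x: "x \<in> carrier F" for x
  proof -
    obtain a b where ab: "a \<in> R" "b \<in> R" "b \<noteq> \<zero>\<^bsub>F\<^esub>" "x = a \<otimes>\<^bsub>F\<^esub> inv\<^bsub>F\<^esub> b"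
      using assms(1) x unfolding fraction_field_of_def by blast
    have "b \<in> Units F" using ab R_closed(7) by (simp add: F.field_Units)
    then have "b \<otimes>\<^bsub>F\<^esub> x = a"
      using ab R_closed(7) by (simp add: F.m_lcomm F.Units_r_inv)
    then show ?thesis using ab by blast
  qed
  have PH: "P \<subseteq> H" using subgroup.subset[OF assms(12)] by simp
  have P: "subgroup P G" using FG.G.incl_subgroup[OF assms(8,12)] .
  have PG: "P \<subseteq> carrier G" using subgroup.subset[OF P] .
  let ?N = "normal_closure G P"
  have N: "?N \<lhd> G" "P \<subseteq> ?N"
    using FG.G.normal_closure_normal[OF PG] FG.G.normal_closure_superset[OF PG] by auto
  have NP: "P \<lhd> G \<longleftrightarrow> ?N = P"
    using N FG.G.normal_closure_minimal[OF PG, of P] by auto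
  note order_eq = sub.trace_set_eq_coset_order[OF assms(12) p(1,2), of n, folded c_def]
  have order: "lattice_order F R ?H M = coset_order F R c ?H P" using assms(13) order_eq by simp
  have tr: "trace_set F R p n G Q = coset_order F R c G Q" if "subgroup Q G" for Q
    using trace_set_eq_coset_order[OF that p(1,2), of n] by (simp add: c_def)
  have trN: "trace_set F R p n G ?N = coset_order F R c G ?N" using tr normal_imp_subgroup[OF N(1)] .

  let ?V = "scalar_ext F R ?H M" and ?emb = "scalar_ext_emb F R ?H M"
  have M: "left_module RH M" using assms(9) by (simp add: group_lattice_def)
  \<comment> \<open>The module laws for FM are taken from the freeness hypothesis, which includes
    them, and not from the tensor construction.\<close>
  have V: "left_module FH ?V" using assms(10) by (simp add: free_of_rank_def free_on_def)
  interpret M: left_module RH M by (rule M)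
  interpret V: left_module FH ?V by (rule V)
  obtain \<psi> where \<psi>: "\<psi> \<in> left_module_hom FH ?V (regular_module FH)" "bij_betw \<psi> (carrier ?V) (carrier FH)"
    using free_rank_one_coordinate[OF sub.FG.group_ring_ring assms(10)] .
  have \<psi>add: "\<psi> (v \<oplus>\<^bsub>?V\<^esub> w) = \<psi> v \<oplus>\<^bsub>FH\<^esub> \<psi> w" if "v \<in> carrier ?V" "w \<in> carrier ?V" for v w
    using \<psi>(1) that by (simp add: left_module_hom_def regular_module_def)
  have \<psi>smult: "\<psi> (a \<odot>\<^bsub>?V\<^esub> v) = a \<otimes>\<^bsub>FH\<^esub> \<psi> v" if "a \<in> carrier FH" "v \<in> carrier ?V" for a v
    using \<psi>(1) that by (simp add: left_module_hom_def regular_module_def)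
  have \<psi>cl: "\<psi> v \<in> carrier FH" if "v \<in> carrier ?V" for v
    using \<psi>(2) that by (auto simp: bij_betw_def)
  note emb_closed = sub.ext_emb_closed[OF M V] and emb_add = sub.ext_emb_add[OF M V]
    and emb_smult = sub.ext_emb_smult[OF M V]
  define L where "L = \<psi> ` ?emb ` carrier M"
  have "lattice_order F R ?H M = {a \<in> carrier FH. \<forall>l\<in>L. a \<otimes>\<^bsub>FH\<^esub> l \<in> L}"
    unfolding lattice_order_def L_def lattice_in_ext_def
    using emb_closed \<psi>smult V.smult_closed
    by (intro associated_order_transport[OF bij_betw_imp_inj_on[OF \<psi>(2)]]) auto
  then have L_order: "{a \<in> carrier FH. \<forall>l\<in>L. a \<otimes>\<^bsub>FH\<^esub> l \<in> L} = coset_order F R c ?H P"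
    using order by simp
  \<comment> \<open>R[H] lies in the order of \<open>L\<close>, as the hypothesis on the order of M
    shows; so stability under R[H] can be read off.\<close>
  have stable: "b \<otimes>\<^bsub>FH\<^esub> l \<in> L" if "b \<in> carrier RH" "l \<in> L" for b l
    using sub.RG_subset_coset_order[OF c(1), of P] that unfolding L_order[symmetric] by blast
  have LF: "L \<subseteq> carrier FH" using emb_closed \<psi>cl by (auto simp: L_def)
  \<comment> \<open>Zero and negatives come from stability, as multiples by the elements 0 and -1 of
    R[H].\<close>
  have L: "subgroup L (add_monoid FH)"
  proof (rule sub.FG.KG.add_subgroupI[OF LF])
    have l: "\<psi> (?emb \<zero>\<^bsub>M\<^esub>) \<in> L" by (auto simp: L_def)
    have "\<zero>\<^bsub>FH\<^esub> \<in> carrier RH" by (auto simp: sub.RG_carrier_iff group_ring_carrier_iff R_closed)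
    then have "\<zero>\<^bsub>FH\<^esub> \<otimes>\<^bsub>FH\<^esub> \<psi> (?emb \<zero>\<^bsub>M\<^esub>) \<in> L" using stable l by blast
    moreover have "\<zero>\<^bsub>FH\<^esub> \<otimes>\<^bsub>FH\<^esub> \<psi> (?emb \<zero>\<^bsub>M\<^esub>) = \<zero>\<^bsub>FH\<^esub>"
      using l LF by (intro sub.FG.KG.l_null) blast
    ultimately show "\<zero>\<^bsub>FH\<^esub> \<in> L" by simp
  next
    fix x y assume "x \<in> L" "y \<in> L"
    then obtain m m' where "m \<in> carrier M" "m' \<in> carrier M" "x = \<psi> (?emb m)" "y = \<psi> (?emb m')"
      by (auto simp: L_def)
    then have "x \<oplus>\<^bsub>FH\<^esub> y = \<psi> (?emb (m \<oplus>\<^bsub>M\<^esub> m'))" "m \<oplus>\<^bsub>M\<^esub> m' \<in> carrier M"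
      using emb_add emb_closed \<psi>add by auto
    then show "x \<oplus>\<^bsub>FH\<^esub> y \<in> L" unfolding L_def by blast
  next
    fix x assume x: "x \<in> L"
    then have xF: "x \<in> carrier FH" using LF by blast
    have "\<ominus>\<^bsub>FH\<^esub> \<one>\<^bsub>FH\<^esub> \<in> carrier RH"
      using sub.FG.KG.a_inv_closed[OF sub.FG.KG.one_closed] sub.FG.KG.one_closed
      by (auto simp: sub.RG_carrier_iff sub.FG.group_ring_a_inv)
        (auto simp: group_ring_one monomial_def R_closed)
    then have "(\<ominus>\<^bsub>FH\<^esub> \<one>\<^bsub>FH\<^esub>) \<otimes>\<^bsub>FH\<^esub> x \<in> L" using stable x by blast
    then show "\<ominus>\<^bsub>FH\<^esub> x \<in> L"
      using xF sub.FG.KG.l_minus[OF sub.FG.KG.one_closed xF] by simp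
  qed

  let ?W = "induced_module FG FH ?V"
  obtain \<Phi> where \<Phi>: "bij_betw \<Phi> (carrier ?W) (carrier FG)"
    and \<Phi>add: "\<And>x y. \<lbrakk>x \<in> carrier ?W; y \<in> carrier ?W\<rbrakk> \<Longrightarrow> \<Phi> (x \<oplus>\<^bsub>?W\<^esub> y) = \<Phi> x \<oplus>\<^bsub>FG\<^esub> \<Phi> y"
    and \<Phi>smult: "\<And>s x. \<lbrakk>s \<in> carrier FG; x \<in> carrier ?W\<rbrakk> \<Longrightarrow>
      s \<odot>\<^bsub>?W\<^esub> x \<in> carrier ?W \<and> \<Phi> (s \<odot>\<^bsub>?W\<^esub> x) = s \<otimes>\<^bsub>FG\<^esub> \<Phi> x"
    and \<Phi>pure: "\<And>a v. \<lbrakk>a \<in> carrier FG; v \<in> carrier ?V\<rbrakk> \<Longrightarrow> \<Phi> (pure_tensor FG FH ?V a v) = a \<otimes>\<^bsub>FG\<^esub> \<psi> v"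
    by (rule induced_coordinate[OF V \<psi>]) (rule that, assumption+)
  have ambient: "induced_ambient F R G H M = ?W" by (simp add: induced_ambient_def)
  let ?E = "induced_lattice F R G H M"
  have E: "?E \<subseteq> carrier ?W" "\<Phi> ` ?E = induced_sub L"
  proof -
    have X: "tensor_data RG RH M" using M.smult_closed by (intro RG_RH_tensor_data) auto
    have j: "?emb \<in> carrier M \<rightarrow> carrier ?V" using emb_closed by blast
    have \<psi>V: "\<psi> ` carrier ?V \<subseteq> carrier FH" using \<psi>cl by blast
    show "?E \<subseteq> carrier ?W" "\<Phi> ` ?E = induced_sub L"
      unfolding induced_lattice_def
      by (rule induced_image_eq[OF V \<psi>V bij_betw_imp_funcset[OF \<Phi>] \<Phi>add \<Phi>pure X j emb_add emb_smult L_def L stable]; assumption)+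
  qed

  have i: "induced_subset F R G H (lattice_order F R ?H M) = coset_order F R c G P"
  proof -
    have "subgroup (coset_order F R c ?H P) (add_monoid FH)" using sub.coset_order_subgroup[OF c(3)] .
    moreover have "b \<otimes>\<^bsub>FH\<^esub> l \<in> coset_order F R c ?H P" if b: "b \<in> carrier RH" and l: "l \<in> coset_order F R c ?H P" for b l
      using subringE(6)[OF sub.FG.KG.multiplier_subring[OF L, unfolded L_order]]
        sub.RG_subset_coset_order[OF c(1), of P] b l by blast
    ultimately show ?thesis
      unfolding order using induced_subset_eq induced_sub_coset_order[OF PH] by simp
  qed
  have order_G: "{s \<in> carrier FG. \<forall>x\<in>induced_sub L. s \<otimes>\<^bsub>FG\<^esub> x \<in> induced_sub L} = coset_order F R c G ?N"
    by (rule induced_sub_order[OF L stable P PH L_order])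
  have ii: "induced_lattice_order F R G H M = coset_order F R c G ?N"
  proof -
    have "induced_lattice_order F R G H M =
        {s \<in> carrier FG. \<forall>x\<in>induced_sub L. s \<otimes>\<^bsub>FG\<^esub> x \<in> induced_sub L}"
      unfolding induced_lattice_order_def ambient E(2)[symmetric]
      by (rule associated_order_transport[OF bij_betw_imp_inj_on[OF \<Phi>] E(1) \<Phi>smult])
    then show ?thesis using order_G by simp
  qed
  have subring_N: "subring (coset_order F R c G ?N) FG"
    using FG.KG.multiplier_subring[OF induced_sub_subgroup[OF L]] unfolding order_G .
  have iii: "subring (coset_order F R c G P) FG \<longleftrightarrow> P \<lhd> G"
    using coset_order_subring_imp_normal[OF P c(1,2,4)] subring_N NP by auto
  \<comment> \<open>For normal \<open>P\<close> the induced order and the order of the induced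
    lattice are the same ring, regarded as a module over itself.\<close>
  have iv: "free_module (FG\<lparr>carrier := coset_order F R c G ?N\<rparr>) ((regular_module FG)\<lparr>carrier := coset_order F R c G P\<rparr>)"
    if "P \<lhd> G"
    using regular_module_free[OF FG.group_ring_ring subring_N] NP that by simp
  have v: "P \<lhd> G" if comm: "comm_group ?H" and normal: "H \<lhd> G"
    and proj: "projective_module (FG\<lparr>carrier := coset_order F R c G ?N\<rparr>) (?W\<lparr>carrier := ?E\<rparr>)"
  proof -
    \<comment> \<open>Here normality of \<open>H\<close> enters: it confines the normal closure of
      \<open>P\<close> to \<open>H\<close>.\<close>
    have NH: "?N \<subseteq> H" using FG.G.normal_closure_minimal[OF PG normal PH] .
    have "\<one>\<^bsub>FH\<^esub> \<in> \<psi> ` carrier ?V"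
      using bij_betw_imp_surj_on[OF \<psi>(2)] sub.FG.KG.one_closed by simp
    then obtain v where v: "\<one>\<^bsub>FH\<^esub> = \<psi> v" "v \<in> carrier ?V"
      by (rule imageE) (rule that, assumption+)
    \<comment> \<open>\<open>r\<close> clears the denominator of the basis vector \<open>v\<close>.
      As \<open>v\<close> has coordinate 1, the scalar \<open>r\<close> itself lies in
      \<open>L\<close>.\<close>
    obtain r where r: "r \<in> R" "r \<noteq> \<zero>\<^bsub>F\<^esub>" "monomial F r \<one>\<^bsub>?H\<^esub> \<odot>\<^bsub>?V\<^esub> v \<in> ?emb ` carrier M"
      using sub.ext_emb_denominator[OF M V frac v(2)] by blast
    have m: "monomial F r \<one>\<^bsub>?H\<^esub> \<in> carrier FH"
      using sub.FG.monomial_closed[OF R_closed(7)[OF r(1)] sub.FG.G.one_closed] .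
    have "\<psi> (monomial F r \<one>\<^bsub>?H\<^esub> \<odot>\<^bsub>?V\<^esub> v) = monomial F r \<one>\<^bsub>?H\<^esub>"
      using \<psi>smult[OF m v(2)] v(1)[symmetric] m by simp
    then have rL: "monomial F r \<one>\<^bsub>G\<^esub> \<in> L" using r(3) by (auto simp: L_def intro: rev_image_eqI)
    \<comment> \<open>This is \<open>c\<^sup>-\<^sup>1Tr\<^sub>P\<close>. It stabilises
      \<open>L\<close> because it lies in the order of \<open>P\<close>; projectivity puts it into
      the order of \<open>?N\<close>, and its coefficients then bound \<open>?N\<close> by
      \<open>P\<close>.\<close>
    let ?q = "\<lambda>x. if x \<in> P then inv\<^bsub>F\<^esub> c else \<zero>\<^bsub>F\<^esub>"
    have "?q \<in> coset_order F R c ?H P" using sub.scaled_trace_mem[OF assms(12) c(3,2)] .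
    then have q: "?q \<in> carrier FH" "\<And>l. l \<in> L \<Longrightarrow> ?q \<otimes>\<^bsub>FH\<^esub> l \<in> L"
      unfolding L_order[symmetric] by auto
    have "?q \<in> coset_order F R c ?H ?N"
      by (rule projective_imp_order_subset[OF L stable frac r(1,2) rL c(1) comm N(1) NH \<Phi> \<Phi>add \<Phi>smult E proj q])
    then have "?N \<subseteq> P"
      using sub.coset_order_trace_imp_subset[of P c ?N] c NH subgroup.one_closed[OF P] by simp
    then show "P \<lhd> G" using NP N(2) by auto
  qed
  show ?thesis
    unfolding i ii tr[OF P] trN ambient using iii iv v by blast
qed

end
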